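(* Let $G$ be a group and $k$ a commutative ring. Let $V$ be an $\mathrm{FI}_G$-module over $k$ which is generated in finite degree. Then $V$ is degree-wise coherent if and only if $\operatorname{td}(V) < \infty$.
   Context: $\mathrm{FI}_G$ is the category whose objects are the sets $[n]=\{1,\ldots,n\}$, $n \ge 0$, and whose morphisms $(f,g):[n]\to[m]$ are pairs of an injection $f:[n]\to[m]$ and an arbitrary map of sets $g:[n]\to G$; composition is $(f,g)\circ(h,g') = (f\circ h, g'')$ with $g''(x) = g'(x)\cdot g(h(x))$. Write $G_r = \operatorname{End}_{\mathrm{FI}_G}([r]) = \mathfrak{S}_r \wr G$. An $\mathrm{FI}_G$-module over $k$ is a functor $V:\mathrm{FI}_G \to k\text{-Mod}$; write $V_n = V([n])$ and $(f,g)_\ast = V(f,g)$; when $n<m$ these maps are called transition maps. The degree of $V$ is $\deg(V)=\sup\{n \mid V_n \neq 0\}$, with $\sup\emptyset = -\infty$. For a $kG_r$-module $W$, the free module $M(W)$ has $M(W)_n = k[\operatorname{Hom}_{\mathrm{FI}_G}([r],[n])]\otimes_{kG_r} W$, with induced maps acting by composition on the first factor; it is said to be generated in degree $r$. A free module is a direct sum of such modules, and its generating degree is the supremum of the degrees $r$ of its summands. $V$ is generated in finite degree if there is $N$ such that no proper submodule of $V$ contains $\bigsqcup_{n\le N} V_n$. $V$ is degree-wise coherent if there is an exact sequence $0\to K\to F\to V\to 0$ with $F$ a free module of finite generating degree and $K$ generated in finite degree. An element $v\in V_n$ is torsion if $(f,g)_\ast(v)=0$ for some morphism $(f,g):[n]\to[m]$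 of $\mathrm{FI}_G$. Let $V_T$ denote the maximal torsion submodule of $V$ (the submodule of all torsion elements). The torsion degree is $\operatorname{td}(V) = \deg(V_T)$. *)

theory Defs
  imports "HOL-Algebra.Module" "HOL-Library.FuncSet" "HOL-Library.Extended_Real"
begin

type_synonym 'g fimor = "(nat \<Rightarrow> nat) \<times> (nat \<Rightarrow> 'g)"

definition fig_hom :: "('g,'b) monoid_scheme \<Rightarrow> nat \<Rightarrow> nat \<Rightarrow> 'g fimor set" where
  "fig_hom G n m = {(f,g). f \<in> {1..n} \<rightarrow>\<^sub>E {1..m} \<and> inj_on f {1..n} \<and> g \<in> {1..n} \<rightarrow>\<^sub>E carrier G}"

definition fig_id :: "('g,'b) monoid_scheme \<Rightarrow> nat \<Rightarrow> 'g fimor" where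
  "fig_id G n = (\<lambda>x\<in>{1..n}. x, \<lambda>x\<in>{1..n}. \<one>\<^bsub>G\<^esub>)"

definition fig_comp :: "('g,'b) monoid_scheme \<Rightarrow> nat \<Rightarrow> 'g fimor \<Rightarrow> 'g fimor \<Rightarrow> 'g fimor" where
  "fig_comp G r \<phi> \<psi> = (case \<phi> of (f,g) \<Rightarrow> case \<psi> of (h,g') \<Rightarrow>
      (\<lambda>x\<in>{1..r}. f (h x), \<lambda>x\<in>{1..r}. g' x \<otimes>\<^bsub>G\<^esub> g (h x)))"

record ('g,'k,'v) fig_module =
  fi_space :: "nat \<Rightarrow> ('k,'v) module"
  fi_map :: "nat \<Rightarrow> nat \<Rightarrow> 'g fimor \<Rightarrow> 'v \<Rightarrow> 'v"

definition klinear :: "('k,'a) ring_scheme \<Rightarrow> ('k,'v) module \<Rightarrow> ('k,'w) module \<Rightarrow> ('v \<Rightarrow> 'w) \<Rightarrow> bool" where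
  "klinear R M N h \<longleftrightarrow> h \<in> carrier M \<rightarrow> carrier N
     \<and> (\<forall>x\<in>carrier M. \<forall>y\<in>carrier M. h (x \<oplus>\<^bsub>M\<^esub> y) = h x \<oplus>\<^bsub>N\<^esub> h y)
     \<and> (\<forall>a\<in>carrier R. \<forall>x\<in>carrier M. h (a \<odot>\<^bsub>M\<^esub> x) = a \<odot>\<^bsub>N\<^esub> h x)"

definition is_fig_module :: "('g,'b) monoid_scheme \<Rightarrow> ('k,'a) ring_scheme \<Rightarrow> ('g,'k,'v) fig_module \<Rightarrow> bool" where
  "is_fig_module G R V \<longleftrightarrow>
     (\<forall>n. Module.module R (fi_space V n)) \<and>
     (\<forall>n m \<phi>. \<phi> \<in> fig_hom G n m \<longrightarrow> klinear R (fi_space V n) (fi_space V m) (fi_map V n m \<phi>)) \<and>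
     (\<forall>n. \<forall>v\<in>carrier (fi_space V n). fi_map V n n (fig_id G n) v = v) \<and>
     (\<forall>r n m \<phi> \<psi>. \<phi> \<in> fig_hom G n m \<longrightarrow> \<psi> \<in> fig_hom G r n \<longrightarrow>
        (\<forall>v\<in>carrier (fi_space V r).
           fi_map V r m (fig_comp G r \<phi> \<psi>) v = fi_map V n m \<phi> (fi_map V r n \<psi> v)))"

definition fig_submodule :: "('g,'b) monoid_scheme \<Rightarrow> ('k,'a) ring_scheme \<Rightarrow> ('g,'k,'v) fig_module \<Rightarrow> (nat \<Rightarrow> 'v set) \<Rightarrow> bool" where
  "fig_submodule G R V W \<longleftrightarrow>
     (\<forall>n. submodule (W n) R (fi_space V n)) \<and>
     (\<forall>n m \<phi> v. \<phi> \<in> fig_hom G n m \<longrightarrow> v \<in> W n \<longrightarrow> fi_map V n m \<phi> v \<in> W m)"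

definition restrict_fig :: "('g,'k,'v) fig_module \<Rightarrow> (nat \<Rightarrow> 'v set) \<Rightarrow> ('g,'k,'v) fig_module" where
  "restrict_fig V W = V\<lparr>fi_space := (\<lambda>n. (fi_space V n)\<lparr>carrier := W n\<rparr>)\<rparr>"

definition gen_fin_degree :: "('g,'b) monoid_scheme \<Rightarrow> ('k,'a) ring_scheme \<Rightarrow> ('g,'k,'v) fig_module \<Rightarrow> bool" where
  "gen_fin_degree G R V \<longleftrightarrow> (\<exists>N::nat. \<forall>W. fig_submodule G R V W \<and> (\<forall>n\<le>N. carrier (fi_space V n) \<subseteq> W n)
       \<longrightarrow> (\<forall>n. W n = carrier (fi_space V n)))"

text \<open>deg(V) = sup {n | V_n \<noteq> 0} in the extended reals (sup of the empty set is -\<infinity>).\<close>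
definition fig_deg :: "('g,'k,'v) fig_module \<Rightarrow> ereal" where
  "fig_deg V = Sup {ereal (real n) | n. carrier (fi_space V n) \<noteq> {\<zero>\<^bsub>fi_space V n\<^esub>}}"

definition is_torsion :: "('g,'b) monoid_scheme \<Rightarrow> ('g,'k,'v) fig_module \<Rightarrow> nat \<Rightarrow> 'v \<Rightarrow> bool" where
  "is_torsion G V n v \<longleftrightarrow> v \<in> carrier (fi_space V n) \<and>
     (\<exists>m \<phi>. \<phi> \<in> fig_hom G n m \<and> fi_map V n m \<phi> v = \<zero>\<^bsub>fi_space V m\<^esub>)"

definition torsion_submodule :: "('g,'b) monoid_scheme \<Rightarrow> ('g,'k,'v) fig_module \<Rightarrow> ('g,'k,'v) fig_module" where
  "torsion_submodule G V = restrict_fig V (\<lambda>n. {v. is_torsion G V n v})"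

definition td :: "('g,'b) monoid_scheme \<Rightarrow> ('g,'k,'v) fig_module \<Rightarrow> ereal" where
  "td G V = fig_deg (torsion_submodule G V)"

definition kGr_module :: "('g,'b) monoid_scheme \<Rightarrow> ('k,'a) ring_scheme \<Rightarrow> nat \<Rightarrow> ('k,'w) module \<Rightarrow> ('g fimor \<Rightarrow> 'w \<Rightarrow> 'w) \<Rightarrow> bool" where
  "kGr_module G R r W wact \<longleftrightarrow> Module.module R W \<and>
     (\<forall>\<sigma>\<in>fig_hom G r r. klinear R W W (wact \<sigma>)) \<and>
     (\<forall>w\<in>carrier W. wact (fig_id G r) w = w) \<and>
     (\<forall>\<sigma>\<in>fig_hom G r r. \<forall>\<tau>\<in>fig_hom G r r. \<forall>w\<in>carrier W.
        wact (fig_comp G r \<sigma> \<tau>) w = wact \<sigma> (wact \<tau> w))"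

text \<open>Free k-module on a set S: finitely supported k-valued functions vanishing off S.\<close>
definition fsupp :: "('k,'a) ring_scheme \<Rightarrow> 'x set \<Rightarrow> ('x \<Rightarrow> 'k) set" where
  "fsupp R S = {c. (\<forall>x. c x \<in> carrier R) \<and> (\<forall>x. x \<notin> S \<longrightarrow> c x = \<zero>\<^bsub>R\<^esub>) \<and> finite {x. c x \<noteq> \<zero>\<^bsub>R\<^esub>}}"

definition fadd :: "('k,'a) ring_scheme \<Rightarrow> ('x \<Rightarrow> 'k) \<Rightarrow> ('x \<Rightarrow> 'k) \<Rightarrow> 'x \<Rightarrow> 'k" where
  "fadd R c d = (\<lambda>x. c x \<oplus>\<^bsub>R\<^esub> d x)"
definition fneg :: "('k,'a) ring_scheme \<Rightarrow> ('x \<Rightarrow> 'k) \<Rightarrow> 'x \<Rightarrow> 'k" where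
  "fneg R c = (\<lambda>x. \<ominus>\<^bsub>R\<^esub> c x)"
definition fsmult :: "('k,'a) ring_scheme \<Rightarrow> 'k \<Rightarrow> ('x \<Rightarrow> 'k) \<Rightarrow> 'x \<Rightarrow> 'k" where
  "fsmult R a c = (\<lambda>x. a \<otimes>\<^bsub>R\<^esub> c x)"
definition fzero :: "('k,'a) ring_scheme \<Rightarrow> 'x \<Rightarrow> 'k" where
  "fzero R = (\<lambda>x. \<zero>\<^bsub>R\<^esub>)"
definition fdelta :: "('k,'a) ring_scheme \<Rightarrow> 'x \<Rightarrow> 'x \<Rightarrow> 'k" where
  "fdelta R x = (\<lambda>y. if y = x then \<one>\<^bsub>R\<^esub> else \<zero>\<^bsub>R\<^esub>)"

definition fspan :: "('k,'a) ring_scheme \<Rightarrow> 'x set \<Rightarrow> ('x \<Rightarrow> 'k) set \<Rightarrow> ('x \<Rightarrow> 'k) set" where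
  "fspan R S X = \<Inter>{N. X \<subseteq> N \<and> N \<subseteq> fsupp R S \<and> fzero R \<in> N \<and>
      (\<forall>c\<in>N. \<forall>d\<in>N. fadd R c d \<in> N) \<and> (\<forall>a\<in>carrier R. \<forall>c\<in>N. fsmult R a c \<in> N)}"

text \<open>Relations defining k[Hom([r],[n])] \<otimes>_{kG_r} W as a quotient of the free k-module
  on Hom([r],[n]) \<times> W: additivity and k-linearity in W, and the balancing relation
  (\<phi> \<circ> \<sigma>) \<otimes> w = \<phi> \<otimes> (\<sigma> w) for \<sigma> \<in> G_r.\<close>
definition tens_rels :: "('g,'b) monoid_scheme \<Rightarrow> ('k,'a) ring_scheme \<Rightarrow> nat \<Rightarrow> ('k,'w) module \<Rightarrow> ('g fimor \<Rightarrow> 'w \<Rightarrow> 'w) \<Rightarrow> nat \<Rightarrow> ('g fimor \<times> 'w \<Rightarrow> 'k) set" where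
  "tens_rels G R r W wact n =
     {fadd R (fdelta R (\<phi>, w \<oplus>\<^bsub>W\<^esub> w')) (fneg R (fadd R (fdelta R (\<phi>, w)) (fdelta R (\<phi>, w')))) | \<phi> w w'.
        \<phi> \<in> fig_hom G r n \<and> w \<in> carrier W \<and> w' \<in> carrier W}
   \<union> {fadd R (fdelta R (\<phi>, a \<odot>\<^bsub>W\<^esub> w)) (fneg R (fsmult R a (fdelta R (\<phi>, w)))) | \<phi> a w.
        \<phi> \<in> fig_hom G r n \<and> a \<in> carrier R \<and> w \<in> carrier W}
   \<union> {fadd R (fdelta R (fig_comp G r \<phi> \<sigma>, w)) (fneg R (fdelta R (\<phi>, wact \<sigma> w))) | \<phi> \<sigma> w.
        \<phi> \<in> fig_hom G r n \<and> \<sigma> \<in> fig_hom G r r \<and> w \<in> carrier W}"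

definition freeM_rel :: "('g,'b) monoid_scheme \<Rightarrow> ('k,'a) ring_scheme \<Rightarrow> nat \<Rightarrow> ('k,'w) module \<Rightarrow> ('g fimor \<Rightarrow> 'w \<Rightarrow> 'w) \<Rightarrow> nat \<Rightarrow> ('g fimor \<times> 'w \<Rightarrow> 'k) set" where
  "freeM_rel G R r W wact n = fspan R (fig_hom G r n \<times> carrier W) (tens_rels G R r W wact n)"

definition coset_of :: "('k,'a) ring_scheme \<Rightarrow> ('x \<Rightarrow> 'k) set \<Rightarrow> ('x \<Rightarrow> 'k) \<Rightarrow> ('x \<Rightarrow> 'k) set" where
  "coset_of R N c = {fadd R c x | x. x \<in> N}"

text \<open>M(W)_n = k[Hom([r],[n])] \<otimes>_{kG_r} W, realised as the quotient module.\<close>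
definition freeM_space :: "('g,'b) monoid_scheme \<Rightarrow> ('k,'a) ring_scheme \<Rightarrow> nat \<Rightarrow> ('k,'w) module \<Rightarrow> ('g fimor \<Rightarrow> 'w \<Rightarrow> 'w) \<Rightarrow> nat \<Rightarrow> ('k, ('g fimor \<times> 'w \<Rightarrow> 'k) set) module" where
  "freeM_space G R r W wact n =
     (let Nn = freeM_rel G R r W wact n in
      \<lparr>carrier = {coset_of R Nn c | c. c \<in> fsupp R (fig_hom G r n \<times> carrier W)},
       mult = undefined, one = undefined,
       zero = Nn,
       add = (\<lambda>A B. {fadd R a b | a b. a \<in> A \<and> b \<in> B}),
       smult = (\<lambda>a A. {fadd R (fsmult R a c) x | c x. c \<in> A \<and> x \<in> Nn})\<rparr>)"

definition flin_ext :: "('k,'a) ring_scheme \<Rightarrow> ('x \<Rightarrow> 'y) \<Rightarrow> ('x \<Rightarrow> 'k) \<Rightarrow> 'y \<Rightarrow> 'k" where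
  "flin_ext R f c = (\<lambda>y. finsum R (\<lambda>x. if f x = y then c x else \<zero>\<^bsub>R\<^esub>) {x. c x \<noteq> \<zero>\<^bsub>R\<^esub>})"

definition freeM_map :: "('g,'b) monoid_scheme \<Rightarrow> ('k,'a) ring_scheme \<Rightarrow> nat \<Rightarrow> ('k,'w) module \<Rightarrow> ('g fimor \<Rightarrow> 'w \<Rightarrow> 'w) \<Rightarrow> nat \<Rightarrow> nat \<Rightarrow> 'g fimor \<Rightarrow> ('g fimor \<times> 'w \<Rightarrow> 'k) set \<Rightarrow> ('g fimor \<times> 'w \<Rightarrow> 'k) set" where
  "freeM_map G R r W wact n m \<psi> A =
     {fadd R (flin_ext R (\<lambda>(\<phi>, w). (fig_comp G r \<psi> \<phi>, w)) c) x | c x. c \<in> A \<and> x \<in> freeM_rel G R r W wact m}"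

definition freeM :: "('g,'b) monoid_scheme \<Rightarrow> ('k,'a) ring_scheme \<Rightarrow> nat \<Rightarrow> ('k,'w) module \<Rightarrow> ('g fimor \<Rightarrow> 'w \<Rightarrow> 'w) \<Rightarrow> ('g, 'k, ('g fimor \<times> 'w \<Rightarrow> 'k) set) fig_module" where
  "freeM G R r W wact = \<lparr>fi_space = freeM_space G R r W wact, fi_map = freeM_map G R r W wact\<rparr>"

definition dsum_space :: "('i \<Rightarrow> ('g,'k,'x) fig_module) \<Rightarrow> 'i set \<Rightarrow> nat \<Rightarrow> ('k, 'i \<Rightarrow> 'x) module" where
  "dsum_space F I n =
     \<lparr>carrier = {x. (\<forall>i\<in>I. x i \<in> carrier (fi_space (F i) n)) \<and> (\<forall>i. i \<notin> I \<longrightarrow> x i = undefined)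
                   \<and> finite {i\<in>I. x i \<noteq> \<zero>\<^bsub>fi_space (F i) n\<^esub>}},
      mult = undefined, one = undefined,
      zero = (\<lambda>i\<in>I. \<zero>\<^bsub>fi_space (F i) n\<^esub>),
      add = (\<lambda>x y. \<lambda>i\<in>I. x i \<oplus>\<^bsub>fi_space (F i) n\<^esub> y i),
      smult = (\<lambda>a x. \<lambda>i\<in>I. a \<odot>\<^bsub>fi_space (F i) n\<^esub> x i)\<rparr>"

definition dsum :: "('i \<Rightarrow> ('g,'k,'x) fig_module) \<Rightarrow> 'i set \<Rightarrow> ('g,'k,'i \<Rightarrow> 'x) fig_module" where
  "dsum F I = \<lparr>fi_space = dsum_space F I, fi_map = (\<lambda>n m \<phi> x. \<lambda>i\<in>I. fi_map (F i) n m \<phi> (x i))\<rparr>"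

definition fig_mod_hom :: "('g,'b) monoid_scheme \<Rightarrow> ('k,'a) ring_scheme \<Rightarrow> ('g,'k,'u) fig_module \<Rightarrow> ('g,'k,'v) fig_module \<Rightarrow> (nat \<Rightarrow> 'u \<Rightarrow> 'v) \<Rightarrow> bool" where
  "fig_mod_hom G R U V p \<longleftrightarrow>
     (\<forall>n. klinear R (fi_space U n) (fi_space V n) (p n)) \<and>
     (\<forall>n m \<phi>. \<phi> \<in> fig_hom G n m \<longrightarrow>
        (\<forall>u\<in>carrier (fi_space U n). p m (fi_map U n m \<phi> u) = fi_map V n m \<phi> (p n u)))"

definition fig_kernel :: "('g,'k,'v) fig_module \<Rightarrow> ('g,'k,'u) fig_module \<Rightarrow> (nat \<Rightarrow> 'u \<Rightarrow> 'v) \<Rightarrow> ('g,'k,'u) fig_module" where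
  "fig_kernel V U p = restrict_fig U (\<lambda>n. {u \<in> carrier (fi_space U n). p n u = \<zero>\<^bsub>fi_space V n\<^esub>})"

text \<open>Degree-wise coherence, with the index type 'i of the direct sum and the element
  type 'w of the generating kG_r-modules made explicit: there is an exact sequence
  0 -> K -> F -> V -> 0 with F = \<Oplus>_{i\<in>I} M(W_i) of finite generating degree and
  K (= ker(F -> V)) generated in finite degree.\<close>
definition dw_coherent_in :: "'i itself \<Rightarrow> 'w itself \<Rightarrow> ('g,'b) monoid_scheme \<Rightarrow> ('k,'a) ring_scheme \<Rightarrow> ('g,'k,'v) fig_module \<Rightarrow> bool" where
  "dw_coherent_in _ _ G R V \<longleftrightarrow>
     (\<exists>(I::'i set) (r::'i \<Rightarrow> nat) (N::nat) (W::'i \<Rightarrow> ('k,'w) module) wact p.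
        (\<forall>i\<in>I. r i \<le> N \<and> kGr_module G R (r i) (W i) (wact i)) \<and>
        fig_mod_hom G R (dsum (\<lambda>i. freeM G R (r i) (W i) (wact i)) I) V p \<and>
        (\<forall>n. p n ` carrier (fi_space (dsum (\<lambda>i. freeM G R (r i) (W i) (wact i)) I) n)
               = carrier (fi_space V n)) \<and>
        gen_fin_degree G R (fig_kernel V (dsum (\<lambda>i. freeM G R (r i) (W i) (wact i)) I) p))"

end

theory Submission
  imports Defs
begin

text \<open>
  Forgetting the labels, an FI_G-module is a functor on finite sets and injections; write V_T for its
  value on a finite set T and E_B(T) for the sum of the images of all V_U with U \<subseteq> T not containing B.
  The quotient V_T / E_B(T) is the value on T - B of the |B|-fold derivative of V.

  The heart of the proof is the following step. Let V be generated in degree N, let its a-fold derivative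
  be torsion free in high degrees, and let x in V_T be unchanged modulo E_B, |B| = a, when a point * of T
  is moved to a new point. If T is large then x lies in E_{B + *}(T). To see this, write x as a sum of
  contributions of small subsets U of T. For a subset A of T, the product of the operators
  id - (a moved to a new point), a in A, kills all contributions not containing A. Applied to the
  invariance of x it yields a relation for the contribution of A alone, and torsion freeness allows the
  new points to be chosen inside T. This trades U \<supseteq> A for sets meeting a fixed finite part of T, so that
  finally x comes from a fixed small set, off which * can be moved.

  Consequently, if V is generated in finite degree and has finite torsion degree, so do all its iterated
  derivatives. The kernel of a surjection F \<rightarrow> V with F generated in degree N is then generated in finite
  degree: fix C \<subseteq> T of large fixed size; the part of a kernel element supported on sets U with
  U - C = A maps into E_A(T), hence already into E_A(A + C), and so differs by a kernel element of
  bounded degree from a part supported on sets with smaller U - C. Conversely, if V = F / K with F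
  torsion free and K generated in finite degree, the step with B empty, applied to K, shows that K is
  saturated in F in high degrees.
\<close>

section \<open>FI-functors on finite sets of naturals\<close>

text \<open>The ring k and the group G are arbitrary, so generation of a kernel cannot rest on chain
  conditions and has to come from explicit bounds. Torsion freeness of V in high degrees is too weak
  for this: to remove the part of a kernel element whose sets have trace A outside C, its image must
  be pulled back from E_A(T) to E_A(A + C), and that is torsion freeness of the |A|-fold derivative.
  Derivatives of all orders up to N are therefore needed, and they are reached one order at a time.
  An element v that dies in the next derivative once a point l is added agrees modulo E_B with a
  copy of some v' in which the point star is renamed l; comparing two choices of l shows that v' is
  invariant when star is moved, which is the situation of the central step.

  The labels do no harm: every morphism is an automorphism followed by an inclusion with trivial
  labels, and submodules are stable under automorphisms.

  The constant \<open>N * N + N + 2\<close> covers the growth of the fixed finite part, which gains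
  N, then N - 1, and so on down to 1 points, and the spare points to which others are moved.\<close>

context abelian_group begin

lemma minus_add_eq: "\<lbrakk>x \<in> carrier G; y \<in> carrier G; a \<in> carrier G; b \<in> carrier G\<rbrakk> \<Longrightarrow>
  (x \<oplus> a) \<ominus> (y \<oplus> b) = (x \<ominus> y) \<oplus> (a \<ominus> b)"
  by (simp add: a_minus_def minus_add a_ac)

lemma minus_minus_eq: "\<lbrakk>x \<in> carrier G; y \<in> carrier G; a \<in> carrier G; b \<in> carrier G\<rbrakk> \<Longrightarrow>
  (x \<ominus> a) \<ominus> (y \<ominus> b) = (x \<ominus> y) \<ominus> (a \<ominus> b)"
  by (simp add: a_minus_def minus_add a_ac)

lemma add_minus_cancel_right: "\<lbrakk>x \<in> carrier G; y \<in> carrier G\<rbrakk> \<Longrightarrow> (x \<oplus> y) \<ominus> y = x"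
  by (simp add: a_minus_def a_assoc r_neg)

lemma minus_add_cancel_right: "\<lbrakk>x \<in> carrier G; y \<in> carrier G\<rbrakk> \<Longrightarrow> (x \<ominus> y) \<oplus> y = x"
  by (simp add: a_minus_def a_assoc l_neg)

lemma minus_minus_cancel: "\<lbrakk>x \<in> carrier G; y \<in> carrier G\<rbrakk> \<Longrightarrow> x \<ominus> (x \<ominus> y) = y"
  by (simp add: a_minus_def minus_add r_neg2)

lemma minus_self: "x \<in> carrier G \<Longrightarrow> x \<ominus> x = \<zero>"
  by (simp add: a_minus_def r_neg)

lemma minus_right_comm: "\<lbrakk>x \<in> carrier G; y \<in> carrier G; z \<in> carrier G\<rbrakk> \<Longrightarrow>
  (x \<ominus> y) \<ominus> z = (x \<ominus> z) \<ominus> y"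
  by (simp add: a_minus_def a_ac)

lemma minus_minus_minus: "\<lbrakk>x \<in> carrier G; y \<in> carrier G; z \<in> carrier G\<rbrakk> \<Longrightarrow>
  (x \<ominus> z) \<ominus> (y \<ominus> z) = x \<ominus> y"
  by (simp add: minus_minus_eq minus_self) (simp add: a_minus_def a_inv_def)

end

text \<open>Values on arbitrary finite sets of naturals, rather than on \<open>{1..n}\<close>, let
  subsets, complements and new points be taken literally. \<open>act\<close> takes a total function,
  so \<open>act_cong\<close> says that only its values on the source count. The record
  \<open>module\<close> extends \<open>ring\<close>, so the spaces of an FI_G-module can serve as
  \<open>M\<close> directly.\<close>

locale fi_functor =
  fixes M :: "nat set \<Rightarrow> ('v,'x) ring_scheme"
    and act :: "nat set \<Rightarrow> nat set \<Rightarrow> (nat \<Rightarrow> nat) \<Rightarrow> 'v \<Rightarrow> 'v"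
  assumes abelian: "finite T \<Longrightarrow> abelian_group (M T)"
    and act_closed: "\<lbrakk>finite T; inj_on f S; f ` S \<subseteq> T; x \<in> carrier (M S)\<rbrakk>
      \<Longrightarrow> act S T f x \<in> carrier (M T)"
    and act_add: "\<lbrakk>finite T; inj_on f S; f ` S \<subseteq> T; x \<in> carrier (M S); y \<in> carrier (M S)\<rbrakk>
      \<Longrightarrow> act S T f (x \<oplus>\<^bsub>M S\<^esub> y) = act S T f x \<oplus>\<^bsub>M T\<^esub> act S T f y"
    and act_cong: "(\<And>i. i \<in> S \<Longrightarrow> f i = g i) \<Longrightarrow> act S T f = act S T g"
    and act_id: "\<lbrakk>finite T; x \<in> carrier (M T)\<rbrakk> \<Longrightarrow> act T T (\<lambda>i. i) x = x"
    and act_act: "\<lbrakk>finite U; inj_on f S; f ` S \<subseteq> T; inj_on g T; g ` T \<subseteq> U; x \<in> carrier (M S)\<rbrakk>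
      \<Longrightarrow> act T U g (act S T f x) = act S U (\<lambda>i. g (f i)) x"
begin

abbreviation incl :: "nat set \<Rightarrow> nat set \<Rightarrow> 'v \<Rightarrow> 'v" where
  "incl S T \<equiv> act S T (\<lambda>i. i)"

lemma zero_closed: "finite T \<Longrightarrow> \<zero>\<^bsub>M T\<^esub> \<in> carrier (M T)"
  using abelian abelian_group.axioms(1) abelian_monoid.zero_closed by blast

lemma act_zero:
  assumes "finite T" "inj_on f S" "f ` S \<subseteq> T"
  shows "act S T f \<zero>\<^bsub>M S\<^esub> = \<zero>\<^bsub>M T\<^esub>"
proof -
  have "finite S" using assms finite_imageD finite_subset by blast
  interpret S: abelian_group "M S" by (rule abelian) fact
  interpret T: abelian_group "M T" by (rule abelian) fact
  let ?z = "act S T f \<zero>\<^bsub>M S\<^esub>"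
  have c: "?z \<in> carrier (M T)" using assms by (intro act_closed) auto
  have "?z \<oplus>\<^bsub>M T\<^esub> ?z = ?z" using act_add[OF assms, of "\<zero>\<^bsub>M S\<^esub>" "\<zero>\<^bsub>M S\<^esub>"] by simp
  then show ?thesis using c T.add.l_cancel_one by simp
qed

lemma act_neg:
  assumes "finite T" "inj_on f S" "f ` S \<subseteq> T" "x \<in> carrier (M S)"
  shows "act S T f (\<ominus>\<^bsub>M S\<^esub> x) = \<ominus>\<^bsub>M T\<^esub> act S T f x"
proof -
  have "finite S" using assms finite_imageD finite_subset by blast
  interpret S: abelian_group "M S" by (rule abelian) fact
  interpret T: abelian_group "M T" by (rule abelian) fact
  have c: "act S T f x \<in> carrier (M T)" "act S T f (\<ominus>\<^bsub>M S\<^esub> x) \<in> carrier (M T)"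
    using assms by (auto intro!: act_closed)
  have "act S T f (\<ominus>\<^bsub>M S\<^esub> x) \<oplus>\<^bsub>M T\<^esub> act S T f x = \<zero>\<^bsub>M T\<^esub>"
    using act_add[OF assms(1-3), of "\<ominus>\<^bsub>M S\<^esub> x" x] assms(4) act_zero[OF assms(1-3)] by (simp add: S.l_neg)
  then show ?thesis using c T.minus_equality by metis
qed

lemma act_minus:
  assumes "finite T" "inj_on f S" "f ` S \<subseteq> T" "x \<in> carrier (M S)" "y \<in> carrier (M S)"
  shows "act S T f (x \<ominus>\<^bsub>M S\<^esub> y) = act S T f x \<ominus>\<^bsub>M T\<^esub> act S T f y"
proof -
  have "finite S" using assms finite_imageD finite_subset by blast
  interpret S: abelian_group "M S" by (rule abelian) fact
  show ?thesis using assms by (simp add: a_minus_def act_add act_neg)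
qed

text \<open>E_B(T) is \<open>incl_span T (\<lambda>U. \<not> B \<subseteq> U)\<close>. A predicate
  in place of \<open>B\<close> also allows conditions on the size of \<open>U\<close> or on its
  trace outside a fixed set, which is how contributions are sorted below.\<close>

inductive_set incl_span :: "nat set \<Rightarrow> (nat set \<Rightarrow> bool) \<Rightarrow> 'v set" for T P where
  zero: "\<zero>\<^bsub>M T\<^esub> \<in> incl_span T P"
| add: "\<lbrakk>x \<in> incl_span T P; U \<subseteq> T; P U; c \<in> carrier (M U)\<rbrakk> \<Longrightarrow> x \<oplus>\<^bsub>M T\<^esub> incl U T c \<in> incl_span T P"

lemma incl_span_carrier:
  assumes "finite T" "x \<in> incl_span T P" shows "x \<in> carrier (M T)"
proof -
  interpret T: abelian_group "M T" by (rule abelian) fact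
  show ?thesis using assms(2) by induction (auto intro!: act_closed assms(1) T.add.m_closed)
qed

lemma incl_span_gen:
  assumes "finite T" "U \<subseteq> T" "P U" "c \<in> carrier (M U)"
  shows "incl U T c \<in> incl_span T P"
proof -
  interpret T: abelian_group "M T" by (rule abelian) fact
  have "incl U T c \<in> carrier (M T)" using assms by (auto intro!: act_closed)
  then show ?thesis using incl_span.add[of _ T P, OF incl_span.zero assms(2-4)] by simp
qed

lemma incl_span_add:
  assumes "finite T" "x \<in> incl_span T P" "y \<in> incl_span T P"
  shows "x \<oplus>\<^bsub>M T\<^esub> y \<in> incl_span T P"
proof -
  interpret T: abelian_group "M T" by (rule abelian) fact
  have xc: "x \<in> carrier (M T)" using assms incl_span_carrier by blast
  show ?thesis using assms(3)
  proof induction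
    case zero then show ?case using xc assms(2) by simp
  next
    case (add y U c)
    have "incl U T c \<in> carrier (M T)" "y \<in> carrier (M T)"
      using add assms incl_span_carrier by (auto intro!: act_closed)
    then show ?case using incl_span.add[OF add.IH add.hyps(2-4)] xc by (simp add: T.a_assoc)
  qed
qed

lemma incl_span_neg:
  assumes "finite T" "x \<in> incl_span T P"
  shows "\<ominus>\<^bsub>M T\<^esub> x \<in> incl_span T P"
proof -
  interpret T: abelian_group "M T" by (rule abelian) fact
  show ?thesis using assms(2)
  proof induction
    case zero show ?case using incl_span.zero[of T P] T.add.inv_one by (simp add: a_inv_def)
  next
    case (add y U c)
    have fU: "finite U" using add assms finite_subset by blast
    interpret U: abelian_group "M U" by (rule abelian) fact
    have c: "incl U T c \<in> carrier (M T)" "y \<in> carrier (M T)"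
      using add assms incl_span_carrier by (auto intro!: act_closed)
    have "\<ominus>\<^bsub>M T\<^esub> (y \<oplus>\<^bsub>M T\<^esub> incl U T c) = \<ominus>\<^bsub>M T\<^esub> y \<oplus>\<^bsub>M T\<^esub> incl U T (\<ominus>\<^bsub>M U\<^esub> c)"
      using c add assms by (simp add: T.minus_add act_neg)
    then show ?case using incl_span.add[OF add.IH add.hyps(2-3), of "\<ominus>\<^bsub>M U\<^esub> c"] add by simp
  qed
qed

lemma incl_span_minus: "\<lbrakk>finite T; x \<in> incl_span T P; y \<in> incl_span T P\<rbrakk> \<Longrightarrow> x \<ominus>\<^bsub>M T\<^esub> y \<in> incl_span T P"
  by (simp add: a_minus_def incl_span_add incl_span_neg)

lemma incl_span_minus_left:
  assumes "finite T" "x \<ominus>\<^bsub>M T\<^esub> y \<in> incl_span T P" "y \<in> incl_span T P" "x \<in> carrier (M T)"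
  shows "x \<in> incl_span T P"
proof -
  interpret T: abelian_group "M T" by (rule abelian) fact
  have "(x \<ominus>\<^bsub>M T\<^esub> y) \<oplus>\<^bsub>M T\<^esub> y = x"
    using assms incl_span_carrier by (intro T.minus_add_cancel_right) auto
  then show ?thesis using incl_span_add[OF assms(1-3)] by simp
qed

lemma incl_span_minus_right:
  assumes "finite T" "x \<ominus>\<^bsub>M T\<^esub> y \<in> incl_span T P" "x \<in> incl_span T P" "y \<in> carrier (M T)"
  shows "y \<in> incl_span T P"
proof -
  interpret T: abelian_group "M T" by (rule abelian) fact
  have "x \<ominus>\<^bsub>M T\<^esub> (x \<ominus>\<^bsub>M T\<^esub> y) = y"
    using assms incl_span_carrier by (intro T.minus_minus_cancel) auto
  then show ?thesis using incl_span_minus[OF assms(1) assms(3) assms(2)] by simp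
qed

text \<open>A contribution of \<open>U\<close> becomes one of the image of \<open>U\<close>, and it
  factors through every larger subset of \<open>T'\<close>. So \<open>Q\<close> is asked only for
  some set containing the image.\<close>

lemma incl_span_act:
  assumes "finite T'" "inj_on f T" "f ` T \<subseteq> T'" "x \<in> incl_span T P"
    and Q: "\<And>U. \<lbrakk>U \<subseteq> T; P U\<rbrakk> \<Longrightarrow> \<exists>U'. f ` U \<subseteq> U' \<and> U' \<subseteq> T' \<and> Q U'"
  shows "act T T' f x \<in> incl_span T' Q"
proof -
  have fT: "finite T" using assms(1-3) by (meson finite_imageD finite_subset)
  show ?thesis using assms(4)
  proof induction
    case zero then show ?case using incl_span.zero act_zero assms by simp
  next
    case (add y U c)
    obtain U' where U': "f ` U \<subseteq> U'" "U' \<subseteq> T'" "Q U'"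
      using Q[OF add.hyps(2,3)] by blast
    have fin: "finite U'" "finite U"
      using finite_subset[OF U'(2) assms(1)] finite_subset[OF add.hyps(2) fT] by auto
    have inj: "inj_on f U" using inj_on_subset[OF assms(2) add.hyps(2)] .
    have c: "incl U T c \<in> carrier (M T)" "y \<in> carrier (M T)" "act U U' f c \<in> carrier (M U')"
      using add fT incl_span_carrier inj U' fin by (auto intro!: act_closed)
    have "act T T' f (incl U T c) = act U T' f c"
      using act_act[of T' "\<lambda>i. i" U T f c] add.hyps assms(1-3) by auto
    also have "\<dots> = incl U' T' (act U U' f c)"
      using act_act[of T' f U U' "\<lambda>i. i" c] add.hyps assms(1-3) inj U' by auto
    finally have "act T T' f (y \<oplus>\<^bsub>M T\<^esub> incl U T c) = act T T' f y \<oplus>\<^bsub>M T'\<^esub> incl U' T' (act U U' f c)"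
      using act_add[OF assms(1-3) c(2,1)] by simp
    then show ?case using incl_span.add[of _ T' Q, OF add.IH U'(2,3) c(3)] by simp
  qed
qed

text \<open>A contribution of \<open>U\<close> is also one of every larger subset of
  \<open>T\<close>; with U' = U this is plain weakening of the predicate.\<close>

lemma incl_span_mono:
  assumes "finite T" "x \<in> incl_span T P"
    and "\<And>U. \<lbrakk>U \<subseteq> T; P U\<rbrakk> \<Longrightarrow> \<exists>U'. U \<subseteq> U' \<and> U' \<subseteq> T \<and> Q U'"
  shows "x \<in> incl_span T Q"
  using incl_span_act[of T "\<lambda>i. i" T x P Q] assms act_id incl_span_carrier by auto

lemma incl_span_split:
  assumes "finite T" "x \<in> incl_span T R" "\<And>U. \<lbrakk>U \<subseteq> T; R U\<rbrakk> \<Longrightarrow> P U \<or> Q U"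
  shows "\<exists>y\<in>incl_span T P. \<exists>z\<in>incl_span T Q. x = y \<oplus>\<^bsub>M T\<^esub> z"
proof -
  interpret T: abelian_group "M T" by (rule abelian) fact
  show ?thesis using assms(2)
  proof induction
    case zero then show ?case by (metis incl_span.zero T.r_zero T.zero_closed)
  next
    case (add x U c)
    then obtain y z where yz: "y \<in> incl_span T P" "z \<in> incl_span T Q" "x = y \<oplus>\<^bsub>M T\<^esub> z" by blast
    have c: "incl U T c \<in> carrier (M T)" "y \<in> carrier (M T)" "z \<in> carrier (M T)"
      using add yz assms incl_span_carrier by (auto intro!: act_closed)
    have eq: "x \<oplus>\<^bsub>M T\<^esub> incl U T c = (y \<oplus>\<^bsub>M T\<^esub> incl U T c) \<oplus>\<^bsub>M T\<^esub> z"
      "x \<oplus>\<^bsub>M T\<^esub> incl U T c = y \<oplus>\<^bsub>M T\<^esub> (z \<oplus>\<^bsub>M T\<^esub> incl U T c)"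
      using c yz by (simp_all add: T.a_ac)
    show ?case using assms(3)[OF add.hyps(2,3)]
    proof
      assume "P U"
      then show ?thesis using incl_span.add[OF yz(1) add.hyps(2) _ add.hyps(4)] yz eq by blast
    next
      assume "Q U"
      then show ?thesis using incl_span.add[OF yz(2) add.hyps(2) _ add.hyps(4)] yz eq by blast
    qed
  qed
qed

text \<open>Every summand factors through \<open>Y\<close>, hence so does the sum. This gathers many
  contributions into one element of \<open>M Y\<close>, to which operators on \<open>Y\<close> can
  be applied.\<close>

lemma incl_span_below:
  assumes "finite T" "Y \<subseteq> T" "x \<in> incl_span T P" "\<And>U. \<lbrakk>U \<subseteq> T; P U\<rbrakk> \<Longrightarrow> U \<subseteq> Y"
  shows "\<exists>y\<in>carrier (M Y). x = incl Y T y"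
proof -
  have fY: "finite Y" using assms finite_subset by blast
  interpret T: abelian_group "M T" by (rule abelian) fact
  interpret Y: abelian_group "M Y" by (rule abelian) fact
  show ?thesis using assms(3)
  proof induction
    case zero then show ?case
      using act_zero[of T "\<lambda>i. i" Y] assms by (intro bexI[of _ "\<zero>\<^bsub>M Y\<^esub>"]) auto
  next
    case (add x U c)
    then obtain y where y: "y \<in> carrier (M Y)" "x = incl Y T y" by blast
    have U: "U \<subseteq> Y" using assms(4) add by blast
    have c: "incl U Y c \<in> carrier (M Y)" using U add fY by (auto intro!: act_closed)
    have "incl U T c = incl Y T (incl U Y c)"
      using act_act[of T "\<lambda>i. i" U Y "\<lambda>i. i" c] U assms add by auto
    then have "x \<oplus>\<^bsub>M T\<^esub> incl U T c = incl Y T (y \<oplus>\<^bsub>M Y\<^esub> incl U Y c)"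
      using act_add[of T "\<lambda>i. i" Y y "incl U Y c"] y c assms by auto
    then show ?case using y c by blast
  qed
qed

section \<open>Differences that move one point to a new point\<close>

definition move_diff :: "nat set \<Rightarrow> nat \<Rightarrow> nat \<Rightarrow> 'v \<Rightarrow> 'v" where
  "move_diff X a m x = incl X (insert m X) x \<ominus>\<^bsub>M (insert m X)\<^esub> act X (insert m X) ((\<lambda>i. i)(a := m)) x"

lemma inj_on_upd: "m \<notin> X \<Longrightarrow> inj_on ((\<lambda>i. i)(a := m)) X"
  by (auto simp: inj_on_def)

lemma upd_image: "((\<lambda>i. i)(a := m)) ` X \<subseteq> insert m X"
  by auto

lemma move_diff_closed:
  assumes "finite X" "m \<notin> X" "x \<in> carrier (M X)"
  shows "move_diff X a m x \<in> carrier (M (insert m X))"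
proof -
  interpret T: abelian_group "M (insert m X)" by (rule abelian) (simp add: assms)
  show ?thesis unfolding move_diff_def using assms inj_on_upd upd_image
    by (intro T.minus_closed act_closed) auto
qed

lemma move_diff_add:
  assumes "finite X" "m \<notin> X" "x \<in> carrier (M X)" "y \<in> carrier (M X)"
  shows "move_diff X a m (x \<oplus>\<^bsub>M X\<^esub> y) = move_diff X a m x \<oplus>\<^bsub>M (insert m X)\<^esub> move_diff X a m y"
proof -
  interpret T: abelian_group "M (insert m X)" by (rule abelian) (simp add: assms)
  have c: "incl X (insert m X) z \<in> carrier (M (insert m X))"
    "act X (insert m X) ((\<lambda>i. i)(a := m)) z \<in> carrier (M (insert m X))" if "z \<in> carrier (M X)" for z
    using assms that inj_on_upd upd_image by (auto intro!: act_closed)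
  have "act X (insert m X) f (x \<oplus>\<^bsub>M X\<^esub> y) = act X (insert m X) f x \<oplus>\<^bsub>M (insert m X)\<^esub> act X (insert m X) f y"
    if "inj_on f X" "f ` X \<subseteq> insert m X" for f
    using assms that by (intro act_add) auto
  from this[of "\<lambda>i. i"] this[OF inj_on_upd[OF assms(2)] upd_image] show ?thesis
    unfolding move_diff_def using c assms by (simp add: subset_insertI T.minus_add_eq)
qed

lemma move_diff_minus:
  assumes "finite X" "m \<notin> X" "x \<in> carrier (M X)" "y \<in> carrier (M X)"
  shows "move_diff X a m (x \<ominus>\<^bsub>M X\<^esub> y) = move_diff X a m x \<ominus>\<^bsub>M (insert m X)\<^esub> move_diff X a m y"
proof -
  interpret T: abelian_group "M (insert m X)" by (rule abelian) (simp add: assms)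
  have c: "incl X (insert m X) z \<in> carrier (M (insert m X))"
    "act X (insert m X) ((\<lambda>i. i)(a := m)) z \<in> carrier (M (insert m X))" if "z \<in> carrier (M X)" for z
    using assms that inj_on_upd upd_image by (auto intro!: act_closed)
  have "act X (insert m X) f (x \<ominus>\<^bsub>M X\<^esub> y) = act X (insert m X) f x \<ominus>\<^bsub>M (insert m X)\<^esub> act X (insert m X) f y"
    if "inj_on f X" "f ` X \<subseteq> insert m X" for f
    using assms that by (intro act_minus) auto
  from this[of "\<lambda>i. i"] this[OF inj_on_upd[OF assms(2)] upd_image] show ?thesis
    unfolding move_diff_def using c assms by (simp add: subset_insertI T.minus_minus_eq)
qed

text \<open>Moving \<open>a\<close> does not affect the contribution of a set without
  \<open>a\<close>, so there the two terms cancel. Sets with \<open>a\<close> survive, once as they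
  are and once with \<open>a\<close> replaced by \<open>m\<close>; hence \<open>Q\<close> is
  required only under \<open>a \<in> U\<close>.\<close>

lemma move_diff_incl_span:
  assumes "finite X" "m \<notin> X" "x \<in> incl_span X P"
    and Q: "\<And>U. \<lbrakk>U \<subseteq> X; P U; a \<in> U\<rbrakk> \<Longrightarrow> Q U \<and> Q (insert m (U - {a}))"
  shows "move_diff X a m x \<in> incl_span (insert m X) Q"
proof -
  let ?Y = "insert m X"
  interpret X: abelian_group "M X" by (rule abelian) fact
  interpret T: abelian_group "M ?Y" by (rule abelian) (simp add: assms)
  show ?thesis using assms(3)
  proof induction
    case zero
    have "move_diff X a m \<zero>\<^bsub>M X\<^esub> = \<zero>\<^bsub>M ?Y\<^esub>"
      unfolding move_diff_def using assms inj_on_upd[of m X a] upd_image[of a m X]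
      by (simp add: act_zero subset_insertI T.minus_self)
    then show ?case using incl_span.zero by simp
  next
    case (add x U c)
    have c: "incl U X c \<in> carrier (M X)" "x \<in> carrier (M X)"
      using add assms incl_span_carrier by (auto intro!: act_closed)
    have 1: "incl X ?Y (incl U X c) = incl U ?Y c"
      using add assms by (subst act_act) auto
    have 2: "act X ?Y ((\<lambda>i. i)(a := m)) (incl U X c) = act U ?Y ((\<lambda>i. i)(a := m)) c"
      using add assms inj_on_upd upd_image by (subst act_act) auto
    have cY: "incl U ?Y c \<in> carrier (M ?Y)" using add assms by (auto intro!: act_closed)
    have "move_diff X a m (incl U X c) \<in> incl_span ?Y Q"
    proof (cases "a \<in> U")
      case False
      then have "act U ?Y ((\<lambda>i. i)(a := m)) = incl U ?Y" by (intro act_cong) auto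
      then show ?thesis unfolding move_diff_def 1 2 using T.minus_self cY incl_span.zero by simp
    next
      case True
      let ?V = "insert m (U - {a})"
      have V: "Q U" "Q ?V" "?V \<subseteq> ?Y" "finite ?V" "m \<notin> U"
        using Q True add assms by (auto dest: finite_subset)
      have img: "((\<lambda>i. i)(a := m)) ` U \<subseteq> ?V" by auto
      have c': "act U ?V ((\<lambda>i. i)(a := m)) c \<in> carrier (M ?V)"
        using V add img inj_on_upd by (intro act_closed) auto
      have "act U ?Y ((\<lambda>i. i)(a := m)) c = incl ?V ?Y (act U ?V ((\<lambda>i. i)(a := m)) c)"
        using V add assms img inj_on_upd by (subst act_act) auto
      then show ?thesis unfolding move_diff_def 1 2 using V add assms c'
        by (auto intro!: incl_span_minus incl_span_gen)
    qed
    then show ?case using add assms c incl_span_add by (simp add: move_diff_add)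
  qed
qed

text \<open>Naturality lets a difference taken with one new point be compared with the same
  difference taken with another.\<close>

lemma move_diff_nat:
  assumes "inj_on h (insert m X)" "h ` X \<subseteq> X'" "finite X'" "h m \<notin> X'" "a \<in> X" "m \<notin> X" "x \<in> carrier (M X)"
  shows "act (insert m X) (insert (h m) X') h (move_diff X a m x) = move_diff X' (h a) (h m) (act X X' h x)"
proof -
  let ?Y = "insert m X" and ?Y' = "insert (h m) X'"
  have fX: "finite X" using assms finite_imageD finite_subset inj_on_subset by (metis subset_insertI)
  have ih: "inj_on h X" using assms by auto
  have im: "h ` ?Y \<subseteq> ?Y'" using assms by auto
  have "act ?Y ?Y' h (move_diff X a m x) = act ?Y ?Y' h (incl X ?Y x) \<ominus>\<^bsub>M ?Y'\<^esub> act ?Y ?Y' h (act X ?Y ((\<lambda>i. i)(a := m)) x)"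
    unfolding move_diff_def using assms fX inj_on_upd upd_image im
    by (intro act_minus act_closed) auto
  also have "act ?Y ?Y' h (incl X ?Y x) = incl X' ?Y' (act X X' h x)"
    using assms fX im ih by (subst (1 2) act_act) auto
  also have "act ?Y ?Y' h (act X ?Y ((\<lambda>i. i)(a := m)) x) = act X ?Y' (\<lambda>i. h (((\<lambda>i. i)(a := m)) i)) x"
    using assms fX im inj_on_upd upd_image by (subst act_act) auto
  \<comment> \<open>The two functions agree on \<open>X\<close>: by injectivity only
    \<open>a\<close> is sent to \<open>h a\<close>.\<close>
  also have "act X ?Y' (\<lambda>i. h (((\<lambda>i. i)(a := m)) i)) = act X ?Y' (\<lambda>i. ((\<lambda>i. i)(h a := h m)) (h i))"
    using assms ih by (intro act_cong) (auto simp: inj_on_def)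
  also have "act X ?Y' (\<lambda>i. ((\<lambda>i. i)(h a := h m)) (h i)) x = act X' ?Y' ((\<lambda>i. i)(h a := h m)) (act X X' h x)"
    using assms ih inj_on_upd upd_image by (subst act_act) auto
  finally show ?thesis unfolding move_diff_def .
qed

section \<open>Products of differences along a list of moves\<close>

fun move_diffs :: "nat set \<Rightarrow> (nat \<times> nat) list \<Rightarrow> 'v \<Rightarrow> 'v" where
  "move_diffs X [] x = x"
| "move_diffs X ((a, m) # ps) x = move_diffs (insert m X) ps (move_diff X a m x)"

text \<open>The second components have to be new at every stage, so they are distinct and outside
  \<open>X\<close>; the first components lie in \<open>X\<close> from the start, so no new point is
  ever moved again.\<close>

definition fresh :: "nat set \<Rightarrow> (nat \<times> nat) list \<Rightarrow> bool" where
  "fresh X ps \<longleftrightarrow> distinct (map snd ps) \<and> snd ` set ps \<inter> X = {} \<and> fst ` set ps \<subseteq> X"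

lemma fresh_Cons: "fresh X ((a, m) # ps) \<Longrightarrow> m \<notin> X \<and> a \<in> X \<and> fresh (insert m X) ps"
  by (auto simp: fresh_def)

lemma move_diffs_closed:
  "\<lbrakk>finite X; fresh X ps; x \<in> carrier (M X)\<rbrakk> \<Longrightarrow> move_diffs X ps x \<in> carrier (M (X \<union> snd ` set ps))"
proof (induction ps arbitrary: X x)
  case (Cons p ps)
  obtain a m where p: "p = (a, m)" by fastforce
  have "move_diffs (insert m X) ps (move_diff X a m x) \<in> carrier (M (insert m X \<union> snd ` set ps))"
    using Cons.prems fresh_Cons p by (intro Cons.IH move_diff_closed) auto
  then show ?case by (simp add: p)
qed simp

lemma move_diffs_minus:
  "\<lbrakk>finite X; fresh X ps; x \<in> carrier (M X); y \<in> carrier (M X)\<rbrakk> \<Longrightarrow>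
   move_diffs X ps (x \<ominus>\<^bsub>M X\<^esub> y) = move_diffs X ps x \<ominus>\<^bsub>M (X \<union> snd ` set ps)\<^esub> move_diffs X ps y"
proof (induction ps arbitrary: X x y)
  case (Cons p ps)
  obtain a m where p: "p = (a, m)" by fastforce
  have f: "m \<notin> X" "fresh (insert m X) ps" using Cons.prems fresh_Cons p by auto
  have "move_diffs (insert m X) ps (move_diff X a m x \<ominus>\<^bsub>M (insert m X)\<^esub> move_diff X a m y) =
     move_diffs (insert m X) ps (move_diff X a m x) \<ominus>\<^bsub>M (insert m X \<union> snd ` set ps)\<^esub> move_diffs (insert m X) ps (move_diff X a m y)"
    using Cons.prems f by (intro Cons.IH move_diff_closed) auto
  then show ?case using Cons.prems f by (simp add: p move_diff_minus)
qed simp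

lemma move_diffs_incl_span:
  assumes "finite X" "fresh X ps" "x \<in> incl_span X Q"
    "\<And>U a m. \<lbrakk>(a, m) \<in> set ps; Q U; a \<in> U; m \<notin> U; finite U\<rbrakk> \<Longrightarrow> Q (insert m (U - {a}))"
  shows "move_diffs X ps x \<in> incl_span (X \<union> snd ` set ps) Q"
  using assms
proof (induction ps arbitrary: X x)
  case (Cons p ps)
  obtain a m where p: "p = (a, m)" by fastforce
  have f: "m \<notin> X" "fresh (insert m X) ps" using Cons.prems fresh_Cons p by auto
  have "move_diff X a m x \<in> incl_span (insert m X) Q"
  proof (rule move_diff_incl_span[OF Cons.prems(1) f(1) Cons.prems(3)])
    fix U assume "U \<subseteq> X" "Q U" "a \<in> U"
    then show "Q U \<and> Q (insert m (U - {a}))"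
      using Cons.prems(4)[of a m U] Cons.prems(1) f p by (auto dest: finite_subset)
  qed
  then have "move_diffs (insert m X) ps (move_diff X a m x) \<in> incl_span (insert m X \<union> snd ` set ps) Q"
    using Cons.prems f by (intro Cons.IH) auto
  then show ?case by (simp add: p)
qed simp

text \<open>Each difference cancels the contributions that lack its own point, so the second
  alternative shrinks to the moved points still in the list and is gone at the end. New points lie
  outside \<open>X\<close>, so a move never makes a set contain \<open>B\<close> or the remaining
  moved points if it did not before.\<close>

lemma move_diffs_kill:
  assumes "finite X" "fresh X ps" "x \<in> incl_span X (\<lambda>U. \<not> B \<subseteq> U \<or> \<not> fst ` set ps \<subseteq> U)"
    "B \<subseteq> X" "fst ` set ps \<inter> B = {}"
  shows "move_diffs X ps x \<in> incl_span (X \<union> snd ` set ps) (\<lambda>U. \<not> B \<subseteq> U)"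
  using assms
proof (induction ps arbitrary: X x)
  case (Cons p ps)
  obtain a m where p: "p = (a, m)" by fastforce
  have f: "m \<notin> X" "a \<in> X" "fresh (insert m X) ps" using Cons.prems fresh_Cons p by auto
  have fs: "fst ` set ps \<subseteq> X" using Cons.prems(2) by (auto simp: fresh_def)
  have "move_diff X a m x \<in> incl_span (insert m X) (\<lambda>U. \<not> B \<subseteq> U \<or> \<not> fst ` set ps \<subseteq> U)"
  proof (rule move_diff_incl_span[OF Cons.prems(1) f(1) Cons.prems(3)])
    fix U assume U: "U \<subseteq> X" "\<not> B \<subseteq> U \<or> \<not> fst ` set (p # ps) \<subseteq> U" "a \<in> U"
    then have "\<not> B \<subseteq> U \<or> \<not> fst ` set ps \<subseteq> U" using p by auto
    moreover have "V \<subseteq> U" if "V \<subseteq> insert m (U - {a})" "V \<subseteq> X" for V using that f by auto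
    ultimately show "(\<not> B \<subseteq> U \<or> \<not> fst ` set ps \<subseteq> U) \<and>
      (\<not> B \<subseteq> insert m (U - {a}) \<or> \<not> fst ` set ps \<subseteq> insert m (U - {a}))"
      using fs Cons.prems(4) by blast
  qed
  then have "move_diffs (insert m X) ps (move_diff X a m x) \<in> incl_span (insert m X \<union> snd ` set ps) (\<lambda>U. \<not> B \<subseteq> U)"
    using Cons.prems f by (intro Cons.IH) auto
  then show ?case by (simp add: p)
qed simp

lemma move_diffs_nat:
  assumes "inj_on h (X \<union> snd ` set ps)" "h ` X \<subseteq> X'" "finite X'" "h ` snd ` set ps \<inter> X' = {}"
    "fresh X ps" "x \<in> carrier (M X)"
  shows "act (X \<union> snd ` set ps) (X' \<union> h ` snd ` set ps) h (move_diffs X ps x)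
    = move_diffs X' (map (map_prod h h) ps) (act X X' h x)"
  using assms
proof (induction ps arbitrary: X X' x)
  case (Cons p ps)
  obtain a m where p: "p = (a, m)" by fastforce
  have f: "m \<notin> X" "a \<in> X" "fresh (insert m X) ps" using Cons.prems fresh_Cons p by auto
  have fX: "finite X" using Cons.prems by (meson finite_imageD finite_subset inj_on_subset Un_upper1)
  have m: "m \<notin> snd ` set ps" using Cons.prems p by (force simp: fresh_def)
  have inj: "inj_on h (insert m X \<union> snd ` set ps)" using Cons.prems(1) p by simp
  have "h m \<notin> h ` snd ` set ps"
    using m inj by (auto simp: inj_on_def)
  then have "act (insert m X \<union> snd ` set ps) (insert (h m) X' \<union> h ` snd ` set ps) h (move_diffs (insert m X) ps (move_diff X a m x))
    = move_diffs (insert (h m) X') (map (map_prod h h) ps) (act (insert m X) (insert (h m) X') h (move_diff X a m x))"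
    using Cons.prems f inj p fX by (intro Cons.IH move_diff_closed) auto
  also have "act (insert m X) (insert (h m) X') h (move_diff X a m x) = move_diff X' (h a) (h m) (act X X' h x)"
    using Cons.prems f inj p by (intro move_diff_nat) (auto intro: inj_on_subset)
  finally show ?case by (simp add: p)
qed simp

text \<open>In the expanded product the summand without any move is the inclusion of
  \<open>x\<close>. Every other summand moves some point of \<open>A\<close> away, and since the new
  points lie outside \<open>A\<close>, its sets miss \<open>A\<close> from then on.\<close>

lemma move_diffs_expand:
  assumes "finite X" "fresh X ps" "x \<in> incl_span X (\<lambda>U. card (U - D) \<le> s)"
    "fst ` set ps \<subseteq> A" "A \<inter> D = {}" "A \<subseteq> X"
  shows "move_diffs X ps x \<ominus>\<^bsub>M (X \<union> snd ` set ps)\<^esub> incl X (X \<union> snd ` set ps) x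
     \<in> incl_span (X \<union> snd ` set ps) (\<lambda>U. card (U - D) \<le> s \<and> \<not> A \<subseteq> U)"
  using assms
proof (induction ps arbitrary: X x)
  case Nil
  interpret X: abelian_group "M X" by (rule abelian) fact
  have xc: "x \<in> carrier (M X)" using incl_span_carrier[OF Nil(1,3)] .
  have "move_diffs X [] x \<ominus>\<^bsub>M X\<^esub> incl X X x = \<zero>\<^bsub>M X\<^esub>"
    by (simp only: act_id[OF Nil(1) xc] move_diffs.simps X.minus_self[OF xc])
  then show ?case using incl_span.zero[of X] by (simp del: )
next
  case (Cons p ps)
  obtain a m where p: "p = (a, m)" by fastforce
  have f: "m \<notin> X" "a \<in> X" "fresh (insert m X) ps" using Cons.prems fresh_Cons p by auto
  let ?Q = "\<lambda>U. card (U - D) \<le> s \<and> \<not> A \<subseteq> U"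
  let ?Y = "insert m X" let ?Z = "?Y \<union> snd ` set ps"
  have finY: "finite ?Y" "finite ?Z" using Cons.prems by auto
  interpret Z: abelian_group "M ?Z" by (rule abelian) fact
  \<comment> \<open>The lost point \<open>b\<close> lies outside \<open>D\<close>, which makes up
    for the gain of \<open>k\<close>.\<close>
  have card_le: "card (insert k (U - {b}) - D) \<le> card (U - D)" if "finite U" "b \<in> U" "b \<in> A" for U k b
  proof -
    have "insert k (U - {b}) - D \<subseteq> insert k ((U - D) - {b})" by auto
    then have "card (insert k (U - {b}) - D) \<le> card (insert k ((U - D) - {b}))"
      using that by (intro card_mono) auto
    also have "\<dots> \<le> Suc (card ((U - D) - {b}))" by (simp add: card_insert_le_m1 card_insert_if that(1))
    also have "\<dots> = card (U - D)" using that Cons.prems(5) by (intro card_Suc_Diff1) auto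
    finally show ?thesis .
  qed
  have xc: "x \<in> carrier (M X)" using Cons.prems incl_span_carrier by blast
  define i where "i = incl X ?Y x"
  define v where "v = act X ?Y ((\<lambda>i. i)(a := m)) x"
  have c: "i \<in> carrier (M ?Y)" "v \<in> carrier (M ?Y)"
    unfolding i_def v_def using xc finY inj_on_upd[OF f(1)] upd_image by (auto intro!: act_closed)
  have iSp: "i \<in> incl_span ?Y (\<lambda>U. card (U - D) \<le> s)" unfolding i_def
    using Cons.prems by (intro incl_span_act[OF _ _ _ Cons.prems(3)]) auto
  \<comment> \<open>Once \<open>a \<in> A\<close> has been moved, or was not there at all, the set
    misses \<open>A\<close>; the later moves keep this property.\<close>
  have vSp: "v \<in> incl_span ?Y ?Q" unfolding v_def
  proof (rule incl_span_act[OF finY(1) inj_on_upd[OF f(1)] upd_image Cons.prems(3)])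
    fix U assume U: "U \<subseteq> X" "card (U - D) \<le> s"
    show "\<exists>U'. ((\<lambda>i. i)(a := m)) ` U \<subseteq> U' \<and> U' \<subseteq> insert m X \<and> card (U' - D) \<le> s \<and> \<not> A \<subseteq> U'"
    proof (cases "a \<in> U")
      case True
      have "finite U" using U Cons.prems finite_subset by blast
      moreover have "a \<in> A" "m \<noteq> a" using p Cons.prems f by auto
      ultimately show ?thesis using card_le[of U a m] U True
        by (intro exI[of _ "insert m (U - {a})"]) auto
    next
      case False
      then show ?thesis using p Cons.prems U by (intro exI[of _ U]) (auto)
    qed
  qed
  have "move_diffs ?Y ps v \<in> incl_span ?Z ?Q"
  proof (rule move_diffs_incl_span[OF finY(1) f(3) vSp])
    fix U b k assume U: "(b, k) \<in> set ps" "?Q U" "b \<in> U" "k \<notin> U" "finite U"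
    have "b \<in> fst ` set ps" "k \<in> snd ` set ps" using U(1) by force+
    then have "b \<in> A" "k \<notin> A"
      using Cons.prems(4,6) f(3) by (auto simp: fresh_def)
    with U show "?Q (insert k (U - {b}))" using card_le[of U b k] by auto
  qed
  moreover have "move_diffs ?Y ps i \<ominus>\<^bsub>M ?Z\<^esub> incl ?Y ?Z i \<in> incl_span ?Z ?Q"
    using Cons.prems f finY iSp by (intro Cons.IH) auto
  ultimately have "(move_diffs ?Y ps i \<ominus>\<^bsub>M ?Z\<^esub> incl ?Y ?Z i) \<ominus>\<^bsub>M ?Z\<^esub> move_diffs ?Y ps v \<in> incl_span ?Z ?Q"
    by (meson incl_span_minus finY(2))
  moreover have "incl ?Y ?Z i = incl X ?Z x"
    unfolding i_def using xc finY by (subst act_act) auto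
  moreover have "move_diffs ?Y ps (move_diff X a m x) = move_diffs ?Y ps i \<ominus>\<^bsub>M ?Z\<^esub> move_diffs ?Y ps v"
    unfolding move_diff_def i_def[symmetric] v_def[symmetric]
    using c finY f by (intro move_diffs_minus) auto
  moreover have "move_diffs ?Y ps i \<in> carrier (M ?Z)" "move_diffs ?Y ps v \<in> carrier (M ?Z)"
    using c f finY by (blast intro: move_diffs_closed)+
  moreover have "incl X ?Z x \<in> carrier (M ?Z)"
    using xc finY by (auto intro!: act_closed)
  ultimately have "move_diffs ?Y ps (move_diff X a m x) \<ominus>\<^bsub>M ?Z\<^esub> incl X ?Z x \<in> incl_span ?Z ?Q"
    by (simp only: Z.minus_right_comm)
  then show ?case by (simp add: p)
qed

end

section \<open>Finite torsion degree of iterated derivatives\<close>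

context fi_functor begin

lemma incl_minus:
  "\<lbrakk>finite T; S \<subseteq> T; x \<in> carrier (M S); y \<in> carrier (M S)\<rbrakk> \<Longrightarrow>
   incl S T (x \<ominus>\<^bsub>M S\<^esub> y) = incl S T x \<ominus>\<^bsub>M T\<^esub> incl S T y"
  by (rule act_minus) auto

lemma incl_closed:
  "\<lbrakk>finite T; S \<subseteq> T; x \<in> carrier (M S)\<rbrakk> \<Longrightarrow> incl S T x \<in> carrier (M T)"
  by (rule act_closed) auto

lemma incl_span_incl:
  assumes "finite T" "S \<subseteq> T" "x \<in> incl_span S P" "\<And>U. \<lbrakk>U \<subseteq> S; P U\<rbrakk> \<Longrightarrow> Q U"
  shows "incl S T x \<in> incl_span T Q"
proof (rule incl_span_act[OF assms(1) _ _ assms(3)])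
  fix U assume "U \<subseteq> S" "P U"
  then show "\<exists>U'. (\<lambda>i. i) ` U \<subseteq> U' \<and> U' \<subseteq> T \<and> Q U'"
    using assms(2,4) by (intro exI[of _ U]) auto
qed (use assms(2) in auto)

text \<open>Torsion freeness of the \<open>a\<close>-fold derivative, with the degree measured by \<open>card T\<close>
  instead of \<open>card (T - B)\<close>.\<close>

definition deriv_torsion_free :: "nat \<Rightarrow> nat \<Rightarrow> bool" where
  "deriv_torsion_free a C \<longleftrightarrow> (\<forall>B T T' h v. finite T' \<and> B \<subseteq> T \<and> card B = a \<and> C \<le> card T \<and> inj_on h T \<and> h ` T \<subseteq> T' \<and>
     (\<forall>b\<in>B. h b = b) \<and> v \<in> carrier (M T) \<and> act T T' h v \<in> incl_span T' (\<lambda>U. \<not> B \<subseteq> U) \<longrightarrow>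
     v \<in> incl_span T (\<lambda>U. \<not> B \<subseteq> U))"

lemma deriv_torsion_free_D:
  assumes "deriv_torsion_free (card B) C" "finite T'" "B \<subseteq> T" "C \<le> card T" "inj_on h T" "h ` T \<subseteq> T'"
    "\<And>b. b \<in> B \<Longrightarrow> h b = b" "v \<in> carrier (M T)" "act T T' h v \<in> incl_span T' (\<lambda>U. \<not> B \<subseteq> U)"
  shows "v \<in> incl_span T (\<lambda>U. \<not> B \<subseteq> U)"
  using assms unfolding deriv_torsion_free_def by blast

text \<open>The relation for a single block \<open>A\<close>. Let \<open>z'\<close> be the product
  of the differences moving \<open>star\<close> to \<open>l0\<close> and \<open>A\<close> to
  \<open>M'\<close>, all inside \<open>T\<close>. The injection \<open>h\<close> throws
  \<open>l0\<close> and \<open>M'\<close> out of \<open>T\<close>; there, by naturality,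
  \<open>z'\<close> becomes a product of differences applied to
  \<open>move_diff T star l ?y\<close>, and these kill the sets missing \<open>A\<close>. Torsion
  freeness of the derivative brings the vanishing modulo E_B back to \<open>T\<close>, and expanding
  \<open>z'\<close> expresses \<open>?y\<close> through sets missing \<open>star\<close>,
  \<open>B\<close> or \<open>A\<close>.\<close>

lemma block_step:
  assumes tf: "deriv_torsion_free (card B) C" and fT: "finite T" and D: "B \<subseteq> D" "star \<in> D" "star \<notin> B" "D \<subseteq> T"
    and C: "C \<le> card T" and l: "l \<notin> T"
    and A: "A \<subseteq> T - D" "M' \<subseteq> T - D" "A \<inter> M' = {}" "card A = card M'" "l0 \<in> T" "l0 \<notin> D \<union> A \<union> M'"
    and y0: "y0 \<in> carrier (M (D \<union> A))"
    and dly: "move_diff T star l (incl (D \<union> A) T y0) \<in> incl_span (insert l T) (\<lambda>U. \<not> B \<subseteq> U \<or> \<not> A \<subseteq> U)"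
  shows "incl (D \<union> A) T y0 \<in> incl_span T (\<lambda>U. \<not> insert star B \<subseteq> U
     \<or> (U \<subseteq> D \<union> A \<union> M' \<and> card (U - D) \<le> card A \<and> \<not> A \<subseteq> U))" (is "?y \<in> incl_span T ?R")
proof -
  let ?Y = "D \<union> A"
  have fin: "finite A" "finite M'" "finite D" "finite ?Y"
    using A D fT by (auto dest: finite_subset)
  obtain as ms where as: "distinct as" "set as = A" and ms: "distinct ms" "set ms = M'"
    using fin finite_distinct_list by metis
  have len: "length as = length ms" using as ms A(4) distinct_card by metis
  define ps where "ps = zip as ms"
  have ps: "map fst ps = as" "map snd ps = ms" using len by (auto simp: ps_def)
  have fs: "fst ` set ps = A" "snd ` set ps = M'" using ps as ms by (metis list.set_map)+
  \<comment> \<open>A shift by a number above all of \<open>insert l T\<close> makes the images of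
    \<open>M'\<close> new.\<close>
  define k where "k = Suc (Max (insert l T))"
  have k: "i < k" if "i \<in> insert l T" for i
    using that fT by (auto simp: k_def le_imp_less_Suc)
  \<comment> \<open>\<open>l0\<close> goes to the given point \<open>l\<close>, so that the move of
    \<open>star\<close> to \<open>l0\<close> turns into the move that occurs in
    \<open>dly\<close>.\<close>
  define h where "h i = (if i = l0 then l else if i \<in> M' then i + k else i)" for i
  have hl0: "h l0 = l" by (simp add: h_def)
  have hM: "h i = i + k" if "i \<in> M'" for i using that A by (auto simp: h_def)
  have hY: "h i = i" if "i \<in> ?Y" for i using that A by (auto simp: h_def)
  have hT: "h i = i" if "i \<notin> M'" "i \<noteq> l0" for i using that by (auto simp: h_def)
  have injh: "inj_on h T"
  proof (rule inj_onI)
    fix x y assume "x \<in> T" "y \<in> T" "h x = h y"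
    then show "x = y" using k[of l] k[of x] k[of y] l by (auto simp: h_def split: if_splits)
  qed
  have newM: "h ` M' \<inter> insert l T = {}" using hM k by fastforce
  define ps0 where "ps0 = (star, l0) # ps"
  have fs0: "snd ` set ps0 = insert l0 M'" by (simp add: ps0_def fs)
  have fr: "fresh ?Y ps" using A ps ms fs by (auto simp: fresh_def)
  have fr0: "fresh ?Y ps0" using A ps ms D fs by (auto simp: fresh_def ps0_def)
  have fr1: "fresh (insert l0 ?Y) ps" using fr0 fresh_Cons by (auto simp: ps0_def)
  let ?Yf = "?Y \<union> insert l0 M'"
  have YfT: "?Yf \<subseteq> T" using A D by auto
  have fYf: "finite ?Yf" using finite_subset[OF YfT fT] .
  define z' where "z' = move_diffs ?Y ps0 y0"
  have z'c: "z' \<in> carrier (M ?Yf)" using move_diffs_closed[OF fin(4) fr0 y0] by (simp add: z'_def fs0)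
  define T' where "T' = T \<union> h ` insert l0 M'"
  have fT': "finite T'" using fT fin by (simp add: T'_def)
  have hTT': "h ` T \<subseteq> T'" using hT by (fastforce simp: T'_def)
  have "act ?Yf T' h z' = move_diffs T (map (map_prod h h) ps0) (act ?Y T h y0)"
    unfolding T'_def z'_def fs0[symmetric]
  proof (rule move_diffs_nat)
    show "inj_on h (?Y \<union> snd ` set ps0)" using injh YfT inj_on_subset unfolding fs0 by blast
    show "h ` ?Y \<subseteq> T" using hY YfT by fastforce
    show "h ` snd ` set ps0 \<inter> T = {}" unfolding fs0 using newM l hl0 by auto
  qed (use fr0 fT y0 in auto)
  also have "act ?Y T h = incl ?Y T" by (rule act_cong) (rule hY)
  also have "move_diffs T (map (map_prod h h) ps0) ?y = move_diffs (insert l T) (map (map_prod h h) ps) (move_diff T star l ?y)"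
    using hY D hl0 by (simp add: ps0_def)
  finally have nat: "act ?Yf T' h z' = move_diffs (insert l T) (map (map_prod h h) ps) (move_diff T star l ?y)" .
  have fs': "fst ` set (map (map_prod h h) ps) = A" "snd ` set (map (map_prod h h) ps) = h ` M'"
  proof -
    have "fst ` set (map (map_prod h h) ps) = h ` A" using fs by (simp add: image_image flip: fs(1))
    also have "\<dots> = A" using hY by force
    finally show "fst ` set (map (map_prod h h) ps) = A" .
    show "snd ` set (map (map_prod h h) ps) = h ` M'" by (simp add: image_image flip: fs(2))
  qed
  have "map snd (map (map_prod h h) ps) = map h ms" by (simp flip: ps(2))
  moreover have "inj_on h M'" using injh A inj_on_subset by blast
  ultimately have fr': "fresh (insert l T) (map (map_prod h h) ps)"
    unfolding fresh_def fs' using newM A ms by (auto simp: distinct_map)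
  have "move_diffs (insert l T) (map (map_prod h h) ps) (move_diff T star l ?y) \<in>
     incl_span (insert l T \<union> snd ` set (map (map_prod h h) ps)) (\<lambda>U. \<not> B \<subseteq> U)"
  proof (rule move_diffs_kill[OF _ fr'])
    show "move_diff T star l ?y \<in> incl_span (insert l T) (\<lambda>U. \<not> B \<subseteq> U \<or> \<not> fst ` set (map (map_prod h h) ps) \<subseteq> U)"
      unfolding fs' by (rule dly)
    show "fst ` set (map (map_prod h h) ps) \<inter> B = {}" unfolding fs' using A D by auto
  qed (use fT D in auto)
  moreover have "insert l T \<union> snd ` set (map (map_prod h h) ps) = T'"
    unfolding fs' T'_def using hl0 by auto
  ultimately have inE: "act ?Yf T' h z' \<in> incl_span T' (\<lambda>U. \<not> B \<subseteq> U)" using nat by simp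
  define Z where "Z = incl ?Yf T z'"
  have Zc: "Z \<in> carrier (M T)" unfolding Z_def using z'c fT YfT by (auto intro!: act_closed)
  have "act T T' h Z = act ?Yf T' h z'"
    unfolding Z_def using z'c fT' YfT injh hTT' by (subst act_act) auto
  \<comment> \<open>\<open>h\<close> is the identity on \<open>D\<close>, hence on \<open>B\<close>,
    as the torsion freeness of the derivative at \<open>B\<close> demands.\<close>
  then have ZE: "Z \<in> incl_span T (\<lambda>U. \<not> B \<subseteq> U)"
    using inE tf fT' D C injh hTT' Zc hY by (intro deriv_torsion_free_D[of B C T' T h]) auto
  let ?Y1 = "insert l0 ?Y"
  have fY1: "finite ?Y1" using fin by auto
  have l0Y: "l0 \<notin> ?Y" using A by auto
  define i0 where "i0 = incl ?Y ?Y1 y0"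
  define v0 where "v0 = act ?Y ?Y1 ((\<lambda>i. i)(star := l0)) y0"
  have c0: "i0 \<in> carrier (M ?Y1)" "v0 \<in> carrier (M ?Y1)"
    unfolding i0_def v0_def using y0 fY1 inj_on_upd[OF l0Y] upd_image by (auto intro!: act_closed)
  have Yf1: "?Y1 \<union> snd ` set ps = ?Yf" using fs by auto
  \<comment> \<open>The move of \<open>star\<close> to \<open>l0\<close> is split off:
    \<open>i0\<close> leads to the product over \<open>A\<close> alone, and in \<open>v0\<close> the
    point \<open>star\<close> no longer occurs.\<close>
  have zeq: "z' = move_diffs ?Y1 ps i0 \<ominus>\<^bsub>M ?Yf\<^esub> move_diffs ?Y1 ps v0"
    using move_diffs_minus[OF fY1 fr1 c0] unfolding Yf1 by (simp add: z'_def ps0_def move_diff_def i0_def v0_def)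
  have vSp: "v0 \<in> incl_span ?Y1 (\<lambda>U. star \<notin> U)" unfolding v0_def
  proof (rule incl_span_act[OF fY1 inj_on_upd[OF l0Y] upd_image])
    show "y0 \<in> incl_span ?Y (\<lambda>U. True)" using incl_span_gen[of ?Y ?Y "\<lambda>U. True" y0] act_id fin y0 by simp
    show "\<exists>U'. ((\<lambda>i. i)(star := l0)) ` U \<subseteq> U' \<and> U' \<subseteq> ?Y1 \<and> star \<notin> U'" if "U \<subseteq> ?Y" for U
      using that A D by (intro exI[of _ "insert l0 (?Y - {star})"]) auto
  qed
  have "star \<notin> M'" using A D by auto
  have Dv: "move_diffs ?Y1 ps v0 \<in> incl_span ?Yf (\<lambda>U. star \<notin> U)"
    unfolding Yf1[symmetric]
  proof (rule move_diffs_incl_span[OF fY1 fr1 vSp])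
    fix U a m assume "(a, m) \<in> set ps" "star \<notin> U"
    moreover from this have "m \<in> M'" using fs by force
    ultimately show "star \<notin> insert m (U - {a})" using \<open>star \<notin> M'\<close> by auto
  qed
  have Di: "move_diffs ?Y1 ps i0 = incl (?Y \<union> M') ?Yf (move_diffs ?Y ps y0)"
  proof -
    have "incl (?Y \<union> snd ` set ps) (?Y1 \<union> (\<lambda>i. i) ` snd ` set ps) (move_diffs ?Y ps y0)
       = move_diffs ?Y1 (map (map_prod (\<lambda>i. i) (\<lambda>i. i)) ps) (incl ?Y ?Y1 y0)"
      using fr1 fY1 fr y0 by (intro move_diffs_nat) (auto simp: fresh_def)
    then show ?thesis unfolding image_ident Yf1 unfolding fs by (simp add: i0_def map_prod_def)
  qed
  let ?Ym = "?Y \<union> M'"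
  have Ym: "?Ym \<subseteq> T" "?Ym \<subseteq> ?Yf" "?Y \<subseteq> ?Ym" using YfT by auto
  have fYm: "finite ?Ym" using fin by auto
  have yc: "?y \<in> carrier (M T)" using y0 fT YfT by (auto intro!: act_closed)
  have Dyc: "move_diffs ?Y ps y0 \<in> carrier (M ?Ym)" using move_diffs_closed[OF fin(4) fr y0] by (simp only: fs)
  have y0Sp: "y0 \<in> incl_span ?Y (\<lambda>U. card (U - D) \<le> card A)"
  proof -
    have "?Y - D = A" using A by auto
    then show ?thesis using incl_span_gen[of ?Y ?Y "\<lambda>U. card (U - D) \<le> card A" y0] act_id fin y0 by simp
  qed
  have ex: "move_diffs ?Y ps y0 \<ominus>\<^bsub>M ?Ym\<^esub> incl ?Y ?Ym y0 \<in> incl_span ?Ym (\<lambda>U. card (U - D) \<le> card A \<and> \<not> A \<subseteq> U)"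
    using move_diffs_expand[OF fin(4) fr y0Sp, of A] A unfolding fs by auto
  define y' where "y' = incl ?Ym T (move_diffs ?Y ps y0)"
  define w where "w = incl ?Yf T (move_diffs ?Y1 ps v0)"
  have Dvc: "move_diffs ?Y1 ps v0 \<in> carrier (M ?Yf)" by (rule incl_span_carrier[OF fYf Dv])
  have y'c: "y' \<in> carrier (M T)" unfolding y'_def using Dyc fT Ym by (auto intro!: act_closed)
  have y'eq: "y' = incl ?Yf T (move_diffs ?Y1 ps i0)"
    unfolding Di y'_def using Dyc fT YfT Ym by (subst act_act) auto
  have "incl ?Ym T (move_diffs ?Y ps y0 \<ominus>\<^bsub>M ?Ym\<^esub> incl ?Y ?Ym y0) \<in> incl_span T ?R"
    by (rule incl_span_incl[OF fT Ym(1) ex]) blast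
  moreover have "incl ?Ym T (move_diffs ?Y ps y0 \<ominus>\<^bsub>M ?Ym\<^esub> incl ?Y ?Ym y0) = y' \<ominus>\<^bsub>M T\<^esub> ?y"
  proof -
    have c: "incl ?Y ?Ym y0 \<in> carrier (M ?Ym)" using y0 fYm by (auto intro!: act_closed)
    have "incl ?Ym T (incl ?Y ?Ym y0) = ?y" using y0 fT Ym by (subst act_act) auto
    then show ?thesis unfolding y'_def using incl_minus[OF fT Ym(1) Dyc c] by simp
  qed
  ultimately have 1: "y' \<ominus>\<^bsub>M T\<^esub> ?y \<in> incl_span T ?R" by simp
  have 2: "w \<in> incl_span T ?R" unfolding w_def
    by (rule incl_span_incl[OF fT YfT Dv]) blast
  \<comment> \<open>\<open>Z\<close> lies in E_B(T), \<open>w\<close> comes from sets without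
    \<open>star\<close>, and \<open>y' - ?y\<close> from sets missing \<open>A\<close>. So every
    term except \<open>?y\<close> is already known to be of the required kind.\<close>
  have "Z = y' \<ominus>\<^bsub>M T\<^esub> w"
  proof -
    have "move_diffs ?Y1 ps i0 \<in> carrier (M ?Yf)" using move_diffs_closed[OF fY1 fr1 c0(1)] by (simp only: Yf1)
    then show ?thesis unfolding Z_def zeq y'eq w_def using incl_minus[OF fT YfT _ Dvc] by simp
  qed
  moreover have "Z \<in> incl_span T ?R" using incl_span_mono[OF fT ZE, of ?R] by blast
  ultimately have "y' \<in> incl_span T ?R" using incl_span_minus_left[OF fT _ 2 y'c] by simp
  then show ?thesis using incl_span_minus_right[OF fT 1 _ yc] by simp
qed

text \<open>Induction on the number of points outside \<open>D\<close> that a contribution may use.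
  A round at level s fixes a set \<open>M'\<close> of s points outside \<open>D\<close> and
  eliminates, block by block, the sets whose trace outside \<open>D\<close> has s points and avoids
  \<open>M'\<close>. What is left at this size meets \<open>M'\<close>, so it has fewer than s
  points outside \<open>D \<union> M'\<close>. Each round enlarges \<open>D\<close> by s, and
  \<open>s * s + s + 1\<close> leaves room for all rounds together with \<open>A\<close>,
  \<open>M'\<close> and a spare point.\<close>

lemma fixed_mod_imp_block:
  assumes tf: "deriv_torsion_free (card B) C" and fT: "finite T" and B: "star \<notin> B" and C: "C \<le> card T" and l: "l \<notin> T"
    and dlx: "move_diff T star l x \<in> incl_span (insert l T) (\<lambda>U. \<not> B \<subseteq> U)"
  shows "\<lbrakk>insert star B \<subseteq> D; D \<subseteq> T; card D + s * s + s + 1 \<le> card T;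
    x \<in> incl_span T (\<lambda>U. \<not> insert star B \<subseteq> U \<or> card (U - D) \<le> s)\<rbrakk> \<Longrightarrow>
    x \<in> incl_span T (\<lambda>U. \<not> insert star B \<subseteq> U)"
proof (induction s arbitrary: D)
  \<comment> \<open>Eliminates one block: the summands with \<open>U - D = A\<close> are collected
    in \<open>y\<close>, and all others miss a point of \<open>insert star B\<close> or, by
    \<open>P\<close>, a point of \<open>A\<close>.\<close>
  have step: "x \<in> incl_span T (\<lambda>U. \<not> insert star B \<subseteq> U \<or> P U \<or> (U \<subseteq> D \<union> A \<union> M' \<and> card (U - D) \<le> card A \<and> \<not> A \<subseteq> U))"
    if D: "insert star B \<subseteq> D" "D \<subseteq> T" and A: "A \<subseteq> T - D" "M' \<subseteq> T - D" "A \<inter> M' = {}" "card A = card M'"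
      and cT: "card D + 2 * card A < card T"
      and x: "x \<in> incl_span T (\<lambda>U. \<not> insert star B \<subseteq> U \<or> P U \<or> U - D = A)"
      and P: "\<And>U. P U \<Longrightarrow> \<not> A \<subseteq> U" for D A M' P
  proof -
    have fin: "finite D" "finite A" "finite M'" using D A fT by (auto dest: finite_subset)
    have "card (D \<union> A \<union> M') \<le> card D + card A + card M'"
      by (meson add_le_mono1 card_Un_le le_trans)
    then have "card (D \<union> A \<union> M') < card T" using cT A by simp
    then obtain l0 where l0: "l0 \<in> T" "l0 \<notin> D \<union> A \<union> M'"
      using card_mono[of "D \<union> A \<union> M'" T] fin by fastforce
    interpret T: abelian_group "M T" by (rule abelian) fact
    interpret Tl: abelian_group "M (insert l T)" by (rule abelian) (simp add: fT)
    obtain r y where r: "r \<in> incl_span T (\<lambda>U. \<not> insert star B \<subseteq> U \<or> P U)" and y: "y \<in> incl_span T (\<lambda>U. U - D = A)"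
      and xy: "x = r \<oplus>\<^bsub>M T\<^esub> y"
      using incl_span_split[OF fT x, of "\<lambda>U. \<not> insert star B \<subseteq> U \<or> P U" "\<lambda>U. U - D = A"] by blast
    have rc: "r \<in> carrier (M T)" "y \<in> carrier (M T)" using incl_span_carrier[OF fT r] incl_span_carrier[OF fT y] .
    obtain y0 where y0: "y0 \<in> carrier (M (D \<union> A))" "y = incl (D \<union> A) T y0"
      using incl_span_below[OF fT _ y, of "D \<union> A"] A D by auto
    \<comment> \<open>Only sets containing \<open>star\<close> survive the difference, and such a
      set misses \<open>insert star B\<close> only by missing \<open>B\<close>.\<close>
    have "move_diff T star l r \<in> incl_span (insert l T) (\<lambda>U. \<not> B \<subseteq> U \<or> \<not> A \<subseteq> U)"
    proof (rule move_diff_incl_span[OF fT l r])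
      fix U assume U: "U \<subseteq> T" "\<not> insert star B \<subseteq> U \<or> P U" "star \<in> U"
      then have "\<not> B \<subseteq> U \<or> \<not> A \<subseteq> U" using P by auto
      moreover have "V \<subseteq> U" if "V \<subseteq> insert l (U - {star})" "V \<subseteq> T" for V using that l by auto
      moreover have "A \<subseteq> T" "B \<subseteq> T" using A D by auto
      ultimately show "(\<not> B \<subseteq> U \<or> \<not> A \<subseteq> U) \<and>
        (\<not> B \<subseteq> insert l (U - {star}) \<or> \<not> A \<subseteq> insert l (U - {star}))" by blast
    qed
    moreover have "move_diff T star l x \<in> incl_span (insert l T) (\<lambda>U. \<not> B \<subseteq> U \<or> \<not> A \<subseteq> U)"
      by (rule incl_span_mono[OF _ dlx]) (use fT in auto)
    moreover have "move_diff T star l y = move_diff T star l x \<ominus>\<^bsub>M (insert l T)\<^esub> move_diff T star l r"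
      using move_diff_add[OF fT l rc] move_diff_closed[OF fT l rc(1)] move_diff_closed[OF fT l rc(2)]
      unfolding xy by (metis Tl.a_comm Tl.add_minus_cancel_right)
    ultimately have "move_diff T star l y \<in> incl_span (insert l T) (\<lambda>U. \<not> B \<subseteq> U \<or> \<not> A \<subseteq> U)"
      using incl_span_minus fT by simp
    then have "y \<in> incl_span T (\<lambda>U. \<not> insert star B \<subseteq> U \<or> (U \<subseteq> D \<union> A \<union> M' \<and> card (U - D) \<le> card A \<and> \<not> A \<subseteq> U))"
      unfolding y0(2) using D B A l0 y0
      by (intro block_step[OF tf fT _ _ B _ C l, of D A M' l0]) auto
    then have "y \<in> incl_span T (\<lambda>U. \<not> insert star B \<subseteq> U \<or> P U
        \<or> (U \<subseteq> D \<union> A \<union> M' \<and> card (U - D) \<le> card A \<and> \<not> A \<subseteq> U))"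
      by (rule incl_span_mono[OF fT]) blast
    moreover have "r \<in> incl_span T (\<lambda>U. \<not> insert star B \<subseteq> U \<or> P U
        \<or> (U \<subseteq> D \<union> A \<union> M' \<and> card (U - D) \<le> card A \<and> \<not> A \<subseteq> U))"
      by (rule incl_span_mono[OF fT r]) blast
    ultimately show ?thesis unfolding xy by (intro incl_span_add[OF fT])
  qed
  {
    case 0
    have "x \<in> incl_span T (\<lambda>U. \<not> insert star B \<subseteq> U \<or> False \<or> U - D = {})"
    proof (rule incl_span_mono[OF fT 0(4)])
      fix U assume U: "U \<subseteq> T" "\<not> insert star B \<subseteq> U \<or> card (U - D) \<le> 0"
      have "finite U" using finite_subset[OF U(1) fT] .
      then show "\<exists>U'. U \<subseteq> U' \<and> U' \<subseteq> T \<and> (\<not> insert star B \<subseteq> U' \<or> False \<or> U' - D = {})"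
        using U by (intro exI[of _ U]) auto
    qed
    \<comment> \<open>Here \<open>A\<close> and \<open>M'\<close> are empty. The exceptional sets of
      the step would have to miss the empty set, so there are none.\<close>
    from step[OF 0(1,2) _ _ _ _ _ this, of "{}"] 0 show ?case by simp
  next
    case (Suc s)
    let ?s = "Suc s"
    have fD: "finite D" using finite_subset[OF Suc.prems(2) fT] .
    have "?s \<le> card (T - D)" using Suc.prems by (simp add: card_Diff_subset fD)
    then obtain M' where M': "M' \<subseteq> T - D" "card M' = ?s" by (meson obtain_subset_with_card_n)
    \<comment> \<open>\<open>\<B>\<close> lists the traces of full size, disjoint from
      \<open>M'\<close>, that still have to be eliminated. One and the same \<open>M'\<close> serves
      for all blocks.\<close>
    define R where "R \<B> U \<longleftrightarrow> card (U - D) \<le> ?s \<and> (card (U - D) = ?s \<and> U \<inter> M' = {} \<longrightarrow> U - D \<in> \<B>)" for \<B> U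
    have main: "\<lbrakk>finite \<B>; \<B> \<subseteq> {A. A \<subseteq> T - D - M' \<and> card A = ?s};
      x \<in> incl_span T (\<lambda>U. \<not> insert star B \<subseteq> U \<or> R \<B> U)\<rbrakk> \<Longrightarrow> x \<in> incl_span T (\<lambda>U. \<not> insert star B \<subseteq> U \<or> R {} U)" for \<B>
    proof (induction \<B> rule: finite_induct)
      case (insert A \<B>)
      let ?P = "\<lambda>U. R \<B> U \<and> finite U \<and> \<not> A \<subseteq> U"
      have A: "A \<subseteq> T - D - M'" "card A = ?s" using insert by auto
      have "finite A" using A by (auto intro: card_ge_0_finite)
      have "x \<in> incl_span T (\<lambda>U. \<not> insert star B \<subseteq> U \<or> ?P U \<or> U - D = A)"
      proof (rule incl_span_mono[OF fT insert.prems(2)])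
        fix U assume U: "U \<subseteq> T" "\<not> insert star B \<subseteq> U \<or> R (insert A \<B>) U"
        have fU: "finite U" using finite_subset[OF U(1) fT] .
        have "\<not> insert star B \<subseteq> U \<or> ?P U \<or> U - D = A"
        proof (cases "insert star B \<subseteq> U \<and> U - D \<noteq> A")
          case True
          then have RU: "R (insert A \<B>) U" using U by simp
          then have "R \<B> U" using True by (auto simp: R_def)
          \<comment> \<open>A set with at most \<open>card A\<close> points outside \<open>D\<close>
            that contains \<open>A\<close> has trace exactly \<open>A\<close>.\<close>
          moreover have "\<not> A \<subseteq> U"
          proof
            assume "A \<subseteq> U"
            then have "A \<subseteq> U - D" using A by auto
            moreover have "card (U - D) \<le> card A" using RU A by (simp add: R_def)
            ultimately have "A = U - D" using fU by (intro card_seteq) auto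
            then show False using True by simp
          qed
          ultimately show ?thesis using fU by simp
        qed auto
        then show "\<exists>U'. U \<subseteq> U' \<and> U' \<subseteq> T \<and> (\<not> insert star B \<subseteq> U' \<or> ?P U' \<or> U' - D = A)"
          using U by blast
      qed
      then have "x \<in> incl_span T (\<lambda>U. \<not> insert star B \<subseteq> U \<or> ?P U
          \<or> (U \<subseteq> D \<union> A \<union> M' \<and> card (U - D) \<le> card A \<and> \<not> A \<subseteq> U))"
        using A M' Suc.prems by (intro step) auto
      then have "x \<in> incl_span T (\<lambda>U. \<not> insert star B \<subseteq> U \<or> R \<B> U)"
      proof (rule incl_span_mono[OF fT])
        fix U assume U: "U \<subseteq> T" "\<not> insert star B \<subseteq> U \<or> ?P U
          \<or> (U \<subseteq> D \<union> A \<union> M' \<and> card (U - D) \<le> card A \<and> \<not> A \<subseteq> U)"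
        \<comment> \<open>A set produced by the step either meets \<open>M'\<close> or has a proper
          subset of \<open>A\<close> as its trace, so no block of full size comes back.\<close>
        have "R \<B> U" if "U \<subseteq> D \<union> A \<union> M'" "card (U - D) \<le> card A" "\<not> A \<subseteq> U"
        proof -
          have "card (U - D) < card A" if e: "U \<inter> M' = {}"
          proof -
            have "U - D \<subset> A" using e \<open>U \<subseteq> D \<union> A \<union> M'\<close> \<open>\<not> A \<subseteq> U\<close> by auto
            then show ?thesis using \<open>finite A\<close> by (simp add: psubset_card_mono)
          qed
          then show ?thesis using that A by (auto simp: R_def)
        qed
        then show "\<exists>U'. U \<subseteq> U' \<and> U' \<subseteq> T \<and> (\<not> insert star B \<subseteq> U' \<or> R \<B> U')" using U by blast
      qed
      then show ?case using insert by auto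
    qed simp
    have "x \<in> incl_span T (\<lambda>U. \<not> insert star B \<subseteq> U \<or> R {} U)"
    proof (rule main)
      show "finite {A. A \<subseteq> T - D - M' \<and> card A = ?s}"
        by (rule finite_subset[of _ "Pow T"]) (use fT in auto)
      show "x \<in> incl_span T (\<lambda>U. \<not> insert star B \<subseteq> U \<or> R {A. A \<subseteq> T - D - M' \<and> card A = ?s} U)"
        by (rule incl_span_mono[OF fT Suc.prems(4)]) (auto simp: R_def)
    qed simp
    then have "x \<in> incl_span T (\<lambda>U. \<not> insert star B \<subseteq> U \<or> card (U - (D \<union> M')) \<le> s)"
    proof (rule incl_span_mono[OF fT])
      fix U assume U: "U \<subseteq> T" "\<not> insert star B \<subseteq> U \<or> R {} U"
      have fU: "finite U" using finite_subset[OF U(1) fT] .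
      have "card (U - (D \<union> M')) \<le> s" if "R {} U"
      proof (cases "card (U - D) = ?s")
        case True
        then have "U \<inter> M' \<noteq> {}" using that by (auto simp: R_def)
        then have "U - (D \<union> M') \<subset> U - D" using M' by auto
        then have "card (U - (D \<union> M')) < card (U - D)" using fU by (intro psubset_card_mono) auto
        then show ?thesis using True by simp
      next
        case False
        then have "card (U - D) \<le> s" using that by (simp add: R_def)
        moreover have "card (U - (D \<union> M')) \<le> card (U - D)" using fU by (intro card_mono) auto
        ultimately show ?thesis by simp
      qed
      then show "\<exists>U'. U \<subseteq> U' \<and> U' \<subseteq> T \<and> (\<not> insert star B \<subseteq> U' \<or> card (U' - (D \<union> M')) \<le> s)"
        using U by blast
    qed
    moreover have "card (D \<union> M') = card D + ?s"
      using M' fD fT by (subst card_Un_disjoint) (auto dest: finite_subset)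
    ultimately show ?case using Suc.prems M' by (intro Suc.IH[of "D \<union> M'"]) auto
  }
qed

definition generated_upto :: "nat \<Rightarrow> bool" where
  "generated_upto N \<longleftrightarrow> (\<forall>T x. finite T \<longrightarrow> x \<in> carrier (M T) \<longrightarrow> x \<in> incl_span T (\<lambda>U. card U \<le> N))"

text \<open>The block elimination starts with \<open>D = insert star B\<close> and level
  \<open>N\<close>, since generation in degree \<open>N\<close> bounds the size of every
  contributing set. The constant is \<open>C\<close> for torsion freeness plus
  \<open>card D + N * N + N + 1\<close>, where \<open>card D = card B + 1\<close>.\<close>

lemma fixed_mod_imp:
  assumes "generated_upto N" "deriv_torsion_free (card B) C" "finite T" "insert star B \<subseteq> T" "star \<notin> B" "l \<notin> T"
    "C + card B + N * N + N + 2 \<le> card T" "x \<in> carrier (M T)"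
    "move_diff T star l x \<in> incl_span (insert l T) (\<lambda>U. \<not> B \<subseteq> U)"
  shows "x \<in> incl_span T (\<lambda>U. \<not> insert star B \<subseteq> U)"
proof (rule fixed_mod_imp_block[OF assms(2,3,5) _ assms(6,9)])
  have fB: "finite B" using assms(3,4) by (auto dest: finite_subset)
  then show "card (insert star B) + N * N + N + 1 \<le> card T" using assms by simp
  have "x \<in> incl_span T (\<lambda>U. card U \<le> N)" using assms by (auto simp: generated_upto_def)
  then show "x \<in> incl_span T (\<lambda>U. \<not> insert star B \<subseteq> U \<or> card (U - insert star B) \<le> N)"
  proof (rule incl_span_mono[OF assms(3)])
    fix U assume U: "U \<subseteq> T" "card U \<le> N"
    have "card (U - insert star B) \<le> card U"
      using finite_subset[OF U(1) assms(3)] by (intro card_mono) auto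
    then show "\<exists>U'. U \<subseteq> U' \<and> U' \<subseteq> T \<and> (\<not> insert star B \<subseteq> U' \<or> card (U' - insert star B) \<le> N)"
      using U by (intro exI[of _ U]) auto
  qed
qed (use assms in auto)

text \<open>It is enough to add one point: \<open>h\<close> is a bijection onto its image followed
  by an inclusion, and an inclusion adds points singly while \<open>C \<le> card T\<close> persists.
  The bijection fixes \<open>B\<close> pointwise, so its inverse preserves E_B.\<close>

lemma deriv_torsion_free_I:
  assumes one: "\<And>B T l v. \<lbrakk>finite T; B \<subseteq> T; l \<notin> T; card B = a; C \<le> card T; v \<in> carrier (M T);
    incl T (insert l T) v \<in> incl_span (insert l T) (\<lambda>U. \<not> B \<subseteq> U)\<rbrakk> \<Longrightarrow> v \<in> incl_span T (\<lambda>U. \<not> B \<subseteq> U)"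
  shows "deriv_torsion_free a C"
  unfolding deriv_torsion_free_def
proof (intro allI impI, elim conjE)
  fix B T T' h v
  assume as: "finite T'" "B \<subseteq> T" "card B = a" "C \<le> card T" "inj_on h T" "h ` T \<subseteq> T'"
    "\<forall>b\<in>B. h b = b" "v \<in> carrier (M T)" "act T T' h v \<in> incl_span T' (\<lambda>U. \<not> B \<subseteq> U)"
  have fT: "finite T" using as by (meson finite_imageD finite_subset)
  have incl: "v \<in> incl_span T (\<lambda>U. \<not> B \<subseteq> U)"
    if "finite E" "finite T" "B \<subseteq> T" "C \<le> card T" "E \<inter> T = {}" "v \<in> carrier (M T)"
      "incl T (T \<union> E) v \<in> incl_span (T \<union> E) (\<lambda>U. \<not> B \<subseteq> U)" for E T v
    using that
  proof (induction E rule: finite_induct)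
    case empty then show ?case using act_id by simp
  next
    case (insert l E)
    have "incl T (T \<union> insert l E) v = incl (T \<union> E) (insert l (T \<union> E)) (incl T (T \<union> E) v)"
      using insert.prems insert.hyps by (subst act_act) auto
    then have "incl (T \<union> E) (insert l (T \<union> E)) (incl T (T \<union> E) v) \<in> incl_span (insert l (T \<union> E)) (\<lambda>U. \<not> B \<subseteq> U)"
      using insert.prems by simp
    moreover have "card T \<le> card (T \<union> E)" using insert by (intro card_mono) auto
    moreover have "incl T (T \<union> E) v \<in> carrier (M (T \<union> E))"
      using insert by (intro act_closed) auto
    ultimately have "incl T (T \<union> E) v \<in> incl_span (T \<union> E) (\<lambda>U. \<not> B \<subseteq> U)"
      by (intro one[of "T \<union> E" B l]) (use insert as in auto)
    then show ?case using insert by auto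
  qed
  let ?H = "h ` T" let ?g = "the_inv_into T h"
  have g: "inj_on ?g ?H" "?g ` ?H \<subseteq> T" using as by (auto simp: inj_on_the_inv_into the_inv_into_into)
  have gh: "?g (h i) = i" if "i \<in> T" for i using that as by (simp add: the_inv_into_f_f)
  define v' where "v' = act T ?H h v"
  have v'c: "v' \<in> carrier (M ?H)" unfolding v'_def using as fT by (intro act_closed) auto
  have BH: "B \<subseteq> ?H" using as by force
  have "incl ?H T' v' = act T T' h v" unfolding v'_def using as by (subst act_act) auto
  moreover have "?H \<union> (T' - ?H) = T'" using as by auto
  ultimately have "incl ?H (?H \<union> (T' - ?H)) v' \<in> incl_span (?H \<union> (T' - ?H)) (\<lambda>U. \<not> B \<subseteq> U)"
    using as by simp
  then have "v' \<in> incl_span ?H (\<lambda>U. \<not> B \<subseteq> U)"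
    by (rule incl[of "T' - ?H" ?H v', rotated -1]) (use as fT BH v'c in \<open>auto simp: card_image\<close>)
  then have "act ?H T ?g v' \<in> incl_span T (\<lambda>U. \<not> B \<subseteq> U)"
  proof (rule incl_span_act[OF fT g])
    fix U assume U: "U \<subseteq> ?H" "\<not> B \<subseteq> U"
    have "\<not> B \<subseteq> ?g ` U"
    proof
      assume b: "B \<subseteq> ?g ` U"
      have "b \<in> U" if bB: "b \<in> B" for b
      proof -
        obtain u where u: "u \<in> U" "b = ?g u" using b bB by blast
        then obtain t where "t \<in> T" "u = h t" using U by blast
        then show ?thesis using u gh as bB by auto
      qed
      then show False using U by blast
    qed
    then show "\<exists>U'. ?g ` U \<subseteq> U' \<and> U' \<subseteq> T \<and> \<not> B \<subseteq> U'" using U g by blast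
  qed
  moreover have "act ?H T ?g v' = v"
  proof -
    have "act ?H T ?g v' = act T T (\<lambda>i. ?g (h i)) v" unfolding v'_def
      using as fT g by (subst act_act) auto
    also have "act T T (\<lambda>i. ?g (h i)) = incl T T" by (rule act_cong) (rule gh)
    finally show ?thesis using act_id as fT by simp
  qed
  ultimately show "v \<in> incl_span T (\<lambda>U. \<not> B \<subseteq> U)" by simp
qed

text \<open>Write B' = B + star. If \<open>v\<close> lands in E_B' after \<open>l\<close> is added,
  then modulo E_B it equals a part \<open>w\<close> without \<open>star\<close>; renaming
  \<open>l\<close> as \<open>star\<close> in \<open>w\<close> gives \<open>v'\<close> on
  \<open>T\<close>. As \<open>v\<close> does not involve \<open>l\<close>, the new point in
  \<open>w\<close> can be replaced by another one modulo E_B. Hence \<open>v'\<close> is invariant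
  modulo E_B when \<open>star\<close> is moved, and \<open>fixed_mod_imp\<close> puts it into E_B'.
  Finally v - v' lies in E_B by torsion freeness for \<open>B\<close>.\<close>

lemma deriv_torsion_free_Suc:
  assumes gen: "generated_upto N" and tf: "deriv_torsion_free a C"
  shows "deriv_torsion_free (Suc a) (C + a + N * N + N + 2)"
proof (rule deriv_torsion_free_I)
  fix B' T l v
  assume fT: "finite T" and B'T: "B' \<subseteq> T" and l: "l \<notin> T" and cB': "card B' = Suc a"
    and cT: "C + a + N * N + N + 2 \<le> card T" and v: "v \<in> carrier (M T)"
    and vE: "incl T (insert l T) v \<in> incl_span (insert l T) (\<lambda>U. \<not> B' \<subseteq> U)"
  obtain star where star: "star \<in> B'" using cB' by (metis card.empty equals0I nat.distinct(1))
  define B where "B = B' - {star}"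
  have fB': "finite B'" using finite_subset[OF B'T fT] .
  have B: "B' = insert star B" "star \<notin> B" "card B = a" "B \<subseteq> T" "star \<in> T" "star \<noteq> l" "l \<notin> B"
    using star cB' fB' B'T l by (auto simp: B_def)
  let ?Tl = "insert l T" let ?Q = "?Tl - {star}"
  have fTl: "finite ?Tl" using fT by simp
  \<comment> \<open>A second new point, against which \<open>l\<close> is compared.\<close>
  define l' where "l' = Suc (Max ?Tl)"
  have "i \<le> Max ?Tl" if "i \<in> ?Tl" for i using fTl that by simp
  then have l': "l' \<notin> ?Tl" unfolding l'_def by (meson not_less_eq_eq order_refl)
  let ?Tll = "insert l' ?Tl"
  have fTll: "finite ?Tll" using fT by simp
  interpret Tl: abelian_group "M ?Tl" by (rule abelian) fact
  interpret Tll: abelian_group "M ?Tll" by (rule abelian) fact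
  interpret T: abelian_group "M T" by (rule abelian) fact
  define iv where "iv = incl T ?Tl v"
  have ivc: "iv \<in> carrier (M ?Tl)" unfolding iv_def using v fT by (auto intro!: act_closed)
  obtain e w where e: "e \<in> incl_span ?Tl (\<lambda>U. \<not> B \<subseteq> U)" and w: "w \<in> incl_span ?Tl (\<lambda>U. star \<notin> U)"
    and ew: "iv = e \<oplus>\<^bsub>M ?Tl\<^esub> w"
    using incl_span_split[OF fTl vE, of "\<lambda>U. \<not> B \<subseteq> U" "\<lambda>U. star \<notin> U"] unfolding iv_def B(1) by blast
  have ewc: "e \<in> carrier (M ?Tl)" "w \<in> carrier (M ?Tl)" using incl_span_carrier[OF fTl e] incl_span_carrier[OF fTl w] .
  have ivw: "iv \<ominus>\<^bsub>M ?Tl\<^esub> w \<in> incl_span ?Tl (\<lambda>U. \<not> B \<subseteq> U)"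
    using e ew ewc by (simp add: Tl.add_minus_cancel_right)
  obtain w0 where w0: "w0 \<in> carrier (M ?Q)" "w = incl ?Q ?Tl w0"
    using incl_span_below[OF fTl _ w, of ?Q] by auto
  \<comment> \<open>\<open>?f\<close> renames \<open>l\<close> as \<open>star\<close> and
    \<open>?mv\<close> undoes this; \<open>?tau\<close> replaces the first new point by the second;
    \<open>?h\<close> turns the move of \<open>star\<close> to \<open>l\<close> into the comparison
    of \<open>l\<close> with \<open>l'\<close>.\<close>
  let ?f = "(\<lambda>i. i)(l := star)" let ?tau = "(\<lambda>i. i)(l := l')" let ?mv = "(\<lambda>i. i)(star := l)"
  let ?h = "(\<lambda>i. i)(star := l, l := l')"
  have fQ: "inj_on ?f ?Q" "?f ` ?Q \<subseteq> T" using B by (auto simp: inj_on_def)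
  have fmv: "inj_on ?mv T" "?mv ` T \<subseteq> ?Tl" using l by (auto simp: inj_on_def)
  have fh: "inj_on ?h ?Tl" "?h ` ?Tl \<subseteq> ?Tll" using l' B by (auto simp: inj_on_def)
  have ftau: "inj_on ?tau ?Tl" "?tau ` ?Tl \<subseteq> ?Tll" using l' by (auto simp: inj_on_def)
  define v' where "v' = act ?Q T ?f w0"
  have v'c: "v' \<in> carrier (M T)" unfolding v'_def by (rule act_closed[OF fT fQ w0(1)])
  have wv': "w = act T ?Tl ?mv v'"
  proof -
    have "act T ?Tl ?mv v' = act ?Q ?Tl (\<lambda>i. ?mv (?f i)) w0" unfolding v'_def
      using fTl fQ fmv w0 by (intro act_act) auto
    also have "act ?Q ?Tl (\<lambda>i. ?mv (?f i)) = incl ?Q ?Tl" by (rule act_cong) auto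
    finally show ?thesis unfolding w0(2) by (rule sym)
  qed
  define b where "b = incl ?Q ?Tll w0"
  define c where "c = act ?Q ?Tll ?tau w0"
  define a0 where "a0 = incl T ?Tll v"
  have tauQ: "inj_on ?tau ?Q" "?tau ` ?Q \<subseteq> ?Tll"
    by (rule inj_on_subset[OF ftau(1)], blast) (use ftau(2) in blast)
  have abc: "a0 \<in> carrier (M ?Tll)" "b \<in> carrier (M ?Tll)" "c \<in> carrier (M ?Tll)"
    unfolding a0_def b_def c_def using act_closed[OF fTll _ _ v, of "\<lambda>i. i"]
      act_closed[OF fTll _ _ w0(1), of "\<lambda>i. i"] act_closed[OF fTll tauQ w0(1)] by auto
  have 1: "a0 \<ominus>\<^bsub>M ?Tll\<^esub> b \<in> incl_span ?Tll (\<lambda>U. \<not> B \<subseteq> U)"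
  proof -
    have "incl ?Tl ?Tll (iv \<ominus>\<^bsub>M ?Tl\<^esub> w) \<in> incl_span ?Tll (\<lambda>U. \<not> B \<subseteq> U)"
      by (rule incl_span_incl[OF fTll _ ivw]) auto
    moreover have "incl ?Tl ?Tll iv = a0" unfolding a0_def iv_def
      using v fTll by (subst act_act) auto
    moreover have "incl ?Tl ?Tll w = b" unfolding b_def w0(2)
      using w0 fTll by (subst act_act) auto
    ultimately show ?thesis using incl_minus[OF fTll subset_insertI ivc ewc(2)] by simp
  qed
  have 2: "a0 \<ominus>\<^bsub>M ?Tll\<^esub> c \<in> incl_span ?Tll (\<lambda>U. \<not> B \<subseteq> U)"
  proof -
    have "act ?Tl ?Tll ?tau (iv \<ominus>\<^bsub>M ?Tl\<^esub> w) \<in> incl_span ?Tll (\<lambda>U. \<not> B \<subseteq> U)"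
    proof (rule incl_span_act[OF fTll ftau ivw])
      fix U assume "U \<subseteq> ?Tl" "\<not> B \<subseteq> U"
      moreover have "l' \<notin> B" using l' B by auto
      ultimately have "\<not> B \<subseteq> ?tau ` U" by auto
      then show "\<exists>U'. ?tau ` U \<subseteq> U' \<and> U' \<subseteq> ?Tll \<and> \<not> B \<subseteq> U'"
        using \<open>U \<subseteq> ?Tl\<close> ftau by blast
    qed
    \<comment> \<open>\<open>iv\<close> comes from \<open>T\<close>, which does not contain
      \<open>l\<close>, so moving \<open>l\<close> leaves it unchanged.\<close>
    moreover have "act ?Tl ?Tll ?tau iv = a0"
    proof -
      have "act ?Tl ?Tll ?tau iv = act T ?Tll (\<lambda>i. ?tau i) v" unfolding iv_def
        using v fTll ftau by (intro act_act) auto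
      also have "act T ?Tll (\<lambda>i. ?tau i) = incl T ?Tll" using l by (intro act_cong) auto
      finally show ?thesis unfolding a0_def .
    qed
    moreover have "act ?Tl ?Tll ?tau w = c" unfolding c_def w0(2)
      using w0 fTll ftau by (subst act_act) auto
    ultimately show ?thesis using act_minus[OF fTll ftau ivc ewc(2)] by (simp only:)
  qed
  have bc: "b \<ominus>\<^bsub>M ?Tll\<^esub> c \<in> incl_span ?Tll (\<lambda>U. \<not> B \<subseteq> U)"
  proof -
    have "(a0 \<ominus>\<^bsub>M ?Tll\<^esub> c) \<ominus>\<^bsub>M ?Tll\<^esub> (a0 \<ominus>\<^bsub>M ?Tll\<^esub> b) = b \<ominus>\<^bsub>M ?Tll\<^esub> c"
      using abc by (metis Tll.minus_closed Tll.minus_minus_cancel Tll.minus_right_comm)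
    then show ?thesis using incl_span_minus[OF fTll 2 1] by simp
  qed
  have dlc: "move_diff T star l v' \<in> carrier (M ?Tl)" by (rule move_diff_closed) fact+
  \<comment> \<open>Under \<open>?h\<close> the two terms of the difference become the copies
    \<open>b\<close> and \<open>c\<close> of \<open>w0\<close> that use \<open>l\<close> and
    \<open>l'\<close>.\<close>
  have hd: "act ?Tl ?Tll ?h (move_diff T star l v') = b \<ominus>\<^bsub>M ?Tll\<^esub> c"
  proof -
    have p1: "incl T ?Tl v' \<in> carrier (M ?Tl)" using v'c fT by (auto intro!: act_closed)
    have "act ?Tl ?Tll ?h (move_diff T star l v') = act ?Tl ?Tll ?h (incl T ?Tl v') \<ominus>\<^bsub>M ?Tll\<^esub> act ?Tl ?Tll ?h w"
      unfolding move_diff_def wv'[symmetric] by (rule act_minus[OF fTll fh p1 ewc(2)])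
    moreover have "act ?Tl ?Tll ?h (incl T ?Tl v') = b"
    proof -
      have "act ?Tl ?Tll ?h (incl T ?Tl v') = act T ?Tll ?h v'"
        using v'c fTll fh by (subst act_act) auto
      also have "\<dots> = act ?Q ?Tll (\<lambda>i. ?h (?f i)) w0" unfolding v'_def
      proof (rule act_act[OF fTll fQ _ _ w0(1)])
        show "inj_on ?h T" using fh(1) inj_on_subset by blast
        show "?h ` T \<subseteq> ?Tll" using fh(2) by blast
      qed
      also have "act ?Q ?Tll (\<lambda>i. ?h (?f i)) = incl ?Q ?Tll" using B by (intro act_cong) auto
      finally show ?thesis unfolding b_def .
    qed
    moreover have "act ?Tl ?Tll ?h w = c"
    proof -
      have "act ?Tl ?Tll ?h w = act ?Q ?Tll (\<lambda>i. ?h i) w0" unfolding w0(2)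
        using w0 fTll fh by (intro act_act) auto
      also have "act ?Q ?Tll (\<lambda>i. ?h i) = act ?Q ?Tll ?tau" using B by (intro act_cong) auto
      finally show ?thesis unfolding c_def .
    qed
    ultimately show ?thesis by simp
  qed
  have cTl: "C \<le> card ?Tl" using cT fT l by simp
  have dlE: "move_diff T star l v' \<in> incl_span ?Tl (\<lambda>U. \<not> B \<subseteq> U)"
  proof (rule deriv_torsion_free_D[of B C ?Tll ?Tl ?h])
    show "deriv_torsion_free (card B) C" using tf B by simp
    show "?h b = b" if "b \<in> B" for b using B that by auto
    show "act ?Tl ?Tll ?h (move_diff T star l v') \<in> incl_span ?Tll (\<lambda>U. \<not> B \<subseteq> U)" unfolding hd by (rule bc)
  qed (use fTll B cTl fh dlc in auto)
  have v'E: "v' \<in> incl_span T (\<lambda>U. \<not> B' \<subseteq> U)" unfolding B(1)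
    by (rule fixed_mod_imp[OF gen _ fT _ _ l _ v'c dlE]) (use tf B cT in auto)
  have "incl T ?Tl (v \<ominus>\<^bsub>M T\<^esub> v') \<in> incl_span ?Tl (\<lambda>U. \<not> B \<subseteq> U)"
  proof -
    have c: "incl T ?Tl v' \<in> carrier (M ?Tl)" using v'c fTl by (auto intro!: act_closed)
    have "incl T ?Tl (v \<ominus>\<^bsub>M T\<^esub> v') = iv \<ominus>\<^bsub>M ?Tl\<^esub> incl T ?Tl v'"
      unfolding iv_def by (rule incl_minus[OF fTl _ v v'c]) auto
    also have "\<dots> = (iv \<ominus>\<^bsub>M ?Tl\<^esub> w) \<ominus>\<^bsub>M ?Tl\<^esub> move_diff T star l v'"
      unfolding move_diff_def wv'[symmetric] using c ivc ewc by (simp only: Tl.minus_minus_minus)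
    finally show ?thesis using incl_span_minus[OF fTl ivw dlE] by simp
  qed
  then have "v \<ominus>\<^bsub>M T\<^esub> v' \<in> incl_span T (\<lambda>U. \<not> B \<subseteq> U)"
    using tf B fTl cT v v'c by (intro deriv_torsion_free_D[of B C ?Tl T "\<lambda>i. i"]) auto
  then have "v \<ominus>\<^bsub>M T\<^esub> v' \<in> incl_span T (\<lambda>U. \<not> B' \<subseteq> U)"
    by (rule incl_span_mono[OF fT]) (auto simp: B(1))
  then show "v \<in> incl_span T (\<lambda>U. \<not> B' \<subseteq> U)" by (rule incl_span_minus_left[OF fT _ v'E v])
qed

lemma deriv_torsion_free_mono:
  assumes "deriv_torsion_free a C" "C \<le> C'" shows "deriv_torsion_free a C'"
  unfolding deriv_torsion_free_def
proof (intro allI impI, elim conjE)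
  fix B T T' h v
  assume "finite T'" "B \<subseteq> T" "card B = a" "C' \<le> card T" "inj_on h T" "h ` T \<subseteq> T'"
    "\<forall>b\<in>B. h b = b" "v \<in> carrier (M T)" "act T T' h v \<in> incl_span T' (\<lambda>U. \<not> B \<subseteq> U)"
  then show "v \<in> incl_span T (\<lambda>U. \<not> B \<subseteq> U)" using assms by (intro deriv_torsion_free_D[of B C T' T h]) auto
qed

text \<open>Thresholds may be enlarged, so finitely many derivatives can share one.\<close>

lemma deriv_torsion_free_all:
  assumes "generated_upto N" "deriv_torsion_free 0 C0"
  shows "\<exists>C. \<forall>a\<le>n. deriv_torsion_free a C"
proof (induction n)
  case 0 then show ?case using assms by auto
next
  case (Suc n)
  then obtain C where C: "\<forall>a\<le>n. deriv_torsion_free a C" by blast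
  then have "deriv_torsion_free (Suc n) (C + n + N * N + N + 2)" using deriv_torsion_free_Suc assms by blast
  then show ?case using C deriv_torsion_free_mono by (intro exI[of _ "C + n + N * N + N + 2"]) (auto simp: le_Suc_eq)
qed

end

section \<open>Kernels and saturation\<close>

context fi_functor begin

lemma incl_span_False:
  assumes "finite T" "x \<in> incl_span T P" "\<And>U. \<not> P U"
  shows "x = \<zero>\<^bsub>M T\<^esub>"
  using assms(2) by (cases) (use assms(3) in auto)

text \<open>No set fails to contain the empty set, so E_B is zero for \<open>B = {}\<close> and the
  condition becomes ordinary torsion freeness.\<close>

lemma deriv_torsion_free_0I:
  assumes "\<And>S T f x. \<lbrakk>finite T; inj_on f S; f ` S \<subseteq> T; C \<le> card S; x \<in> carrier (M S); act S T f x = \<zero>\<^bsub>M T\<^esub>\<rbrakk>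
    \<Longrightarrow> x = \<zero>\<^bsub>M S\<^esub>"
  shows "deriv_torsion_free 0 C"
proof (rule deriv_torsion_free_I)
  fix B T l v
  assume as: "finite T" "B \<subseteq> T" "l \<notin> T" "card B = 0" "C \<le> card T" "v \<in> carrier (M T)"
    "incl T (insert l T) v \<in> incl_span (insert l T) (\<lambda>U. \<not> B \<subseteq> U)"
  have "B = {}" using as finite_subset[OF as(2,1)] by simp
  then have "incl T (insert l T) v = \<zero>\<^bsub>M (insert l T)\<^esub>"
    using incl_span_False[OF _ as(7)] as(1) by simp
  then have "v = \<zero>\<^bsub>M T\<^esub>"
    by (intro assms[OF _ _ _ as(5,6), of "insert l T" "\<lambda>i. i"]) (use as(1) in auto)
  then show "v \<in> incl_span T (\<lambda>U. \<not> B \<subseteq> U)" using incl_span.zero by simp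
qed

end

section \<open>Kernels of surjections of FI-functors\<close>

locale fi_surjection = F: fi_functor MF aF + V: fi_functor MV aV
  for MF :: "nat set \<Rightarrow> ('u,'x) ring_scheme" and aF and MV :: "nat set \<Rightarrow> ('v,'y) ring_scheme" and aV +
  fixes p :: "nat set \<Rightarrow> 'u \<Rightarrow> 'v"
  assumes p_add: "\<lbrakk>finite T; x \<in> carrier (MF T); y \<in> carrier (MF T)\<rbrakk> \<Longrightarrow>
      p T (x \<oplus>\<^bsub>MF T\<^esub> y) = p T x \<oplus>\<^bsub>MV T\<^esub> p T y"
    and p_incl: "\<lbrakk>finite T; S \<subseteq> T; x \<in> carrier (MF S)\<rbrakk> \<Longrightarrow>
      p T (aF S T (\<lambda>i. i) x) = aV S T (\<lambda>i. i) (p S x)"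
    and p_surj: "finite T \<Longrightarrow> p T ` carrier (MF T) = carrier (MV T)"
begin

lemma p_closed: "finite T \<Longrightarrow> x \<in> carrier (MF T) \<Longrightarrow> p T x \<in> carrier (MV T)"
  using p_surj by blast

lemma p_zero: assumes "finite T" shows "p T \<zero>\<^bsub>MF T\<^esub> = \<zero>\<^bsub>MV T\<^esub>"
proof -
  interpret F: abelian_group "MF T" by (rule F.abelian) fact
  interpret V: abelian_group "MV T" by (rule V.abelian) fact
  have "p T \<zero>\<^bsub>MF T\<^esub> \<oplus>\<^bsub>MV T\<^esub> p T \<zero>\<^bsub>MF T\<^esub> = p T \<zero>\<^bsub>MF T\<^esub>"
    using p_add[OF assms, of "\<zero>\<^bsub>MF T\<^esub>" "\<zero>\<^bsub>MF T\<^esub>"] by simp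
  then show ?thesis using V.add.l_cancel_one p_closed[OF assms F.zero_closed] by simp
qed

lemma p_minus:
  assumes "finite T" "x \<in> carrier (MF T)" "y \<in> carrier (MF T)"
  shows "p T (x \<ominus>\<^bsub>MF T\<^esub> y) = p T x \<ominus>\<^bsub>MV T\<^esub> p T y"
proof -
  interpret F: abelian_group "MF T" by (rule F.abelian) fact
  interpret V: abelian_group "MV T" by (rule V.abelian) fact
  have c: "p T (x \<ominus>\<^bsub>MF T\<^esub> y) \<in> carrier (MV T)" "p T y \<in> carrier (MV T)"
    using assms by (auto intro!: p_closed)
  have "p T x = p T (x \<ominus>\<^bsub>MF T\<^esub> y) \<oplus>\<^bsub>MV T\<^esub> p T y"
    using p_add[OF assms(1) F.minus_closed[OF assms(2,3)] assms(3)] assms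
    by (simp add: F.minus_add_cancel_right)
  then show ?thesis using c by (simp add: V.add_minus_cancel_right)
qed

lemma p_incl_span:
  assumes "finite T" "x \<in> F.incl_span T P" shows "p T x \<in> V.incl_span T P"
  using assms(2)
proof induction
  case zero then show ?case using p_zero assms V.incl_span.zero by simp
next
  case (add x U c)
  have fU: "finite U" using finite_subset[OF add.hyps(2) assms(1)] .
  have "p T (x \<oplus>\<^bsub>MF T\<^esub> aF U T (\<lambda>i. i) c) = p T x \<oplus>\<^bsub>MV T\<^esub> aV U T (\<lambda>i. i) (p U c)"
    using p_add[OF assms(1) F.incl_span_carrier[OF assms(1) add.hyps(1)] F.incl_closed[OF assms(1) add.hyps(2,4)]]
      p_incl[OF assms(1) add.hyps(2,4)] by simp
  then show ?case using V.incl_span.add[of _ T P, OF add.IH add.hyps(2,3)] p_closed[OF fU] add by simp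
qed

text \<open>Each summand is lifted on its own set \<open>U\<close>, where \<open>p U\<close> is
  onto, so that the supports are kept; an arbitrary lift on \<open>T\<close> could lose
  them.\<close>

lemma p_incl_span_lift:
  assumes "finite T" "x \<in> V.incl_span T P" shows "\<exists>z\<in>F.incl_span T P. p T z = x"
  using assms(2)
proof induction
  case zero then show ?case using p_zero assms F.incl_span.zero by blast
next
  case (add x U c)
  then obtain z where z: "z \<in> F.incl_span T P" "p T z = x" by blast
  have fU: "finite U" using finite_subset[OF add.hyps(2) assms(1)] .
  have "c \<in> p U ` carrier (MF U)" unfolding p_surj[OF fU] by (rule add.hyps(4))
  then obtain d where d: "d \<in> carrier (MF U)" "p U d = c" by (elim imageE) simp
  have "p T (z \<oplus>\<^bsub>MF T\<^esub> aF U T (\<lambda>i. i) d) = x \<oplus>\<^bsub>MV T\<^esub> aV U T (\<lambda>i. i) c"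
    using p_add[OF assms(1) F.incl_span_carrier[OF assms(1) z(1)] F.incl_closed[OF assms(1) add.hyps(2) d(1)]]
      p_incl[OF assms(1) add.hyps(2) d(1)] z(2) d(2) by simp
  then show ?case using F.incl_span.add[of _ T P, OF z(1) add.hyps(2,3) d(1)] by blast
qed

text \<open>\<open>W\<close> stands for an arbitrary submodule of the kernel that contains it in low
  degrees. The set \<open>C0\<close> has \<open>C\<close> points, which makes
  \<open>C0 \<union> A\<close> large enough for torsion freeness of the derivative at
  \<open>A\<close>; since \<open>A\<close> has at most \<open>N\<close> points, it is also small
  enough for \<open>W\<close> to contain the kernel there.\<close>

lemma kernel_generated:
  assumes gen: "F.generated_upto N" and tf: "\<forall>a\<le>N. V.deriv_torsion_free a C"
    and W: "\<And>T. finite T \<Longrightarrow> \<zero>\<^bsub>MF T\<^esub> \<in> W T"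
      "\<And>T x y. \<lbrakk>finite T; x \<in> W T; y \<in> W T\<rbrakk> \<Longrightarrow> x \<oplus>\<^bsub>MF T\<^esub> y \<in> W T"
      "\<And>S T x. \<lbrakk>finite T; S \<subseteq> T; x \<in> W S\<rbrakk> \<Longrightarrow> aF S T (\<lambda>i. i) x \<in> W T"
      "\<And>T x. \<lbrakk>finite T; card T \<le> N + C; x \<in> carrier (MF T); p T x = \<zero>\<^bsub>MV T\<^esub>\<rbrakk> \<Longrightarrow> x \<in> W T"
    and T: "finite T" and x: "x \<in> carrier (MF T)" "p T x = \<zero>\<^bsub>MV T\<^esub>"
  shows "x \<in> W T"
proof (cases "card T \<le> N + C")
  case True then show ?thesis using W(4) T x by blast
next
  case False
  then obtain C0 where C0: "C0 \<subseteq> T" "card C0 = C" by (meson add_leD2 linorder_linear obtain_subset_with_card_n)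
  have fC0: "finite C0" using finite_subset[OF C0(1) T] .
  interpret FT: abelian_group "MF T" by (rule F.abelian) fact
  interpret VT: abelian_group "MV T" by (rule V.abelian) fact
  \<comment> \<open>\<open>p T r\<close> and \<open>p T y\<close> cancel, so the image of
    \<open>y\<close> lies in E_A(T), and by torsion freeness the image of \<open>y0\<close> already
    lies in E_A(C0 + A). It has a lift \<open>z0\<close> supported on sets missing \<open>A\<close>;
    the difference \<open>y0 - z0\<close> is a kernel element of low degree, hence in
    \<open>W\<close>, and \<open>z0\<close> replaces \<open>y0\<close>.\<close>
  have step: "\<exists>x'. p T x' = \<zero>\<^bsub>MV T\<^esub> \<and> x' \<in> F.incl_span T (\<lambda>U. P U \<or> (U \<subseteq> C0 \<union> A \<and> \<not> A \<subseteq> U)) \<and> (x' \<in> W T \<longrightarrow> x \<in> W T)"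
    if A: "A \<subseteq> T - C0" "card A \<le> N" and x: "p T x = \<zero>\<^bsub>MV T\<^esub>" "x \<in> F.incl_span T (\<lambda>U. P U \<or> U - C0 = A)"
      and P: "\<And>U. P U \<Longrightarrow> \<not> A \<subseteq> U" for A P x
  proof -
    let ?Y = "C0 \<union> A"
    have fA: "finite A" "finite ?Y" using A(1) T fC0 by (auto dest: finite_subset)
    have Y: "?Y \<subseteq> T" using A C0 by auto
    have cY: "card ?Y = C + card A" using fA fC0 A C0 by (subst card_Un_disjoint) auto
    obtain r y where r: "r \<in> F.incl_span T P" and y: "y \<in> F.incl_span T (\<lambda>U. U - C0 = A)" and xy: "x = r \<oplus>\<^bsub>MF T\<^esub> y"
      using F.incl_span_split[OF T x(2), of P "\<lambda>U. U - C0 = A"] by blast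
    have rc: "r \<in> carrier (MF T)" "y \<in> carrier (MF T)" using F.incl_span_carrier[OF T r] F.incl_span_carrier[OF T y] .
    obtain y0 where y0: "y0 \<in> carrier (MF ?Y)" "y = aF ?Y T (\<lambda>i. i) y0"
      using F.incl_span_below[OF T Y y] by auto
    have "p T r \<oplus>\<^bsub>MV T\<^esub> p T y = \<zero>\<^bsub>MV T\<^esub>" using x(1) rc by (simp add: xy p_add T)
    then have "p T y = \<ominus>\<^bsub>MV T\<^esub> p T r"
      using p_closed[OF T] rc by (metis VT.a_comm VT.minus_equality)
    then have "p T y \<in> V.incl_span T P" using V.incl_span_neg[OF T p_incl_span[OF T r]] by simp
    then have "aV ?Y T (\<lambda>i. i) (p ?Y y0) \<in> V.incl_span T P" using p_incl[OF T Y y0(1)] y0(2) by simp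
    then have "aV ?Y T (\<lambda>i. i) (p ?Y y0) \<in> V.incl_span T (\<lambda>U. \<not> A \<subseteq> U)"
      by (rule V.incl_span_mono[OF T]) (use P in blast)
    then have "p ?Y y0 \<in> V.incl_span ?Y (\<lambda>U. \<not> A \<subseteq> U)"
      using tf A(2) T Y cY p_closed[OF fA(2) y0(1)] by (intro V.deriv_torsion_free_D[of A C T ?Y "\<lambda>i. i"]) auto
    then obtain z0 where z0: "z0 \<in> F.incl_span ?Y (\<lambda>U. \<not> A \<subseteq> U)" "p ?Y z0 = p ?Y y0"
      using p_incl_span_lift[OF fA(2)] by blast
    interpret FY: abelian_group "MF ?Y" by (rule F.abelian) fact
    interpret VY: abelian_group "MV ?Y" by (rule V.abelian) fact
    have z0c: "z0 \<in> carrier (MF ?Y)" using F.incl_span_carrier[OF fA(2) z0(1)] .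
    define k where "k = y0 \<ominus>\<^bsub>MF ?Y\<^esub> z0"
    have kc: "k \<in> carrier (MF ?Y)" unfolding k_def using y0 z0c by auto
    have pk: "p ?Y k = \<zero>\<^bsub>MV ?Y\<^esub>" unfolding k_def
      using p_minus[OF fA(2) y0(1) z0c] z0(2) VY.minus_self[OF p_closed[OF fA(2) y0(1)]] by simp
    have "k \<in> W ?Y" by (rule W(4)[OF fA(2) _ kc pk]) (use cY A in simp)
    then have kW: "aF ?Y T (\<lambda>i. i) k \<in> W T" by (rule W(3)[OF T Y])
    define iz where "iz = aF ?Y T (\<lambda>i. i) z0"
    have izc: "iz \<in> carrier (MF T)" unfolding iz_def by (rule F.incl_closed[OF T Y z0c])
    have ikc: "aF ?Y T (\<lambda>i. i) k \<in> carrier (MF T)" by (rule F.incl_closed[OF T Y kc])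
    have "aF ?Y T (\<lambda>i. i) k = y \<ominus>\<^bsub>MF T\<^esub> iz"
      unfolding k_def iz_def y0(2) by (rule F.incl_minus[OF T Y y0(1) z0c])
    then have yeq: "y = aF ?Y T (\<lambda>i. i) k \<oplus>\<^bsub>MF T\<^esub> iz"
      using rc izc by (simp add: FT.minus_add_cancel_right)
    define x' where "x' = r \<oplus>\<^bsub>MF T\<^esub> iz"
    have x'c: "x' \<in> carrier (MF T)" unfolding x'_def using rc izc by simp
    have xx': "x = x' \<oplus>\<^bsub>MF T\<^esub> aF ?Y T (\<lambda>i. i) k"
      unfolding xy yeq x'_def using rc izc ikc by (simp add: FT.a_ac)
    have "p T (aF ?Y T (\<lambda>i. i) k) = \<zero>\<^bsub>MV T\<^esub>"
      using p_incl[OF T Y kc] pk V.act_zero[OF T, of "\<lambda>i. i" ?Y] Y by simp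
    then have "p T x' = \<zero>\<^bsub>MV T\<^esub>"
      using x(1) p_add[OF T x'c ikc] p_closed[OF T x'c] by (simp add: xx')
    moreover have "x' \<in> F.incl_span T (\<lambda>U. P U \<or> (U \<subseteq> ?Y \<and> \<not> A \<subseteq> U))"
      unfolding x'_def
    proof (rule F.incl_span_add[OF T])
      show "r \<in> F.incl_span T (\<lambda>U. P U \<or> (U \<subseteq> ?Y \<and> \<not> A \<subseteq> U))"
        by (rule F.incl_span_mono[OF T r]) blast
      show "iz \<in> F.incl_span T (\<lambda>U. P U \<or> (U \<subseteq> ?Y \<and> \<not> A \<subseteq> U))"
        unfolding iz_def by (rule F.incl_span_incl[OF T Y z0(1)]) blast
    qed
    moreover have "x' \<in> W T \<longrightarrow> x \<in> W T" using W(2)[OF T _ kW] xx' by simp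
    ultimately show ?thesis by blast
  qed
  have "x \<in> W T" if "s \<le> N" "p T x = \<zero>\<^bsub>MV T\<^esub>" "x \<in> F.incl_span T (\<lambda>U. card (U - C0) \<le> s)" for s x
    using that
  proof (induction s arbitrary: x)
    case 0
    have "x \<in> F.incl_span T (\<lambda>U. False \<or> U - C0 = {})"
    proof (rule F.incl_span_mono[OF T 0(3)])
      fix U assume U: "U \<subseteq> T" "card (U - C0) \<le> 0"
      then show "\<exists>U'. U \<subseteq> U' \<and> U' \<subseteq> T \<and> (False \<or> U' - C0 = {})"
        using finite_subset[OF U(1) T] by (intro exI[of _ U]) auto
    qed
    then obtain x' where x': "x' \<in> F.incl_span T (\<lambda>U. False \<or> (U \<subseteq> C0 \<union> {} \<and> \<not> {} \<subseteq> U))" "x' \<in> W T \<longrightarrow> x \<in> W T"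
      using step[of "{}" x "\<lambda>U. False"] 0 by auto
    \<comment> \<open>With \<open>A\<close> empty, the remaining sets would have to miss the empty
      set.\<close>
    have "x' = \<zero>\<^bsub>MF T\<^esub>" by (rule F.incl_span_False[OF T x'(1)]) auto
    then show ?case using x' W(1)[OF T] by simp
  next
    case (Suc s)
    let ?s = "Suc s"
    \<comment> \<open>\<open>\<B>\<close> lists the traces of full size outside \<open>C0\<close>
      that are still present. A step only produces sets with a smaller trace, so the list shrinks to
      nothing and the bound drops to \<open>s\<close>.\<close>
    define R where "R \<B> U \<longleftrightarrow> card (U - C0) \<le> ?s \<and> (card (U - C0) = ?s \<longrightarrow> U - C0 \<in> \<B>)" for \<B> U
    have main: "\<lbrakk>finite \<B>; \<B> \<subseteq> {A. A \<subseteq> T - C0 \<and> card A = ?s}; p T x = \<zero>\<^bsub>MV T\<^esub>; x \<in> F.incl_span T (R \<B>)\<rbrakk> \<Longrightarrow> x \<in> W T" for \<B> x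
    proof (induction \<B> arbitrary: x rule: finite_induct)
      case empty
      have "x \<in> F.incl_span T (\<lambda>U. card (U - C0) \<le> s)"
        by (rule F.incl_span_mono[OF T empty(3)]) (auto simp: R_def)
      then show ?case using Suc.IH[OF _ empty(2)] Suc.prems by simp
    next
      case (insert A \<B>)
      let ?P = "\<lambda>U. R \<B> U \<and> \<not> A \<subseteq> U"
      have A: "A \<subseteq> T - C0" "card A = ?s" using insert by auto
      have fA: "finite A" using A by (auto intro: card_ge_0_finite)
      have "x \<in> F.incl_span T (\<lambda>U. ?P U \<or> U - C0 = A)"
      proof (rule F.incl_span_mono[OF T insert.prems(3)])
        fix U assume U: "U \<subseteq> T" "R (insert A \<B>) U"
        have fU: "finite U" using finite_subset[OF U(1) T] .
        have "?P U \<or> U - C0 = A"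
        proof (cases "U - C0 = A")
          case False
          then have "R \<B> U" using U by (auto simp: R_def)
          moreover have "\<not> A \<subseteq> U"
          proof
            assume "A \<subseteq> U"
            then have "A \<subseteq> U - C0" using A by auto
            moreover have "card (U - C0) \<le> card A" using U A by (simp add: R_def)
            ultimately have "A = U - C0" using fU by (intro card_seteq) auto
            then show False using False by simp
          qed
          ultimately show ?thesis by simp
        qed simp
        then show "\<exists>U'. U \<subseteq> U' \<and> U' \<subseteq> T \<and> (?P U' \<or> U' - C0 = A)" using U by blast
      qed
      then obtain x' where x': "p T x' = \<zero>\<^bsub>MV T\<^esub>" "x' \<in> F.incl_span T (\<lambda>U. ?P U \<or> (U \<subseteq> C0 \<union> A \<and> \<not> A \<subseteq> U))"
          "x' \<in> W T \<longrightarrow> x \<in> W T"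
        using step[OF A(1) _ insert.prems(2), of ?P] A Suc.prems by auto
      have "x' \<in> F.incl_span T (R \<B>)"
      proof (rule F.incl_span_mono[OF T x'(2)])
        fix U assume U: "U \<subseteq> T" "?P U \<or> (U \<subseteq> C0 \<union> A \<and> \<not> A \<subseteq> U)"
        have "R \<B> U" if "U \<subseteq> C0 \<union> A" "\<not> A \<subseteq> U"
        proof -
          have "U - C0 \<subset> A" using that by auto
          then have "card (U - C0) < card A" using fA by (simp add: psubset_card_mono)
          then show ?thesis using A by (auto simp: R_def)
        qed
        then show "\<exists>U'. U \<subseteq> U' \<and> U' \<subseteq> T \<and> R \<B> U'" using U by blast
      qed
      then have "x' \<in> W T" using insert x'(1) by auto
      then show ?case using x'(3) by simp
    qed
    show ?case
    proof (rule main[OF _ order_refl Suc.prems(2)])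
      show "finite {A. A \<subseteq> T - C0 \<and> card A = ?s}"
        by (rule finite_subset[of _ "Pow T"]) (use T in auto)
      show "x \<in> F.incl_span T (R {A. A \<subseteq> T - C0 \<and> card A = ?s})"
        by (rule F.incl_span_mono[OF T Suc.prems(3)]) (auto simp: R_def)
    qed
  qed
  moreover have "x \<in> F.incl_span T (\<lambda>U. card (U - C0) \<le> N)"
  proof (rule F.incl_span_mono[OF T])
    show "x \<in> F.incl_span T (\<lambda>U. card U \<le> N)" using gen T x unfolding F.generated_upto_def by blast
    fix U assume U: "U \<subseteq> T" "card U \<le> N"
    have "card (U - C0) \<le> card U" using finite_subset[OF U(1) T] by (intro card_mono) auto
    then show "\<exists>U'. U \<subseteq> U' \<and> U' \<subseteq> T \<and> card (U' - C0) \<le> N" using U by (intro exI[of _ U]) auto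
  qed
  ultimately show ?thesis using x by blast
qed

end

text \<open>Adding points singly, suppose \<open>x\<close> on \<open>S\<close> becomes an element
  \<open>X\<close> of \<open>K\<close> once \<open>star\<close> is added. As \<open>X\<close> does
  not involve \<open>star\<close>, moving \<open>star\<close> to a new point changes nothing.
  \<open>fixed_mod_imp\<close> for the functor \<open>K\<close> and \<open>B = {}\<close> then
  writes \<open>X\<close> as the image of some \<open>k \<in> K S\<close>, and injectivity of the
  inclusion gives \<open>x = k\<close>.\<close>

lemma (in fi_functor) saturated_of_generated:
  assumes K: "fi_functor (\<lambda>T. (M T)\<lparr>carrier := K T\<rparr>) act" and KM: "\<And>T. K T \<subseteq> carrier (M T)"
    and gen: "fi_functor.generated_upto (\<lambda>T. (M T)\<lparr>carrier := K T\<rparr>) act N"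
    and inj: "\<And>S T f x. \<lbrakk>finite T; inj_on f S; f ` S \<subseteq> T; x \<in> carrier (M S); act S T f x = \<zero>\<^bsub>M T\<^esub>\<rbrakk> \<Longrightarrow> x = \<zero>\<^bsub>M S\<^esub>"
    and "finite T" "S \<subseteq> T" "N * N + N + 2 \<le> card S" "x \<in> carrier (M S)" "incl S T x \<in> K T"
  shows "x \<in> K S"
proof -
  interpret K: fi_functor "\<lambda>T. (M T)\<lparr>carrier := K T\<rparr>" act by (rule K)
  have tf0: "K.deriv_torsion_free 0 0"
  proof (rule K.deriv_torsion_free_0I)
    fix S T f x
    assume "finite T" "inj_on f S" "f ` S \<subseteq> T" "x \<in> carrier ((M S)\<lparr>carrier := K S\<rparr>)"
      "act S T f x = \<zero>\<^bsub>(M T)\<lparr>carrier := K T\<rparr>\<^esub>"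
    then show "x = \<zero>\<^bsub>(M S)\<lparr>carrier := K S\<rparr>\<^esub>"
      using inj[of T f S x] KM[of S] by auto
  qed
  have one: "x \<in> K S" if S: "finite S" "star \<notin> S" "N * N + N + 2 \<le> card S" "x \<in> carrier (M S)"
    "incl S (insert star S) x \<in> K (insert star S)" for S star x
  proof -
    let ?T = "insert star S"
    have fT: "finite ?T" using S by simp
    interpret MT: abelian_group "M ?T" by (rule abelian) fact
    interpret MS: abelian_group "M S" by (rule abelian) (rule S)
    define l where "l = Suc (Max ?T)"
    have "i \<le> Max ?T" if "i \<in> ?T" for i using fT that by simp
    then have l: "l \<notin> ?T" unfolding l_def by (meson not_less_eq_eq order_refl)
    let ?T' = "insert l ?T"
    interpret KT': abelian_group "(M ?T')\<lparr>carrier := K ?T'\<rparr>" by (rule K.abelian) (use fT in auto)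
    define X where "X = incl S ?T x"
    have XK: "X \<in> K ?T" using S by (simp add: X_def)
    have e1: "incl ?T ?T' X = incl S ?T' x"
      unfolding X_def using S by (subst act_act) auto
    have e2: "act ?T ?T' ((\<lambda>i. i)(star := l)) X = incl S ?T' x"
    proof -
      have "act ?T ?T' ((\<lambda>i. i)(star := l)) X = act S ?T' (\<lambda>i. ((\<lambda>i. i)(star := l)) i) x"
        unfolding X_def
        by (rule act_act[OF _ _ _ inj_on_upd[OF l] upd_image S(4)]) (use S in auto)
      also have "act S ?T' (\<lambda>i. ((\<lambda>i. i)(star := l)) i) = incl S ?T'"
        by (rule act_cong) (use S in auto)
      finally show ?thesis .
    qed
    have "incl ?T ?T' X \<in> K ?T'"
      using K.incl_closed[of ?T' ?T X] XK fT by auto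
    then have "K.move_diff ?T star l X = \<zero>\<^bsub>(M ?T')\<lparr>carrier := K ?T'\<rparr>\<^esub>"
      unfolding K.move_diff_def e2 e1[symmetric] by (intro KT'.minus_self) simp
    then have "K.move_diff ?T star l X \<in> K.incl_span ?T' (\<lambda>U. \<not> {} \<subseteq> U)"
      using K.incl_span.zero[of ?T' "\<lambda>U. \<not> {} \<subseteq> U"] by (simp only:)
    then have "X \<in> K.incl_span ?T (\<lambda>U. \<not> insert star {} \<subseteq> U)"
      by (rule K.fixed_mod_imp[OF gen _ fT _ _ l, where C = 0, rotated -1]) (use tf0 S XK in auto)
    \<comment> \<open>Subsets of \<open>insert star S\<close> that miss \<open>star\<close> lie in
      \<open>S\<close>.\<close>
    from K.incl_span_below[OF fT subset_insertI this] S(2)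
    obtain k where k: "k \<in> K S" "X = incl S ?T k" by auto
    have kc: "k \<in> carrier (M S)" using k KM by blast
    have Xc: "incl S ?T k \<in> carrier (M ?T)" by (rule incl_closed[OF fT _ kc]) auto
    have "incl S ?T (x \<ominus>\<^bsub>M S\<^esub> k) = X \<ominus>\<^bsub>M ?T\<^esub> X"
      using incl_minus[OF fT subset_insertI S(4) kc] k(2) X_def by simp
    also have "\<dots> = \<zero>\<^bsub>M ?T\<^esub>" using Xc k(2) MT.minus_self by simp
    finally have "x \<ominus>\<^bsub>M S\<^esub> k = \<zero>\<^bsub>M S\<^esub>"
      by (intro inj[OF fT, of "\<lambda>i. i" S, OF _ _ MS.minus_closed[OF S(4) kc]]) auto
    then have "x = k" using S kc by (metis MS.minus_add_cancel_right MS.l_zero)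
    then show ?thesis using k by simp
  qed
  have "x \<in> K S" if "finite E" "finite S" "N * N + N + 2 \<le> card S" "E \<inter> S = {}" "x \<in> carrier (M S)"
      "incl S (S \<union> E) x \<in> K (S \<union> E)" for E
    using that
  proof (induction E rule: finite_induct)
    case empty then show ?case using act_id by simp
  next
    case (insert l E)
    have "incl S (S \<union> insert l E) x = incl (S \<union> E) (insert l (S \<union> E)) (incl S (S \<union> E) x)"
      using insert.prems insert.hyps by (subst act_act) auto
    then have "incl (S \<union> E) (insert l (S \<union> E)) (incl S (S \<union> E) x) \<in> K (insert l (S \<union> E))"
      using insert.prems by simp
    moreover have "card S \<le> card (S \<union> E)" using insert by (intro card_mono) auto
    moreover have "incl S (S \<union> E) x \<in> carrier (M (S \<union> E))"
      using insert by (intro incl_closed) auto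
    ultimately have "incl S (S \<union> E) x \<in> K (S \<union> E)"
      by (intro one[of "S \<union> E" l]) (use insert in auto)
    then show ?case using insert by auto
  qed
  from this[of "T - S"] show ?thesis using assms finite_subset[OF assms(6,5)]
    by (simp add: Un_absorb1 Int_commute)
qed

section \<open>From FI_G-modules to FI-functors\<close>

text \<open>One bijection is fixed per set. Which one is irrelevant: two of them differ by a
  permutation, and in a composite the enumerations of the middle set cancel.\<close>

definition enum :: "nat set \<Rightarrow> nat \<Rightarrow> nat" where
  "enum T = (SOME e. bij_betw e {1..card T} T)"

lemma enum_bij: "finite T \<Longrightarrow> bij_betw (enum T) {1..card T} T"
  unfolding enum_def
  by (rule someI_ex[where P = "\<lambda>e. bij_betw e {1..card T} T"]) (rule ex_bij_betw_nat_finite_1)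

definition enum_inv :: "nat set \<Rightarrow> nat \<Rightarrow> nat" where
  "enum_inv T = inv_into {1..card T} (enum T)"

lemma enum_in: "finite T \<Longrightarrow> i \<in> {1..card T} \<Longrightarrow> enum T i \<in> T"
  using bij_betwE[OF enum_bij] by simp

lemma enum_inv_in: "finite T \<Longrightarrow> t \<in> T \<Longrightarrow> enum_inv T t \<in> {1..card T}"
  unfolding enum_inv_def using bij_betw_imp_surj_on[OF enum_bij] by (intro inv_into_into) simp

lemma enum_inv_enum: "finite T \<Longrightarrow> i \<in> {1..card T} \<Longrightarrow> enum_inv T (enum T i) = i"
  unfolding enum_inv_def by (rule bij_betw_inv_into_left[OF enum_bij])

lemma enum_enum_inv: "finite T \<Longrightarrow> t \<in> T \<Longrightarrow> enum T (enum_inv T t) = t"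
  unfolding enum_inv_def by (rule bij_betw_inv_into_right[OF enum_bij])

text \<open>The map \<open>f\<close> read through the enumerations, with trivial labels. General
  labels are recovered through automorphisms in \<open>fig_hom_factor\<close>.\<close>

definition fig_unlabelled :: "('g,'b) monoid_scheme \<Rightarrow> nat set \<Rightarrow> nat set \<Rightarrow> (nat \<Rightarrow> nat) \<Rightarrow> 'g fimor" where
  "fig_unlabelled G S T f = (\<lambda>i\<in>{1..card S}. enum_inv T (f (enum S i)), \<lambda>i\<in>{1..card S}. \<one>\<^bsub>G\<^esub>)"

definition fig_at :: "('g,'k,'v) fig_module \<Rightarrow> nat set \<Rightarrow> ('k,'v) module" where
  "fig_at V T = fi_space V (card T)"

definition fig_act :: "('g,'b) monoid_scheme \<Rightarrow> ('g,'k,'v) fig_module \<Rightarrow> nat set \<Rightarrow> nat set \<Rightarrow> (nat \<Rightarrow> nat) \<Rightarrow> 'v \<Rightarrow> 'v" where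
  "fig_act G V S T f = fi_map V (card S) (card T) (fig_unlabelled G S T f)"

lemma restrict_pair_eqI:
  "\<lbrakk>\<And>i. i \<in> A \<Longrightarrow> f i = f' i; \<And>i. i \<in> A \<Longrightarrow> g i = g' i\<rbrakk> \<Longrightarrow>
   (restrict f A, restrict g A) = (restrict f' A, restrict g' A)"
  by (auto intro: restrict_ext)

lemma fig_comp_pair: "fig_comp G r (f, g) (h, g') =
    (\<lambda>x\<in>{1..r}. f (h x), \<lambda>x\<in>{1..r}. g' x \<otimes>\<^bsub>G\<^esub> g (h x))"
  by (simp add: fig_comp_def)

lemma fig_unlabelled_hom:
  assumes "group G" "finite T" "inj_on f S" "f ` S \<subseteq> T"
  shows "fig_unlabelled G S T f \<in> fig_hom G (card S) (card T)"
proof -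
  interpret group G by fact
  have fS: "finite S" using assms(2-4) by (meson finite_imageD finite_subset)
  have "inj_on (\<lambda>i\<in>{1..card S}. enum_inv T (f (enum S i))) {1..card S}"
  proof (rule inj_onI)
    fix i j assume ij: "i \<in> {1..card S}" "j \<in> {1..card S}"
      "(\<lambda>i\<in>{1..card S}. enum_inv T (f (enum S i))) i = (\<lambda>i\<in>{1..card S}. enum_inv T (f (enum S i))) j"
    have s: "enum S i \<in> S" "enum S j \<in> S" using ij enum_in[OF fS] by auto
    have "f (enum S i) \<in> T" "f (enum S j) \<in> T" using s assms(4) by auto
    then have "f (enum S i) = f (enum S j)" using ij enum_enum_inv[OF assms(2)] by (metis restrict_apply')
    then have "enum S i = enum S j" using s assms(3) by (meson inj_onD)
    then show "i = j" using ij enum_inv_enum[OF fS] by metis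
  qed
  moreover have "(\<lambda>i\<in>{1..card S}. enum_inv T (f (enum S i))) \<in> {1..card S} \<rightarrow>\<^sub>E {1..card T}"
    using enum_in[OF fS] enum_inv_in[OF assms(2)] assms(4) by (fastforce simp: PiE_iff)
  ultimately show ?thesis unfolding fig_hom_def fig_unlabelled_def by auto
qed

lemma fig_unlabelled_comp:
  assumes "group G" "finite S" "finite T" "f ` S \<subseteq> T"
  shows "fig_comp G (card S) (fig_unlabelled G T U g) (fig_unlabelled G S T f) = fig_unlabelled G S U (\<lambda>i. g (f i))"
proof -
  interpret group G by fact
  have 1: "enum_inv T (f (enum S i)) \<in> {1..card T}" "enum T (enum_inv T (f (enum S i))) = f (enum S i)" if "i \<in> {1..card S}" for i
  proof -
    have "f (enum S i) \<in> T" using enum_in[OF assms(2) that] assms(4) by auto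
    then show "enum_inv T (f (enum S i)) \<in> {1..card T}" "enum T (enum_inv T (f (enum S i))) = f (enum S i)"
      using enum_inv_in[OF assms(3)] enum_enum_inv[OF assms(3)] by auto
  qed
  show ?thesis unfolding fig_comp_pair fig_unlabelled_def
    by (rule restrict_pair_eqI) (simp_all add: 1 del: atLeastAtMost_iff One_nat_def)
qed

lemma fig_unlabelled_id: "finite T \<Longrightarrow> fig_unlabelled G T T (\<lambda>i. i) = fig_id G (card T)"
  unfolding fig_unlabelled_def fig_id_def
  by (rule restrict_pair_eqI) (simp_all add: enum_inv_enum del: atLeastAtMost_iff One_nat_def)

lemma fig_unlabelled_cong:
  assumes "\<And>i. i \<in> S \<Longrightarrow> f i = g i"
  shows "fig_unlabelled G S T f = fig_unlabelled G S T g"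
proof (cases "finite S")
  case True
  then show ?thesis unfolding fig_unlabelled_def
    by (intro restrict_pair_eqI) (simp_all add: assms enum_in del: atLeastAtMost_iff One_nat_def)
next
  case False
  \<comment> \<open>An infinite set has \<open>card\<close> 0, so both sides are the morphism out of
    the empty set.\<close>
  then show ?thesis unfolding fig_unlabelled_def by (intro restrict_pair_eqI) simp_all
qed

lemma fig_moduleD:
  assumes "is_fig_module G R V"
  shows "Module.module R (fi_space V n)" "abelian_group (fi_space V n)"
    "\<lbrakk>\<phi> \<in> fig_hom G n m; x \<in> carrier (fi_space V n)\<rbrakk> \<Longrightarrow> fi_map V n m \<phi> x \<in> carrier (fi_space V m)"
    "\<lbrakk>\<phi> \<in> fig_hom G n m; x \<in> carrier (fi_space V n); y \<in> carrier (fi_space V n)\<rbrakk> \<Longrightarrow>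
      fi_map V n m \<phi> (x \<oplus>\<^bsub>fi_space V n\<^esub> y) = fi_map V n m \<phi> x \<oplus>\<^bsub>fi_space V m\<^esub> fi_map V n m \<phi> y"
    "\<lbrakk>\<phi> \<in> fig_hom G n m; x \<in> carrier (fi_space V n); a \<in> carrier R\<rbrakk> \<Longrightarrow>
      fi_map V n m \<phi> (a \<odot>\<^bsub>fi_space V n\<^esub> x) = a \<odot>\<^bsub>fi_space V m\<^esub> fi_map V n m \<phi> x"
    "x \<in> carrier (fi_space V n) \<Longrightarrow> fi_map V n n (fig_id G n) x = x"
    "\<lbrakk>\<phi> \<in> fig_hom G n m; \<psi> \<in> fig_hom G r n; x \<in> carrier (fi_space V r)\<rbrakk> \<Longrightarrow>
      fi_map V n m \<phi> (fi_map V r n \<psi> x) = fi_map V r m (fig_comp G r \<phi> \<psi>) x"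
proof -
  show "Module.module R (fi_space V n)" using assms by (simp add: is_fig_module_def)
  then show "abelian_group (fi_space V n)" by (rule Module.module.axioms(2))
  have k: "klinear R (fi_space V n) (fi_space V m) (fi_map V n m \<phi>)" if "\<phi> \<in> fig_hom G n m"
    using assms that unfolding is_fig_module_def by blast
  show "fi_map V n m \<phi> x \<in> carrier (fi_space V m)"
    if "\<phi> \<in> fig_hom G n m" "x \<in> carrier (fi_space V n)"
    using k[OF that(1)] that(2) unfolding klinear_def by blast
  show "fi_map V n m \<phi> (x \<oplus>\<^bsub>fi_space V n\<^esub> y) = fi_map V n m \<phi> x \<oplus>\<^bsub>fi_space V m\<^esub> fi_map V n m \<phi> y"
    if "\<phi> \<in> fig_hom G n m" "x \<in> carrier (fi_space V n)" "y \<in> carrier (fi_space V n)"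
    using k[OF that(1)] that(2,3) unfolding klinear_def by blast
  show "fi_map V n m \<phi> (a \<odot>\<^bsub>fi_space V n\<^esub> x) = a \<odot>\<^bsub>fi_space V m\<^esub> fi_map V n m \<phi> x"
    if "\<phi> \<in> fig_hom G n m" "x \<in> carrier (fi_space V n)" "a \<in> carrier R"
    using k[OF that(1)] that(2,3) unfolding klinear_def by blast
  show "fi_map V n n (fig_id G n) x = x" if "x \<in> carrier (fi_space V n)"
    using assms that unfolding is_fig_module_def by blast
  show "fi_map V n m \<phi> (fi_map V r n \<psi> x) = fi_map V r m (fig_comp G r \<phi> \<psi>) x"
    if "\<phi> \<in> fig_hom G n m" "\<psi> \<in> fig_hom G r n" "x \<in> carrier (fi_space V r)"
    using assms that unfolding is_fig_module_def by metis
qed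

lemma fi_map_zero:
  assumes V: "is_fig_module G R V" and \<phi>: "\<phi> \<in> fig_hom G n m"
  shows "fi_map V n m \<phi> \<zero>\<^bsub>fi_space V n\<^esub> = \<zero>\<^bsub>fi_space V m\<^esub>"
proof -
  note V' = fig_moduleD[OF V]
  interpret n: abelian_group "fi_space V n" by (rule V')
  interpret m: abelian_group "fi_space V m" by (rule V')
  have z: "fi_map V n m \<phi> \<zero>\<^bsub>fi_space V n\<^esub> \<in> carrier (fi_space V m)" by (rule V'(3)[OF \<phi>]) simp
  have "fi_map V n m \<phi> \<zero>\<^bsub>fi_space V n\<^esub> \<oplus>\<^bsub>fi_space V m\<^esub> fi_map V n m \<phi> \<zero>\<^bsub>fi_space V n\<^esub> = fi_map V n m \<phi> \<zero>\<^bsub>fi_space V n\<^esub>"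
    using V'(4)[OF \<phi>, of "\<zero>\<^bsub>fi_space V n\<^esub>" "\<zero>\<^bsub>fi_space V n\<^esub>"] by simp
  then show ?thesis using z m.add.l_cancel_one by simp
qed

lemma fi_functor_fig:
  assumes G: "group G" and V: "is_fig_module G R V"
  shows "fi_functor (fig_at V) (fig_act G V)"
proof (rule fi_functor.intro)
  note V' = fig_moduleD[OF V]
  show "abelian_group (fig_at V T)" for T unfolding fig_at_def by (rule V')
  show "fig_act G V S T f = fig_act G V S T g" if "\<And>i. i \<in> S \<Longrightarrow> f i = g i" for S T f g
    unfolding fig_act_def by (simp only: fig_unlabelled_cong[of S f g, OF that])
  show "fig_act G V T T (\<lambda>i. i) x = x" if "finite T" "x \<in> carrier (fig_at V T)" for T x
    using that V' by (simp add: fig_act_def fig_at_def fig_unlabelled_id)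
  show "fig_act G V S T f x \<in> carrier (fig_at V T)"
    if T: "finite T" "inj_on f S" "f ` S \<subseteq> T" "x \<in> carrier (fig_at V S)" for T f S x
    using T(4) fig_unlabelled_hom[OF G T(1-3)] V'(3) by (simp add: fig_act_def fig_at_def)
  show "fig_act G V S T f (x \<oplus>\<^bsub>fig_at V S\<^esub> y) = fig_act G V S T f x \<oplus>\<^bsub>fig_at V T\<^esub> fig_act G V S T f y"
    if T: "finite T" "inj_on f S" "f ` S \<subseteq> T" "x \<in> carrier (fig_at V S)" "y \<in> carrier (fig_at V S)" for T f S x y
    using T(4,5) fig_unlabelled_hom[OF G T(1-3)] V'(4) by (simp add: fig_act_def fig_at_def)
  fix U T S :: "nat set" and f g x
  assume T: "finite U" "inj_on f S" "f ` S \<subseteq> T" "inj_on g T" "g ` T \<subseteq> U" "x \<in> carrier (fig_at V S)"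
  have fT: "finite T" using T(1,4,5) by (meson finite_imageD finite_subset)
  have fS: "finite S" using T(2,3) fT by (meson finite_imageD finite_subset)
  show "fig_act G V T U g (fig_act G V S T f x) = fig_act G V S U (\<lambda>i. g (f i)) x"
    using V'(7)[OF fig_unlabelled_hom[OF G T(1,4,5)] fig_unlabelled_hom[OF G fT T(2,3)]] T(6) fig_unlabelled_comp[OF G fS fT T(3)]
    by (simp add: fig_act_def fig_at_def)
qed

section \<open>Morphisms of FI_G: composition, inverses and factorisation\<close>

lemma fig_homI:
  assumes "\<And>i. i \<in> {1..n} \<Longrightarrow> f i \<in> {1..m}" "inj_on f {1..n}" "\<And>i. i \<in> {1..n} \<Longrightarrow> g i \<in> carrier G"
  shows "(restrict f {1..n}, restrict g {1..n}) \<in> fig_hom G n m"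
proof -
  have "restrict f {1..n} \<in> {1..n} \<rightarrow>\<^sub>E {1..m}" "restrict g {1..n} \<in> {1..n} \<rightarrow>\<^sub>E carrier G"
    using assms(1,3) by (auto intro!: restrict_PiE_iff[THEN iffD2] simp del: atLeastAtMost_iff)
  moreover have "inj_on (restrict f {1..n}) {1..n}" using assms(2) by simp
  ultimately show ?thesis by (simp add: fig_hom_def del: One_nat_def)
qed

lemma fig_homD:
  assumes "(f, g) \<in> fig_hom G n m"
  shows "\<And>i. i \<in> {1..n} \<Longrightarrow> f i \<in> {1..m}" "inj_on f {1..n}" "\<And>i. i \<in> {1..n} \<Longrightarrow> g i \<in> carrier G"
    "restrict f {1..n} = f" "restrict g {1..n} = g"
proof -
  have f: "f \<in> {1..n} \<rightarrow>\<^sub>E {1..m}" and i: "inj_on f {1..n}" and g: "g \<in> {1..n} \<rightarrow>\<^sub>E carrier G"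
    using assms by (simp_all add: fig_hom_def del: One_nat_def)
  show "f i \<in> {1..m}" "g i \<in> carrier G" if "i \<in> {1..n}" for i
    by (rule PiE_mem[OF f that], rule PiE_mem[OF g that])
  show "inj_on f {1..n}" by (rule i)
  show "restrict f {1..n} = f" using f by (rule PiE_restrict)
  show "restrict g {1..n} = g" using g by (rule PiE_restrict)
qed

lemma fig_hom_comp:
  assumes "group G" "\<phi> \<in> fig_hom G n m" "\<psi> \<in> fig_hom G r n"
  shows "fig_comp G r \<phi> \<psi> \<in> fig_hom G r m"
proof -
  interpret group G by fact
  obtain f g where e1: "\<phi> = (f, g)" by (cases \<phi>)
  obtain h g' where e2: "\<psi> = (h, g')" by (cases \<psi>)
  note e = e1 e2
  note f = fig_homD[OF assms(2)[unfolded e]] and h = fig_homD[OF assms(3)[unfolded e]]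
  have "inj_on (\<lambda>i. f (h i)) {1..r}"
    by (rule inj_onI) (meson f(2) h(1,2) inj_onD)
  then show ?thesis unfolding e fig_comp_pair using f h
    by (intro fig_homI) (simp_all del: atLeastAtMost_iff One_nat_def)
qed

lemma fig_id_hom: assumes "group G" shows "fig_id G n \<in> fig_hom G n n"
proof -
  interpret group G by fact
  show ?thesis unfolding fig_id_def by (rule fig_homI) simp_all
qed

text \<open>An injection of \<open>{1..n}\<close> into itself is onto. Composition multiplies labels
  along the map, so the inverse carries at \<open>i\<close> the inverse of the label at the preimage
  of \<open>i\<close>.\<close>

lemma fig_hom_inverse:
  assumes "group G" "\<phi> \<in> fig_hom G n n"
  shows "\<exists>\<psi>\<in>fig_hom G n n. fig_comp G n \<psi> \<phi> = fig_id G n \<and> fig_comp G n \<phi> \<psi> = fig_id G n"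
proof -
  interpret group G by fact
  obtain f g where e: "\<phi> = (f, g)" by (cases \<phi>)
  note f = fig_homD[OF assms(2)[unfolded e]]
  have fi: "f ` {1..n} = {1..n}" using f(1,2) by (intro endo_inj_surj) blast+
  let ?h = "inv_into {1..n} f"
  have h: "?h i \<in> {1..n}" "f (?h i) = i" if "i \<in> {1..n}" for i
    using that fi by (metis inv_into_into, metis f_inv_into_f)
  have h': "?h (f i) = i" if "i \<in> {1..n}" for i by (rule inv_into_f_f[OF f(2) that])
  note fc = f(1,3)
  let ?psi = "(\<lambda>i\<in>{1..n}. ?h i, \<lambda>i\<in>{1..n}. inv\<^bsub>G\<^esub> g (?h i))"
  have "inj_on ?h {1..n}" by (rule inj_onI) (metis h(2))
  then have "?psi \<in> fig_hom G n n"
    by (intro fig_homI) (simp_all add: h fc del: atLeastAtMost_iff One_nat_def)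
  moreover have "fig_comp G n ?psi \<phi> = fig_id G n"
    unfolding e fig_comp_pair fig_id_def
    by (rule restrict_pair_eqI) (simp_all add: h' fc del: atLeastAtMost_iff One_nat_def)
  moreover have "fig_comp G n \<phi> ?psi = fig_id G n"
    unfolding e fig_comp_pair fig_id_def
    by (rule restrict_pair_eqI) (simp_all add: h fc del: atLeastAtMost_iff One_nat_def)
  ultimately show ?thesis by blast
qed

text \<open>An automorphism of the source absorbs the labels and the order in which the image is
  listed; what remains is the unlabelled inclusion of the image, transported to \<open>T\<close>.
  This is why labels may be forgotten in questions about generation and torsion.\<close>

lemma fig_hom_factor:
  assumes G: "group G" and \<phi>: "\<phi> \<in> fig_hom G j m" and T: "finite T" "card T = m"
  shows "\<exists>U \<phi>'. U \<subseteq> T \<and> card U = j \<and> \<phi>' \<in> fig_hom G j j \<and> \<phi> = fig_comp G j (fig_unlabelled G U T (\<lambda>i. i)) \<phi>'"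
proof -
  interpret group G by fact
  obtain f g where e: "\<phi> = (f, g)" by (cases \<phi>)
  note f = fig_homD[OF \<phi>[unfolded e]]
  note fc = f(1,3)
  have injT: "inj_on (enum T) {1..m}" using enum_bij[OF T(1)] T(2) bij_betw_def by blast
  define U where "U = enum T ` f ` {1..j}"
  have UT: "U \<subseteq> T" unfolding U_def using enum_in[OF T(1)] fc T(2) by blast
  have fU: "finite U" unfolding U_def by simp
  have injc: "inj_on (\<lambda>i. enum T (f i)) {1..j}"
    by (rule inj_onI) (metis fc(1) f(2) inj_onD injT)
  have cU: "card U = j" unfolding U_def using card_image[OF injc] by (simp add: image_image)
  have inU: "enum T (f i) \<in> U" if "i \<in> {1..j}" for i using that by (auto simp: U_def)
  define \<sigma> where "\<sigma> i = enum_inv U (enum T (f i))" for i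
  have \<sigma>: "\<sigma> i \<in> {1..j}" "enum U (\<sigma> i) = enum T (f i)" if "i \<in> {1..j}" for i
    unfolding \<sigma>_def using enum_inv_in[OF fU inU[OF that]] enum_enum_inv[OF fU inU[OF that]] cU by auto
  have "inj_on \<sigma> {1..j}"
    by (rule inj_onI) (metis \<sigma>(2) injc inj_onD)
  then have "(restrict \<sigma> {1..j}, restrict g {1..j}) \<in> fig_hom G j j"
    using \<sigma>(1) fc(2) by (intro fig_homI)
  then have "(\<lambda>i\<in>{1..j}. \<sigma> i, g) \<in> fig_hom G j j" using f(5) by simp
  moreover have "\<phi> = fig_comp G j (fig_unlabelled G U T (\<lambda>i. i)) (\<lambda>i\<in>{1..j}. \<sigma> i, g)"
  proof -
    have "enum_inv T (enum U (\<sigma> i)) = f i" if "i \<in> {1..j}" for i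
      using \<sigma>(2)[OF that] enum_inv_enum[OF T(1)] fc(1)[OF that] T(2) by simp
    then have "fig_comp G j (fig_unlabelled G U T (\<lambda>i. i)) (\<lambda>i\<in>{1..j}. \<sigma> i, g) = (\<lambda>i\<in>{1..j}. f i, \<lambda>i\<in>{1..j}. g i)"
      unfolding fig_comp_pair fig_unlabelled_def cU
      by (intro restrict_pair_eqI) (simp_all add: \<sigma>(1) fc del: atLeastAtMost_iff One_nat_def)
    then show ?thesis using e f(4,5) by simp
  qed
  ultimately show ?thesis using UT cU by blast
qed

lemma fi_map_factor:
  assumes G: "group G" and V: "is_fig_module G R V" and \<phi>: "\<phi> \<in> fig_hom G j m"
    and T: "finite T" "card T = m" and x: "x \<in> carrier (fi_space V j)"
  shows "\<exists>U \<phi>'. U \<subseteq> T \<and> card U = j \<and> \<phi>' \<in> fig_hom G j j \<and>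
    fi_map V j m \<phi> x = fig_act G V U T (\<lambda>i. i) (fi_map V j j \<phi>' x)"
proof -
  obtain U \<phi>' where U: "U \<subseteq> T" "card U = j" "\<phi>' \<in> fig_hom G j j"
    and eq: "\<phi> = fig_comp G j (fig_unlabelled G U T (\<lambda>i. i)) \<phi>'"
    using fig_hom_factor[OF G \<phi> T] by (elim exE conjE) (rule that)
  have "fig_unlabelled G U T (\<lambda>i. i) \<in> fig_hom G j m"
    using fig_unlabelled_hom[OF G T(1), of "\<lambda>i. i" U] U T by simp
  then have "fi_map V j m \<phi> x = fi_map V j m (fig_unlabelled G U T (\<lambda>i. i)) (fi_map V j j \<phi>' x)"
    using fig_moduleD(7)[OF V _ U(3) x] eq by simp
  then have "fi_map V j m \<phi> x = fig_act G V U T (\<lambda>i. i) (fi_map V j j \<phi>' x)"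
    using U(2) T(2) by (simp add: fig_act_def)
  then show ?thesis using U by blast
qed

section \<open>Generation in a fixed degree, with and without labels\<close>

definition gen_degree :: "('g,'b) monoid_scheme \<Rightarrow> ('k,'a) ring_scheme \<Rightarrow> ('g,'k,'v) fig_module \<Rightarrow> nat \<Rightarrow> bool" where
  "gen_degree G R V N \<longleftrightarrow> (\<forall>W. fig_submodule G R V W \<and> (\<forall>n\<le>N. carrier (fi_space V n) \<subseteq> W n)
       \<longrightarrow> (\<forall>n. W n = carrier (fi_space V n)))"

lemma gen_fin_degree_iff: "gen_fin_degree G R V \<longleftrightarrow> (\<exists>N. gen_degree G R V N)"
  by (simp add: gen_fin_degree_def gen_degree_def)

lemma submodule_of_closed:
  assumes "Module.module R M" "H \<subseteq> carrier M" "\<zero>\<^bsub>M\<^esub> \<in> H"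
    "\<And>x y. \<lbrakk>x \<in> H; y \<in> H\<rbrakk> \<Longrightarrow> x \<oplus>\<^bsub>M\<^esub> y \<in> H" "\<And>a x. \<lbrakk>a \<in> carrier R; x \<in> H\<rbrakk> \<Longrightarrow> a \<odot>\<^bsub>M\<^esub> x \<in> H"
  shows "submodule H R M"
proof -
  interpret Module.module R M by fact
  have neg: "\<ominus>\<^bsub>M\<^esub> x \<in> H" if "x \<in> H" for x
  proof -
    have "\<ominus>\<^bsub>M\<^esub> x = (\<ominus>\<^bsub>R\<^esub> \<one>\<^bsub>R\<^esub>) \<odot>\<^bsub>M\<^esub> x" using that assms(2) by (simp add: subset_iff smult_l_minus)
    then show ?thesis using assms(5)[of "\<ominus>\<^bsub>R\<^esub> \<one>\<^bsub>R\<^esub>" x] that by simp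
  qed
  show ?thesis
    by (rule submoduleI) (use assms neg in auto)
qed

lemma submoduleD:
  assumes "submodule H R M"
  shows "H \<subseteq> carrier M" "\<zero>\<^bsub>M\<^esub> \<in> H" "\<And>x y. \<lbrakk>x \<in> H; y \<in> H\<rbrakk> \<Longrightarrow> x \<oplus>\<^bsub>M\<^esub> y \<in> H"
    "\<And>a x. \<lbrakk>a \<in> carrier R; x \<in> H\<rbrakk> \<Longrightarrow> a \<odot>\<^bsub>M\<^esub> x \<in> H"
proof -
  interpret s: submodule H R M by fact
  show "H \<subseteq> carrier M" "\<zero>\<^bsub>M\<^esub> \<in> H" "\<And>x y. \<lbrakk>x \<in> H; y \<in> H\<rbrakk> \<Longrightarrow> x \<oplus>\<^bsub>M\<^esub> y \<in> H"
    using s.subset s.one_closed s.m_closed by auto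
  show "\<And>a x. \<lbrakk>a \<in> carrier R; x \<in> H\<rbrakk> \<Longrightarrow> a \<odot>\<^bsub>M\<^esub> x \<in> H"
    using s.smult_closed by auto
qed

text \<open>The elements reached by inclusions from sets of size at most \<open>N\<close> form a
  submodule: a morphism after an inclusion is again, by \<open>fi_map_factor\<close>, an inclusion
  after an automorphism. This submodule contains the degrees up to \<open>N\<close>, hence is
  everything. Requiring membership for all \<open>T\<close> of size \<open>n\<close> in
  \<open>W n\<close> makes it independent of the enumerations.\<close>

lemma generated_upto_of_gen_degree:
  assumes G: "group G" and V: "is_fig_module G R V" and N: "gen_degree G R V N"
  shows "fi_functor.generated_upto (fig_at V) (fig_act G V) N"
proof -
  interpret fi_functor "fig_at V" "fig_act G V" by (rule fi_functor_fig[OF G V])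
  note V' = fig_moduleD[OF V]
  define W where "W n = {x \<in> carrier (fi_space V n). \<forall>T. finite T \<longrightarrow> card T = n \<longrightarrow> x \<in> incl_span T (\<lambda>U. card U \<le> N)}" for n
  have sm: "a \<odot>\<^bsub>fig_at V T\<^esub> x \<in> incl_span T P" if a: "a \<in> carrier R" and T: "finite T" and x: "x \<in> incl_span T P" for a x T P
    using x
  proof induction
    interpret Module.module R "fig_at V T" unfolding fig_at_def by (rule V')
    {
      case zero show ?case using incl_span.zero a by simp
    next
      case (add x U c)
      interpret U: Module.module R "fig_at V U" unfolding fig_at_def by (rule V')
      have c: "x \<in> carrier (fig_at V T)" "fig_act G V U T (\<lambda>i. i) c \<in> carrier (fig_at V T)"
        using incl_span_carrier[OF T add.hyps(1)] incl_closed[OF T add.hyps(2,4)] .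
      have "a \<odot>\<^bsub>fig_at V T\<^esub> fig_act G V U T (\<lambda>i. i) c = fig_act G V U T (\<lambda>i. i) (a \<odot>\<^bsub>fig_at V U\<^esub> c)"
        unfolding fig_act_def fig_at_def
        using V'(5)[OF fig_unlabelled_hom[OF G T, of "\<lambda>i. i" U], of c a] add.hyps a by (simp add: fig_at_def)
      then have "a \<odot>\<^bsub>fig_at V T\<^esub> (x \<oplus>\<^bsub>fig_at V T\<^esub> fig_act G V U T (\<lambda>i. i) c)
         = a \<odot>\<^bsub>fig_at V T\<^esub> x \<oplus>\<^bsub>fig_at V T\<^esub> fig_act G V U T (\<lambda>i. i) (a \<odot>\<^bsub>fig_at V U\<^esub> c)"
        using c a by (simp add: smult_r_distr)
      then show ?case using incl_span.add[of _ T P, OF add.IH add.hyps(2,3)] a add.hyps(4) by simp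
    }
  qed
  have push: "fi_map V n m \<phi> x \<in> incl_span T' (\<lambda>U. card U \<le> N)"
    if \<phi>: "\<phi> \<in> fig_hom G n m" and T: "finite T" "card T = n" and T': "finite T'" "card T' = m"
      and x: "x \<in> incl_span T (\<lambda>U. card U \<le> N)" for n m \<phi> x T T'
    using x
  proof induction
    case zero
    have "fi_map V n m \<phi> \<zero>\<^bsub>fi_space V n\<^esub> = \<zero>\<^bsub>fi_space V m\<^esub>" by (rule fi_map_zero[OF V \<phi>])
    moreover have "fig_at V T' = fi_space V m" "fig_at V T = fi_space V n" using T T' by (simp_all add: fig_at_def)
    ultimately show ?case using incl_span.zero[of T' "\<lambda>U. card U \<le> N"] by simp
  next
    case (add x U c)
    have xc: "x \<in> carrier (fi_space V n)" using incl_span_carrier[OF T(1) add.hyps(1)] T by (simp add: fig_at_def)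
    have cc: "c \<in> carrier (fi_space V (card U))" using add.hyps by (simp add: fig_at_def)
    have inc: "fig_unlabelled G U T (\<lambda>i. i) \<in> fig_hom G (card U) n"
      using fig_unlabelled_hom[OF G T(1), of "\<lambda>i. i" U] add.hyps T by simp
    have ic: "fig_act G V U T (\<lambda>i. i) c \<in> carrier (fi_space V n)"
      using incl_closed[OF T(1) add.hyps(2,4)] T by (simp add: fig_at_def)
    have "fi_map V n m \<phi> (fig_act G V U T (\<lambda>i. i) c)
      = fi_map V (card U) m (fig_comp G (card U) \<phi> (fig_unlabelled G U T (\<lambda>i. i))) c"
      unfolding fig_act_def using V'(7)[OF \<phi> inc cc] T by simp
    moreover obtain U' \<phi>' where U': "U' \<subseteq> T'" "card U' = card U" "\<phi>' \<in> fig_hom G (card U) (card U)"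
      "fi_map V (card U) m (fig_comp G (card U) \<phi> (fig_unlabelled G U T (\<lambda>i. i))) c
        = fig_act G V U' T' (\<lambda>i. i) (fi_map V (card U) (card U) \<phi>' c)"
      using fi_map_factor[OF G V fig_hom_comp[OF G \<phi> inc] T' cc] by (elim exE conjE) (rule that)
    moreover have "fi_map V (card U) (card U) \<phi>' c \<in> carrier (fig_at V U')"
      using V'(3)[OF U'(3) cc] U'(2) by (simp add: fig_at_def)
    ultimately have "fi_map V n m \<phi> x \<oplus>\<^bsub>fig_at V T'\<^esub> fi_map V n m \<phi> (fig_act G V U T (\<lambda>i. i) c) \<in> incl_span T' (\<lambda>U. card U \<le> N)"
      using incl_span.add[of _ T' "\<lambda>U. card U \<le> N", OF add.IH U'(1)] add.hyps(3) by simp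
    moreover have "fig_at V T' = fi_space V m" "fig_at V T = fi_space V n" using T T' by (simp_all add: fig_at_def)
    ultimately show ?case using V'(4)[OF \<phi> xc ic] by simp
  qed
  have ext: "\<exists>T::nat set. finite T \<and> card T = n" for n by (intro exI[of _ "{1..n}"]) simp
  have W_incl_span: "x \<in> incl_span T (\<lambda>U. card U \<le> N)" if "x \<in> W (card T)" "finite T" for x T using that by (simp add: W_def)
  have "fig_submodule G R V W"
    unfolding fig_submodule_def
  proof (intro conjI allI impI)
    fix n
    interpret Module.module R "fi_space V n" by (rule V')
    show "submodule (W n) R (fi_space V n)"
    proof (rule submodule_of_closed[OF V'(1)])
      show "W n \<subseteq> carrier (fi_space V n)" by (auto simp: W_def)
      have "\<zero>\<^bsub>fi_space V n\<^esub> \<in> incl_span T (\<lambda>U. card U \<le> N)" if "card T = n" for T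
        using incl_span.zero[of T "\<lambda>U. card U \<le> N"] unfolding that[symmetric] fig_at_def[symmetric] .
      then show "\<zero>\<^bsub>fi_space V n\<^esub> \<in> W n" by (simp add: W_def)
      fix x assume x: "x \<in> W n"
      show "x \<oplus>\<^bsub>fi_space V n\<^esub> y \<in> W n" if "y \<in> W n" for y
        unfolding W_def
      proof (intro CollectI conjI allI impI)
        have "x \<in> carrier (fi_space V n)" "y \<in> carrier (fi_space V n)" using x that by (simp_all add: W_def)
        then show "x \<oplus>\<^bsub>fi_space V n\<^esub> y \<in> carrier (fi_space V n)" by simp
        fix T :: "nat set" assume T: "finite T" "card T = n"
        have "x \<in> incl_span T (\<lambda>U. card U \<le> N)" "y \<in> incl_span T (\<lambda>U. card U \<le> N)" using x that T by (simp_all add: W_def)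
        from incl_span_add[OF T(1) this] show "x \<oplus>\<^bsub>fi_space V n\<^esub> y \<in> incl_span T (\<lambda>U. card U \<le> N)"
          unfolding T(2)[symmetric] fig_at_def[symmetric] .
      qed
      show "a \<odot>\<^bsub>fi_space V n\<^esub> x \<in> W n" if "a \<in> carrier R" for a
        unfolding W_def
      proof (intro CollectI conjI allI impI)
        have "x \<in> carrier (fi_space V n)" using x by (simp add: W_def)
        then show "a \<odot>\<^bsub>fi_space V n\<^esub> x \<in> carrier (fi_space V n)" by (rule smult_closed[OF that])
        fix T :: "nat set" assume T: "finite T" "card T = n"
        have "x \<in> incl_span T (\<lambda>U. card U \<le> N)" using x T by (simp add: W_def)
        from sm[OF that T(1) this] show "a \<odot>\<^bsub>fi_space V n\<^esub> x \<in> incl_span T (\<lambda>U. card U \<le> N)"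
          unfolding T(2)[symmetric] fig_at_def[symmetric] .
      qed
    qed
  next
    fix n m \<phi> x assume \<phi>: "\<phi> \<in> fig_hom G n m" and x: "x \<in> W n"
    obtain T :: "nat set" where T: "finite T" "card T = n" using ext[of n] by (elim exE conjE) (rule that)
    have "x \<in> incl_span T (\<lambda>U. card U \<le> N)" using x T W_incl_span by simp
    then show "fi_map V n m \<phi> x \<in> W m"
      using push[OF \<phi> T] V'(3)[OF \<phi>] x by (simp add: W_def)
  qed
  moreover have "carrier (fi_space V n) \<subseteq> W n" if "n \<le> N" for n
  proof
    fix x assume x: "x \<in> carrier (fi_space V n)"
    have "x \<in> incl_span T (\<lambda>U. card U \<le> N)" if T: "finite T" "card T = n" for T
    proof -
      have xT: "x \<in> carrier (fig_at V T)" using x T by (simp add: fig_at_def)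
      show ?thesis using incl_span_gen[OF T(1) order_refl _ xT, of "\<lambda>U. card U \<le> N"] act_id[OF T(1) xT] \<open>n \<le> N\<close> T by simp
    qed
    then show "x \<in> W n" using x by (simp add: W_def)
  qed
  ultimately have "\<forall>n. W n = carrier (fi_space V n)" using N unfolding gen_degree_def by blast
  then show ?thesis unfolding generated_upto_def
  proof (intro allI impI)
    fix T x assume "\<forall>n. W n = carrier (fi_space V n)" "finite T" "x \<in> carrier (fig_at V T)"
    then show "x \<in> incl_span T (\<lambda>U. card U \<le> N)" by (intro W_incl_span) (simp_all add: fig_at_def)
  qed
qed

section \<open>Submodules, homomorphisms and kernels of FI_G-modules\<close>

lemma is_fig_module_restrict:
  assumes V: "is_fig_module G R V" and W: "fig_submodule G R V W"
  shows "is_fig_module G R (restrict_fig V W)"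
proof -
  note V' = fig_moduleD[OF V]
  have Ws: "submodule (W n) R (fi_space V n)" for n using W by (simp add: fig_submodule_def)
  have sub: "x \<in> carrier (fi_space V n)" if "x \<in> W n" for x n using submoduleD(1)[OF Ws] that by blast
  have Wm: "fi_map V n m \<phi> x \<in> W m" if "\<phi> \<in> fig_hom G n m" "x \<in> W n" for n m \<phi> x
    using W that unfolding fig_submodule_def by blast
  show ?thesis
    unfolding is_fig_module_def restrict_fig_def
  proof (intro conjI allI impI ballI)
    fix n
    show "Module.module R (fi_space (V\<lparr>fi_space := \<lambda>n. (fi_space V n)\<lparr>carrier := W n\<rparr>\<rparr>) n)"
      using submodule.submodule_is_module[OF Ws V'(1)] by simp
    show "fi_map (V\<lparr>fi_space := \<lambda>n. (fi_space V n)\<lparr>carrier := W n\<rparr>\<rparr>) n n (fig_id G n) v = v"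
      if "v \<in> carrier (fi_space (V\<lparr>fi_space := \<lambda>n. (fi_space V n)\<lparr>carrier := W n\<rparr>\<rparr>) n)" for v
      using that V'(6) sub by simp
  next
    fix n m \<phi> assume \<phi>: "\<phi> \<in> fig_hom G n m"
    show "klinear R (fi_space (V\<lparr>fi_space := \<lambda>n. (fi_space V n)\<lparr>carrier := W n\<rparr>\<rparr>) n)
          (fi_space (V\<lparr>fi_space := \<lambda>n. (fi_space V n)\<lparr>carrier := W n\<rparr>\<rparr>) m)
          (fi_map (V\<lparr>fi_space := \<lambda>n. (fi_space V n)\<lparr>carrier := W n\<rparr>\<rparr>) n m \<phi>)"
      unfolding klinear_def using V'(4,5)[OF \<phi>] Wm[OF \<phi>] sub by simp
  next
    fix r n m \<phi> \<psi> v
    assume "\<phi> \<in> fig_hom G n m" "\<psi> \<in> fig_hom G r n"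
      "v \<in> carrier (fi_space (V\<lparr>fi_space := \<lambda>n. (fi_space V n)\<lparr>carrier := W n\<rparr>\<rparr>) r)"
    then show "fi_map (V\<lparr>fi_space := \<lambda>n. (fi_space V n)\<lparr>carrier := W n\<rparr>\<rparr>) r m (fig_comp G r \<phi> \<psi>) v =
       fi_map (V\<lparr>fi_space := \<lambda>n. (fi_space V n)\<lparr>carrier := W n\<rparr>\<rparr>) n m \<phi>
        (fi_map (V\<lparr>fi_space := \<lambda>n. (fi_space V n)\<lparr>carrier := W n\<rparr>\<rparr>) r n \<psi> v)"
      using V'(7) sub by simp
  qed
qed

lemma fig_mod_homD:
  assumes "fig_mod_hom G R F V p"
  shows "x \<in> carrier (fi_space F n) \<Longrightarrow> p n x \<in> carrier (fi_space V n)"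
    "\<lbrakk>x \<in> carrier (fi_space F n); y \<in> carrier (fi_space F n)\<rbrakk> \<Longrightarrow>
      p n (x \<oplus>\<^bsub>fi_space F n\<^esub> y) = p n x \<oplus>\<^bsub>fi_space V n\<^esub> p n y"
    "\<lbrakk>a \<in> carrier R; x \<in> carrier (fi_space F n)\<rbrakk> \<Longrightarrow> p n (a \<odot>\<^bsub>fi_space F n\<^esub> x) = a \<odot>\<^bsub>fi_space V n\<^esub> p n x"
    "\<lbrakk>\<phi> \<in> fig_hom G n m; x \<in> carrier (fi_space F n)\<rbrakk> \<Longrightarrow> p m (fi_map F n m \<phi> x) = fi_map V n m \<phi> (p n x)"
proof -
  have k: "klinear R (fi_space F n) (fi_space V n) (p n)" using assms by (simp add: fig_mod_hom_def)
  show "p n x \<in> carrier (fi_space V n)" if "x \<in> carrier (fi_space F n)"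
    using k that unfolding klinear_def by blast
  show "p n (x \<oplus>\<^bsub>fi_space F n\<^esub> y) = p n x \<oplus>\<^bsub>fi_space V n\<^esub> p n y"
    if "x \<in> carrier (fi_space F n)" "y \<in> carrier (fi_space F n)"
    using k that unfolding klinear_def by blast
  show "p n (a \<odot>\<^bsub>fi_space F n\<^esub> x) = a \<odot>\<^bsub>fi_space V n\<^esub> p n x" if "a \<in> carrier R" "x \<in> carrier (fi_space F n)"
    using k that unfolding klinear_def by blast
  show "p m (fi_map F n m \<phi> x) = fi_map V n m \<phi> (p n x)" if "\<phi> \<in> fig_hom G n m" "x \<in> carrier (fi_space F n)"
    using assms that unfolding fig_mod_hom_def by blast
qed

lemma fig_mod_hom_zero:
  assumes F: "is_fig_module G R F" and V: "is_fig_module G R V" and p: "fig_mod_hom G R F V p"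
  shows "p n \<zero>\<^bsub>fi_space F n\<^esub> = \<zero>\<^bsub>fi_space V n\<^esub>"
proof -
  interpret F: abelian_group "fi_space F n" by (rule fig_moduleD[OF F])
  interpret V: abelian_group "fi_space V n" by (rule fig_moduleD[OF V])
  have "p n \<zero>\<^bsub>fi_space F n\<^esub> \<oplus>\<^bsub>fi_space V n\<^esub> p n \<zero>\<^bsub>fi_space F n\<^esub> = p n \<zero>\<^bsub>fi_space F n\<^esub>"
    using fig_mod_homD(2)[OF p F.zero_closed F.zero_closed] by simp
  then show ?thesis using V.add.l_cancel_one fig_mod_homD(1)[OF p F.zero_closed] by simp
qed

lemma kernel_submodule:
  assumes F: "is_fig_module G R F" and V: "is_fig_module G R V" and p: "fig_mod_hom G R F V p"
  shows "fig_submodule G R F (\<lambda>n. {u \<in> carrier (fi_space F n). p n u = \<zero>\<^bsub>fi_space V n\<^esub>})"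
  unfolding fig_submodule_def
proof (intro conjI allI impI)
  note p' = fig_mod_homD[OF p]
  fix n
  interpret F: Module.module R "fi_space F n" by (rule fig_moduleD[OF F])
  interpret V: Module.module R "fi_space V n" by (rule fig_moduleD[OF V])
  show "submodule {u \<in> carrier (fi_space F n). p n u = \<zero>\<^bsub>fi_space V n\<^esub>} R (fi_space F n)"
    by (rule submodule_of_closed[OF fig_moduleD(1)[OF F]])
      (auto simp: p'(2,3) fig_mod_hom_zero[OF F V p])
next
  fix n m \<phi> u assume \<phi>: "\<phi> \<in> fig_hom G n m" and u: "u \<in> {u \<in> carrier (fi_space F n). p n u = \<zero>\<^bsub>fi_space V n\<^esub>}"
  then show "fi_map F n m \<phi> u \<in> {u \<in> carrier (fi_space F m). p m u = \<zero>\<^bsub>fi_space V m\<^esub>}"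
    using fig_moduleD(3)[OF F \<phi>] fig_mod_homD(4)[OF p \<phi>] fi_map_zero[OF V \<phi>] by simp
qed

section \<open>Presentations and bounded torsion\<close>

lemma (in fi_surjection) generated_upto_image: "F.generated_upto N \<Longrightarrow> V.generated_upto N"
  unfolding V.generated_upto_def
proof (intro allI impI)
  fix T v assume gen: "F.generated_upto N" and T: "finite T" and v: "v \<in> carrier (MV T)"
  have "v \<in> p T ` carrier (MF T)" unfolding p_surj[OF T] by (rule v)
  then obtain x where x: "x \<in> carrier (MF T)" "v = p T x" by (elim imageE)
  then show "v \<in> V.incl_span T (\<lambda>U. card U \<le> N)" using p_incl_span[OF T] gen T by (simp add: F.generated_upto_def)
qed

text \<open>A lift \<open>x\<close> of a torsion element \<open>v\<close> is sent into the kernel by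
  some morphism. Factor this morphism as an automorphism \<open>\<phi>'\<close> followed by an
  inclusion: saturation of the kernel puts the image of \<open>x\<close> under
  \<open>\<phi>'\<close> into the kernel, and the inverse of \<open>\<phi>'\<close> then puts
  \<open>x\<close> itself there, so \<open>v\<close> is zero.\<close>

lemma torsion_bounded_of_presentation:
  assumes G: "group G" and F: "is_fig_module G R F" and V: "is_fig_module G R V"
    and p: "fig_mod_hom G R F V p" and surj: "\<And>n. p n ` carrier (fi_space F n) = carrier (fi_space V n)"
    and inj: "\<And>n m \<phi> x. \<lbrakk>\<phi> \<in> fig_hom G n m; x \<in> carrier (fi_space F n);
      fi_map F n m \<phi> x = \<zero>\<^bsub>fi_space F m\<^esub>\<rbrakk> \<Longrightarrow> x = \<zero>\<^bsub>fi_space F n\<^esub>"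
    and gen: "gen_fin_degree G R (fig_kernel V F p)"
  shows "\<exists>C. \<forall>n\<ge>C. \<forall>v. is_torsion G V n v \<longrightarrow> v = \<zero>\<^bsub>fi_space V n\<^esub>"
proof -
  let ?K = "\<lambda>n. {u \<in> carrier (fi_space F n). p n u = \<zero>\<^bsub>fi_space V n\<^esub>}"
  note F' = fig_moduleD[OF F] and p' = fig_mod_homD[OF p]
  obtain N where N: "gen_degree G R (fig_kernel V F p) N"
    using gen unfolding gen_fin_degree_iff by (elim exE)
  have KM: "is_fig_module G R (fig_kernel V F p)"
    unfolding fig_kernel_def by (rule is_fig_module_restrict[OF F kernel_submodule[OF F V p]])
  interpret F: fi_functor "fig_at F" "fig_act G F" by (rule fi_functor_fig[OF G F])
  let ?MK = "\<lambda>T. (fig_at F T)\<lparr>carrier := ?K (card T)\<rparr>"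
  have eq: "fig_at (fig_kernel V F p) = ?MK" "fig_act G (fig_kernel V F p) = fig_act G F"
    by (auto simp: fig_at_def fig_act_def fig_kernel_def restrict_fig_def fun_eq_iff)
  have K: "fi_functor ?MK (fig_act G F)" using fi_functor_fig[OF G KM] unfolding eq .
  have genK: "fi_functor.generated_upto ?MK (fig_act G F) N" using generated_upto_of_gen_degree[OF G KM N] unfolding eq .
  have sat: "x \<in> ?K (card S)" if "finite T" "S \<subseteq> T" "N * N + N + 2 \<le> card S" "x \<in> carrier (fig_at F S)"
    "fig_act G F S T (\<lambda>i. i) x \<in> ?K (card T)" for S T x
  proof (rule F.saturated_of_generated[OF K _ genK _ that])
    show "?K (card T) \<subseteq> carrier (fig_at F T)" for T by (auto simp: fig_at_def)
    fix S T f x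
    assume "finite T" "inj_on f S" "f ` S \<subseteq> T" "x \<in> carrier (fig_at F S)" "fig_act G F S T f x = \<zero>\<^bsub>fig_at F T\<^esub>"
    then show "x = \<zero>\<^bsub>fig_at F S\<^esub>" using inj[OF fig_unlabelled_hom[OF G]] by (simp add: fig_at_def fig_act_def)
  qed
  have "v = \<zero>\<^bsub>fi_space V n\<^esub>" if n: "N * N + N + 2 \<le> n" and v: "is_torsion G V n v" for n v
  proof -
    obtain m \<phi> where \<phi>: "\<phi> \<in> fig_hom G n m" "fi_map V n m \<phi> v = \<zero>\<^bsub>fi_space V m\<^esub>" and vc: "v \<in> carrier (fi_space V n)"
      using v unfolding is_torsion_def by (elim conjE exE)
    have "v \<in> p n ` carrier (fi_space F n)" unfolding surj by (rule vc)
    then obtain x where x: "x \<in> carrier (fi_space F n)" "v = p n x" by (elim imageE)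
    have fm: "finite {1..m}" "card {1..m} = m" by simp_all
    obtain U \<phi>' where U: "U \<subseteq> {1..m}" "card U = n" "\<phi>' \<in> fig_hom G n n"
      "fi_map F n m \<phi> x = fig_act G F U {1..m} (\<lambda>i. i) (fi_map F n n \<phi>' x)"
      using fi_map_factor[OF G F \<phi>(1) fm x(1)] by (elim exE conjE) (rule that)
    have x'c: "fi_map F n n \<phi>' x \<in> carrier (fi_space F n)" by (rule F'(3)[OF U(3) x(1)])
    have "fi_map F n m \<phi> x \<in> ?K m" using p'(4)[OF \<phi>(1) x(1)] F'(3)[OF \<phi>(1) x(1)] \<phi>(2) x(2) by simp
    then have K': "fi_map F n n \<phi>' x \<in> ?K n"
      using sat[of "{1..m}" U "fi_map F n n \<phi>' x"] U x'c n by (simp add: fig_at_def)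
    obtain \<psi> where \<psi>: "\<psi> \<in> fig_hom G n n" "fig_comp G n \<psi> \<phi>' = fig_id G n"
      using fig_hom_inverse[OF G U(3)] by (elim bexE conjE)
    have "p n x = p n (fi_map F n n \<psi> (fi_map F n n \<phi>' x))"
      using F'(7)[OF \<psi>(1) U(3) x(1)] \<psi>(2) F'(6)[OF x(1)] by simp
    also have "\<dots> = \<zero>\<^bsub>fi_space V n\<^esub>"
      using p'(4)[OF \<psi>(1) x'c] K' fi_map_zero[OF V \<psi>(1)] by simp
    finally show ?thesis using x by simp
  qed
  then show ?thesis by (intro exI[of _ "N * N + N + 2"] allI impI)
qed

text \<open>Bounded torsion is torsion freeness of the 0-fold derivative. Since \<open>V\<close>
  inherits generation in degree \<open>N\<close> from \<open>F\<close>, one threshold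
  \<open>C'\<close> works for the derivatives up to order \<open>N\<close>, and the kernel is
  generated in degree \<open>N + C'\<close>.\<close>

lemma kernel_gen_fin_degree:
  assumes G: "group G" and F: "is_fig_module G R F" and V: "is_fig_module G R V"
    and p: "fig_mod_hom G R F V p" and surj: "\<And>n. p n ` carrier (fi_space F n) = carrier (fi_space V n)"
    and gen: "gen_degree G R F N"
    and C: "\<And>n v. n \<ge> C \<Longrightarrow> is_torsion G V n v \<Longrightarrow> v = \<zero>\<^bsub>fi_space V n\<^esub>"
  shows "gen_fin_degree G R (fig_kernel V F p)"
proof -
  note F' = fig_moduleD[OF F] and p' = fig_mod_homD[OF p]
  interpret F: fi_functor "fig_at F" "fig_act G F" by (rule fi_functor_fig[OF G F])
  interpret V: fi_functor "fig_at V" "fig_act G V" by (rule fi_functor_fig[OF G V])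
  have inc: "fig_unlabelled G S T (\<lambda>i. i) \<in> fig_hom G (card S) (card T)" if "finite T" "S \<subseteq> T" for S T
    by (rule fig_unlabelled_hom[OF G]) (use that in auto)
  interpret fi_surjection "fig_at F" "fig_act G F" "fig_at V" "fig_act G V" "\<lambda>T. p (card T)"
  proof
    show "p (card T) (x \<oplus>\<^bsub>fig_at F T\<^esub> y) = p (card T) x \<oplus>\<^bsub>fig_at V T\<^esub> p (card T) y"
      if "x \<in> carrier (fig_at F T)" "y \<in> carrier (fig_at F T)" for T x y
      using that p'(2) by (simp add: fig_at_def)
    show "p (card T) (fig_act G F S T (\<lambda>i. i) x) = fig_act G V S T (\<lambda>i. i) (p (card S) x)"
      if "finite T" "S \<subseteq> T" "x \<in> carrier (fig_at F S)" for S T x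
      using that p'(4)[OF inc[OF that(1,2)]] by (simp add: fig_at_def fig_act_def)
    show "p (card T) ` carrier (fig_at F T) = carrier (fig_at V T)" for T using surj by (simp add: fig_at_def)
  qed
  have genF: "F.generated_upto N" by (rule generated_upto_of_gen_degree[OF G F gen])
  have "V.deriv_torsion_free 0 C"
  proof (rule V.deriv_torsion_free_0I)
    fix S T f x
    assume a: "finite T" "inj_on f S" "f ` S \<subseteq> T" "C \<le> card S" "x \<in> carrier (fig_at V S)" "fig_act G V S T f x = \<zero>\<^bsub>fig_at V T\<^esub>"
    have "is_torsion G V (card S) x" unfolding is_torsion_def
      using fig_unlabelled_hom[OF G a(1-3)] a(5,6) unfolding fig_at_def fig_act_def by blast
    then show "x = \<zero>\<^bsub>fig_at V S\<^esub>" using C[OF a(4)] by (simp add: fig_at_def)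
  qed
  then obtain C' where C': "\<forall>a\<le>N. V.deriv_torsion_free a C'" using V.deriv_torsion_free_all[OF generated_upto_image[OF genF]] by blast
  have "gen_degree G R (fig_kernel V F p) (N + C')"
    unfolding gen_degree_def
  proof (intro allI impI, elim conjE)
    fix W n
    assume W: "fig_submodule G R (fig_kernel V F p) W"
      and low: "\<forall>n\<le>N + C'. carrier (fi_space (fig_kernel V F p) n) \<subseteq> W n"
    let ?K = "\<lambda>n. {u \<in> carrier (fi_space F n). p n u = \<zero>\<^bsub>fi_space V n\<^esub>}"
    have sp: "fi_space (fig_kernel V F p) n = (fi_space F n)\<lparr>carrier := ?K n\<rparr>" for n
      by (simp add: fig_kernel_def restrict_fig_def)
    have mp: "fi_map (fig_kernel V F p) = fi_map F" by (simp add: fig_kernel_def restrict_fig_def)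
    have Ws: "submodule (W n) R ((fi_space F n)\<lparr>carrier := ?K n\<rparr>)" for n
      using W unfolding fig_submodule_def sp by blast
    have Wm: "fi_map F n m \<phi> v \<in> W m" if "\<phi> \<in> fig_hom G n m" "v \<in> W n" for n m \<phi> v
      using W that unfolding fig_submodule_def mp by blast
    have "x \<in> W (card T)" if T: "finite T" "x \<in> carrier (fig_at F T)" "p (card T) x = \<zero>\<^bsub>fig_at V T\<^esub>" for T x
    proof (rule kernel_generated[OF genF C', where W = "\<lambda>T. W (card T)", OF _ _ _ _ T])
      show "\<zero>\<^bsub>fig_at F T\<^esub> \<in> W (card T)" for T using submoduleD(2)[OF Ws] by (simp add: fig_at_def)
      show "x \<oplus>\<^bsub>fig_at F T\<^esub> y \<in> W (card T)" if "x \<in> W (card T)" "y \<in> W (card T)" for T x y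
        using submoduleD(3)[OF Ws that] by (simp add: fig_at_def)
      show "fig_act G F S T (\<lambda>i. i) x \<in> W (card T)" if "finite T" "S \<subseteq> T" "x \<in> W (card S)" for S T x
        using Wm[OF inc[OF that(1,2)] that(3)] by (simp add: fig_act_def)
      show "x \<in> W (card T)" if "card T \<le> N + C'" "x \<in> carrier (fig_at F T)" "p (card T) x = \<zero>\<^bsub>fig_at V T\<^esub>" for T x
        using low[rule_format, OF that(1)] that(2,3) unfolding sp by (auto simp: fig_at_def)
    qed
    from this[of "{1..n}"] have "?K n \<subseteq> W n" by (auto simp: fig_at_def)
    moreover have "W n \<subseteq> ?K n" using submoduleD(1)[OF Ws, of n] by simp
    ultimately show "W n = carrier (fi_space (fig_kernel V F p) n)" unfolding sp by simp
  qed
  then show ?thesis unfolding gen_fin_degree_iff by (rule exI)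
qed

text \<open>Zero is always torsion, so a degree enters the supremum exactly if it has a nonzero
  torsion element. A supremum of natural numbers is below \<open>\<infinity>\<close> exactly if they
  are bounded, the empty set with value \<open>-\<infinity>\<close> included.\<close>

lemma td_finite_iff:
  assumes G: "group G" and V: "is_fig_module G R V"
  shows "td G V < \<infinity> \<longleftrightarrow> (\<exists>C. \<forall>n\<ge>C. \<forall>v. is_torsion G V n v \<longrightarrow> v = \<zero>\<^bsub>fi_space V n\<^esub>)"
proof -
  let ?S = "{ereal (real n) | n. {v. is_torsion G V n v} \<noteq> {\<zero>\<^bsub>fi_space V n\<^esub>}}"
  have td: "td G V = Sup ?S"
    unfolding td_def fig_deg_def torsion_submodule_def restrict_fig_def by simp
  have z: "is_torsion G V n \<zero>\<^bsub>fi_space V n\<^esub>" for n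
  proof -
    interpret abelian_group "fi_space V n" by (rule fig_moduleD[OF V])
    show ?thesis unfolding is_torsion_def using fi_map_zero[OF V fig_id_hom[OF G]] fig_id_hom[OF G] zero_closed by blast
  qed
  show ?thesis
  proof
    assume "td G V < \<infinity>"
    then obtain r where "Sup ?S < ereal (real r)" unfolding td
      using less_PInf_Ex_of_nat[of "Sup ?S"] by (auto simp: less_top)
    then have r: "Sup ?S \<le> ereal (real r)" by (rule less_imp_le)
    have "v = \<zero>\<^bsub>fi_space V n\<^esub>" if n: "Suc r \<le> n" and v: "is_torsion G V n v" for n v
    proof (rule ccontr)
      assume "v \<noteq> \<zero>\<^bsub>fi_space V n\<^esub>"
      then have "ereal (real n) \<in> ?S" using v by blast
      then have "ereal (real n) \<le> Sup ?S" by (rule Sup_upper)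
      then have "ereal (real n) \<le> ereal (real r)" using r by (rule order_trans)
      then show False using n by simp
    qed
    then show "\<exists>C. \<forall>n\<ge>C. \<forall>v. is_torsion G V n v \<longrightarrow> v = \<zero>\<^bsub>fi_space V n\<^esub>" by blast
  next
    assume "\<exists>C. \<forall>n\<ge>C. \<forall>v. is_torsion G V n v \<longrightarrow> v = \<zero>\<^bsub>fi_space V n\<^esub>"
    then obtain C where C: "\<forall>n\<ge>C. \<forall>v. is_torsion G V n v \<longrightarrow> v = \<zero>\<^bsub>fi_space V n\<^esub>" by (elim exE)
    have "Sup ?S \<le> ereal (real C)"
    proof (rule Sup_least)
      fix s assume "s \<in> ?S"
      then obtain n where n: "s = ereal (real n)" "{v. is_torsion G V n v} \<noteq> {\<zero>\<^bsub>fi_space V n\<^esub>}"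
        by (elim CollectE exE conjE) (rule that)
      have "n < C"
      proof (rule ccontr)
        assume "\<not> n < C"
        then have "v = \<zero>\<^bsub>fi_space V n\<^esub>" if "is_torsion G V n v" for v
          using C[rule_format, OF _ that] by simp
        then have "{v. is_torsion G V n v} = {\<zero>\<^bsub>fi_space V n\<^esub>}" using z[of n] by blast
        then show False using n by simp
      qed
      then show "s \<le> ereal (real C)" using n by simp
    qed
    then show "td G V < \<infinity>" unfolding td by (rule order_le_less_trans) simp
  qed
qed

section \<open>Free modules\<close>

context cring begin

lemma fsuppD: "c \<in> fsupp R S \<Longrightarrow> c x \<in> carrier R" "c \<in> fsupp R S \<Longrightarrow> x \<notin> S \<Longrightarrow> c x = \<zero>"
  "c \<in> fsupp R S \<Longrightarrow> finite {x. c x \<noteq> \<zero>}"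
  by (auto simp: fsupp_def)

lemma fsuppI: "\<lbrakk>\<And>x. c x \<in> carrier R; \<And>x. x \<notin> S \<Longrightarrow> c x = \<zero>; finite {x. c x \<noteq> \<zero>}\<rbrakk> \<Longrightarrow> c \<in> fsupp R S"
  by (auto simp: fsupp_def)

lemma fzero_in: "fzero R \<in> fsupp R S" by (auto simp: fsupp_def fzero_def)

lemma fadd_in: assumes "c \<in> fsupp R S" "d \<in> fsupp R S" shows "fadd R c d \<in> fsupp R S"
proof (rule fsuppI)
  show "finite {x. fadd R c d x \<noteq> \<zero>}"
    by (rule finite_subset[of _ "{x. c x \<noteq> \<zero>} \<union> {x. d x \<noteq> \<zero>}"]) (use assms in \<open>auto simp: fadd_def fsupp_def\<close>)
qed (use assms in \<open>auto simp: fadd_def fsupp_def\<close>)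

lemma fsmult_in: assumes "c \<in> fsupp R S" "a \<in> carrier R" shows "fsmult R a c \<in> fsupp R S"
proof (rule fsuppI)
  show "finite {x. fsmult R a c x \<noteq> \<zero>}"
    by (rule finite_subset[of _ "{x. c x \<noteq> \<zero>}"]) (use assms in \<open>auto simp: fsmult_def fsupp_def\<close>)
qed (use assms in \<open>auto simp: fsmult_def fsupp_def\<close>)

lemma fneg_eq: "c \<in> fsupp R S \<Longrightarrow> fneg R c = fsmult R (\<ominus> \<one>) c"
  by (rule ext) (simp add: fneg_def fsmult_def l_minus fsuppD)

lemma fneg_in: "c \<in> fsupp R S \<Longrightarrow> fneg R c \<in> fsupp R S"
  using fsmult_in[of c S "\<ominus> \<one>"] by (simp add: fneg_eq)

lemma fdelta_in: "x \<in> S \<Longrightarrow> fdelta R x \<in> fsupp R S"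
  by (rule fsuppI) (auto simp: fdelta_def)

text \<open>Packed as a module record so that \<open>klinear\<close> can express linearity;
  \<open>mult\<close> and \<open>one\<close> are mere placeholders of the record type.\<close>

definition fspace :: "'x set \<Rightarrow> ('a, 'x \<Rightarrow> 'a) module" where
  "fspace S = \<lparr>carrier = fsupp R S, mult = undefined, one = undefined, zero = fzero R, add = fadd R, smult = fsmult R\<rparr>"

lemma fspace_simps: "carrier (fspace S) = fsupp R S" "zero (fspace S) = fzero R" "add (fspace S) = fadd R"
  "smult (fspace S) = fsmult R"
  by (simp_all add: fspace_def)

text \<open>Removes one point of the support at a time; linear identities then need checking on
  basis functions only.\<close>

lemma fsupp_induct [consumes 1, case_names zero add]:
  assumes "c \<in> fsupp R S" "P (fzero R)"
    and step: "\<And>c a x. \<lbrakk>c \<in> fsupp R S; P c; a \<in> carrier R; x \<in> S\<rbrakk> \<Longrightarrow> P (fadd R c (fsmult R a (fdelta R x)))"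
  shows "P c"
  using assms(1)
proof (induction "card {x. c x \<noteq> \<zero>}" arbitrary: c)
  case 0
  then have "{x. c x \<noteq> \<zero>} = {}" using fsuppD(3)[OF 0(2)] by simp
  then have "c = fzero R" by (auto simp: fzero_def)
  then show ?case using assms(2) by simp
next
  case (Suc n)
  then have "{x. c x \<noteq> \<zero>} \<noteq> {}" by (metis card.empty nat.distinct(1))
  then obtain x where x: "c x \<noteq> \<zero>" by blast
  have xS: "x \<in> S" using x fsuppD(2)[OF Suc.prems] by metis
  note cc = fsuppD(1)[OF Suc.prems]
  let ?d = "c(x := \<zero>)"
  have sup: "{y. ?d y \<noteq> \<zero>} = {y. c y \<noteq> \<zero>} - {x}" by auto
  have d: "?d \<in> fsupp R S"
    by (rule fsuppI) (use cc fsuppD(2,3)[OF Suc.prems] sup in auto)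
  have "card {y. ?d y \<noteq> \<zero>} = n" unfolding sup using x Suc(2) fsuppD(3)[OF Suc.prems] by simp
  then have Pd: "P ?d" using Suc(1)[OF _ d] by simp
  have eq: "c = fadd R ?d (fsmult R (c x) (fdelta R x))"
    using cc by (auto simp: fadd_def fsmult_def fdelta_def)
  show ?case by (subst eq) (rule step[OF d Pd cc xS])
qed

definition flinear :: "'x set \<Rightarrow> 'y set \<Rightarrow> (('x \<Rightarrow> 'a) \<Rightarrow> 'y \<Rightarrow> 'a) \<Rightarrow> bool" where
  "flinear S S' L \<longleftrightarrow> klinear R (fspace S) (fspace S') L"

lemma flinearI:
  assumes "\<And>c. c \<in> fsupp R S \<Longrightarrow> L c \<in> fsupp R S'"
    "\<And>c d. \<lbrakk>c \<in> fsupp R S; d \<in> fsupp R S\<rbrakk> \<Longrightarrow> L (fadd R c d) = fadd R (L c) (L d)"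
    "\<And>a c. \<lbrakk>a \<in> carrier R; c \<in> fsupp R S\<rbrakk> \<Longrightarrow> L (fsmult R a c) = fsmult R a (L c)"
  shows "flinear S S' L"
  unfolding flinear_def klinear_def fspace_simps using assms by blast

lemma flinearD:
  assumes "flinear S S' L"
  shows "c \<in> fsupp R S \<Longrightarrow> L c \<in> fsupp R S'"
    "\<lbrakk>c \<in> fsupp R S; d \<in> fsupp R S\<rbrakk> \<Longrightarrow> L (fadd R c d) = fadd R (L c) (L d)"
    "\<lbrakk>a \<in> carrier R; c \<in> fsupp R S\<rbrakk> \<Longrightarrow> L (fsmult R a c) = fsmult R a (L c)"
  using assms unfolding flinear_def klinear_def fspace_simps by blast+

lemma flinear_neg:
  assumes "flinear S S' L" "c \<in> fsupp R S" shows "L (fneg R c) = fneg R (L c)"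
  using flinearD(3)[OF assms(1) _ assms(2), of "\<ominus> \<one>"] flinearD(1)[OF assms] assms(2) by (simp add: fneg_eq)

lemma flinear_zero:
  assumes "flinear S S' L" shows "L (fzero R) = fzero R"
proof -
  have z: "fsmult R \<zero> c = fzero R" if "c \<in> fsupp R S''" for c :: "'z \<Rightarrow> 'a" and S''
    using fsuppD(1)[OF that] by (auto simp: fsmult_def fzero_def)
  have "L (fsmult R \<zero> (fzero R)) = fsmult R \<zero> (L (fzero R))"
    by (rule flinearD(3)[OF assms zero_closed fzero_in])
  then show ?thesis unfolding z[OF fzero_in] z[OF flinearD(1)[OF assms fzero_in]] .
qed

definition fsubspace :: "'x set \<Rightarrow> ('x \<Rightarrow> 'a) set \<Rightarrow> bool" where
  "fsubspace S N \<longleftrightarrow> N \<subseteq> fsupp R S \<and> fzero R \<in> N \<and> (\<forall>c\<in>N. \<forall>d\<in>N. fadd R c d \<in> N)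
     \<and> (\<forall>a\<in>carrier R. \<forall>c\<in>N. fsmult R a c \<in> N)"

lemma fsubspaceD:
  assumes "fsubspace S N"
  shows "c \<in> N \<Longrightarrow> c \<in> fsupp R S" "fzero R \<in> N" "\<lbrakk>c \<in> N; d \<in> N\<rbrakk> \<Longrightarrow> fadd R c d \<in> N"
    "\<lbrakk>a \<in> carrier R; c \<in> N\<rbrakk> \<Longrightarrow> fsmult R a c \<in> N" "c \<in> N \<Longrightarrow> fneg R c \<in> N"
proof -
  show s: "c \<in> N \<Longrightarrow> c \<in> fsupp R S" "fzero R \<in> N" "\<lbrakk>c \<in> N; d \<in> N\<rbrakk> \<Longrightarrow> fadd R c d \<in> N"
    and m: "\<And>a. \<lbrakk>a \<in> carrier R; c \<in> N\<rbrakk> \<Longrightarrow> fsmult R a c \<in> N"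
    using assms unfolding fsubspace_def by blast+
  show "fneg R c \<in> N" if "c \<in> N" using m[OF _ that, of "\<ominus> \<one>"] fneg_eq[OF s(1)[OF that]] by simp
qed

lemma fspan_subspace:
  assumes "X \<subseteq> fsupp R S" shows "fsubspace S (fspan R S X)"
proof -
  have "fspan R S X \<subseteq> fsupp R S"
    unfolding fspan_def by (rule Inter_lower) (simp add: assms fzero_in fadd_in fsmult_in)
  then show ?thesis unfolding fsubspace_def by (auto simp: fspan_def)
qed

lemma fspan_base: "x \<in> X \<Longrightarrow> x \<in> fspan R S X"
  by (auto simp: fspan_def)

lemma fspan_induct:
  assumes "c \<in> fspan R S X" "X \<subseteq> fsupp R S"
    and "P (fzero R)" "\<And>c. c \<in> X \<Longrightarrow> P c"
    "\<And>c d. \<lbrakk>c \<in> fsupp R S; d \<in> fsupp R S; P c; P d\<rbrakk> \<Longrightarrow> P (fadd R c d)"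
    "\<And>a c. \<lbrakk>a \<in> carrier R; c \<in> fsupp R S; P c\<rbrakk> \<Longrightarrow> P (fsmult R a c)"
  shows "P c"
proof -
  let ?N = "{c \<in> fsupp R S. P c}"
  have "fspan R S X \<subseteq> ?N" unfolding fspan_def
  proof (rule Inter_lower, rule CollectI, intro conjI ballI)
    show "X \<subseteq> ?N" using assms(2,4) by blast
    show "?N \<subseteq> fsupp R S" by blast
    show "fzero R \<in> ?N" using assms(3) fzero_in by simp
    show "fadd R c d \<in> ?N" if "c \<in> ?N" "d \<in> ?N" for c d
      using that assms(5) fadd_in[of c S d] by simp
    show "fsmult R a c \<in> ?N" if "a \<in> carrier R" "c \<in> ?N" for a c
      using that assms(6) fsmult_in[of c S a] by simp
  qed
  then show ?thesis using assms(1) by blast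
qed

lemma flinear_fspan:
  assumes L: "flinear S S' L" and X: "X \<subseteq> fsupp R S" and N': "fsubspace S' N'"
    and LX: "\<And>x. x \<in> X \<Longrightarrow> L x \<in> N'" and c: "c \<in> fspan R S X"
  shows "L c \<in> N'"
  by (rule fspan_induct[OF c X, where P = "\<lambda>c. L c \<in> N'"])
    (use LX flinear_zero[OF L] flinearD(2,3)[OF L] fsubspaceD(2-4)[OF N'] in simp_all)

text \<open>Vanishing summands may be added, so sums belonging to different functions can be
  compared over a common finite set.\<close>

lemma flin_ext_on:
  assumes "c \<in> fsupp R S" "finite A" "{x. c x \<noteq> \<zero>} \<subseteq> A"
  shows "flin_ext R f c y = (\<Oplus>x\<in>A. if f x = y then c x else \<zero>)"
  unfolding flin_ext_def
  by (rule add.finprod_mono_neutral_cong_left) (use assms fsuppD(1)[OF assms(1)] in auto)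

lemma flin_ext_linear:
  assumes f: "f ` S \<subseteq> S'" shows "flinear S S' (flin_ext R f)"
proof (rule flinearI)
  fix c assume c: "c \<in> fsupp R S"
  note cc = fsuppD(1)[OF c]
  show "flin_ext R f c \<in> fsupp R S'"
  proof (rule fsuppI)
    show "flin_ext R f c y \<in> carrier R" for y
      unfolding flin_ext_def using cc by (auto intro!: finsum_closed)
    have z: "flin_ext R f c y = \<zero>" if "y \<notin> f ` {x. c x \<noteq> \<zero>}" for y
    proof -
      have "flin_ext R f c y = (\<Oplus>x\<in>{x. c x \<noteq> \<zero>}. \<zero>)"
        unfolding flin_ext_def by (rule add.finprod_cong') (use that in auto)
      then show ?thesis by simp
    qed
    have "{x. c x \<noteq> \<zero>} \<subseteq> S" using fsuppD(2)[OF c] by blast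
    then have "f ` {x. c x \<noteq> \<zero>} \<subseteq> S'" using f by blast
    then show "flin_ext R f c y = \<zero>" if "y \<notin> S'" for y using z[of y] that by blast
    show "finite {y. flin_ext R f c y \<noteq> \<zero>}"
      by (rule finite_subset[of _ "f ` {x. c x \<noteq> \<zero>}"]) (use z fsuppD(3)[OF c] in auto)
  qed
  show "flin_ext R f (fsmult R a c) = fsmult R a (flin_ext R f c)" if a: "a \<in> carrier R" for a
  proof (rule ext)
    fix y
    have fin: "finite {x. c x \<noteq> \<zero>}" by (rule fsuppD(3)[OF c])
    have "flin_ext R f (fsmult R a c) y = (\<Oplus>x\<in>{x. c x \<noteq> \<zero>}. if f x = y then fsmult R a c x else \<zero>)"
      by (rule flin_ext_on[OF fsmult_in[OF c a] fin]) (use a in \<open>auto simp: fsmult_def\<close>)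
    also have "\<dots> = (\<Oplus>x\<in>{x. c x \<noteq> \<zero>}. a \<otimes> (if f x = y then c x else \<zero>))"
      by (rule add.finprod_cong') (use a cc in \<open>auto simp: fsmult_def\<close>)
    also have "\<dots> = a \<otimes> (\<Oplus>x\<in>{x. c x \<noteq> \<zero>}. if f x = y then c x else \<zero>)"
      using finsum_rdistr[OF fin a, of "\<lambda>x. if f x = y then c x else \<zero>"] cc by (auto simp: Pi_iff)
    finally show "flin_ext R f (fsmult R a c) y = fsmult R a (flin_ext R f c) y"
      by (simp add: fsmult_def flin_ext_def)
  qed
  fix d assume d: "d \<in> fsupp R S"
  note dc = fsuppD(1)[OF d]
  show "flin_ext R f (fadd R c d) = fadd R (flin_ext R f c) (flin_ext R f d)"
  proof (rule ext)
    fix y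
    let ?A = "{x. c x \<noteq> \<zero>} \<union> {x. d x \<noteq> \<zero>}"
    have fin: "finite ?A" using fsuppD(3)[OF c] fsuppD(3)[OF d] by simp
    have "flin_ext R f (fadd R c d) y = (\<Oplus>x\<in>?A. if f x = y then fadd R c d x else \<zero>)"
      by (rule flin_ext_on[OF fadd_in[OF c d] fin]) (auto simp: fadd_def)
    also have "\<dots> = (\<Oplus>x\<in>?A. (if f x = y then c x else \<zero>) \<oplus> (if f x = y then d x else \<zero>))"
      by (rule add.finprod_cong') (use cc dc in \<open>auto simp: fadd_def\<close>)
    also have "\<dots> = (\<Oplus>x\<in>?A. if f x = y then c x else \<zero>) \<oplus> (\<Oplus>x\<in>?A. if f x = y then d x else \<zero>)"
      by (rule finsum_addf) (use cc dc in auto)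
    also have "\<dots> = flin_ext R f c y \<oplus> flin_ext R f d y"
      by (simp only: flin_ext_on[OF c fin Un_upper1] flin_ext_on[OF d fin Un_upper2])
    finally show "flin_ext R f (fadd R c d) y = fadd R (flin_ext R f c) (flin_ext R f d) y"
      by (simp add: fadd_def)
  qed
qed

lemma flin_ext_delta: "flin_ext R f (fdelta R x) = fdelta R (f x)"
proof (rule ext)
  fix y
  have "flin_ext R f (fdelta R x) y = (\<Oplus>z\<in>{x}. if f z = y then fdelta R x z else \<zero>)"
    by (rule flin_ext_on[OF fdelta_in[of x UNIV]]) (auto simp: fdelta_def)
  then show "flin_ext R f (fdelta R x) y = fdelta R (f x) y" by (auto simp: fdelta_def)
qed

section \<open>Evaluation of formal combinations in a module\<close>

definition feval :: "('a, 'm) module \<Rightarrow> ('x \<Rightarrow> 'm) \<Rightarrow> ('x \<Rightarrow> 'a) \<Rightarrow> 'm" where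
  "feval M t c = (\<Oplus>\<^bsub>M\<^esub>x\<in>{x. c x \<noteq> \<zero>}. c x \<odot>\<^bsub>M\<^esub> t x)"

lemma feval_linear:
  assumes M: "Module.module R M" and t: "\<And>x. x \<in> S \<Longrightarrow> t x \<in> carrier M"
  shows "klinear R (fspace S) M (feval M t)"
proof -
  interpret M: Module.module R M by fact
  have on: "feval M t c = (\<Oplus>\<^bsub>M\<^esub>x\<in>A. c x \<odot>\<^bsub>M\<^esub> t x)"
    if c: "c \<in> fsupp R S" and A: "finite A" "{x. c x \<noteq> \<zero>} \<subseteq> A" "A \<subseteq> S" for c A
    unfolding feval_def
    by (rule M.add.finprod_mono_neutral_cong_left) (use A fsuppD(1)[OF c] t in auto)
  have sub: "{x. c x \<noteq> \<zero>} \<subseteq> S" if "c \<in> fsupp R S" for c using fsuppD(2)[OF that] by blast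
  show ?thesis unfolding klinear_def fspace_simps
  proof (intro conjI ballI)
    show "feval M t \<in> fsupp R S \<rightarrow> carrier M"
    proof
      fix c assume c: "c \<in> fsupp R S"
      show "feval M t c \<in> carrier M" unfolding feval_def
        by (rule M.finsum_closed) (use fsuppD(1)[OF c] sub[OF c] t in auto)
    qed
    fix c assume c: "c \<in> fsupp R S"
    note cc = fsuppD(1)[OF c]
    show "feval M t (fsmult R a c) = a \<odot>\<^bsub>M\<^esub> feval M t c" if a: "a \<in> carrier R" for a
    proof -
      have fin: "finite {x. c x \<noteq> \<zero>}" by (rule fsuppD(3)[OF c])
      have "feval M t (fsmult R a c) = (\<Oplus>\<^bsub>M\<^esub>x\<in>{x. c x \<noteq> \<zero>}. fsmult R a c x \<odot>\<^bsub>M\<^esub> t x)"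
        by (rule on[OF fsmult_in[OF c a] fin _ sub[OF c]]) (use a in \<open>auto simp: fsmult_def\<close>)
      also have "\<dots> = (\<Oplus>\<^bsub>M\<^esub>x\<in>{x. c x \<noteq> \<zero>}. a \<odot>\<^bsub>M\<^esub> (c x \<odot>\<^bsub>M\<^esub> t x))"
        by (rule M.add.finprod_cong') (use a cc sub[OF c] t in \<open>auto simp: fsmult_def M.smult_assoc1\<close>)
      also have "\<dots> = a \<odot>\<^bsub>M\<^esub> feval M t c" unfolding feval_def
        by (rule M.finsum_smult_ldistr[OF fin a, symmetric]) (use cc sub[OF c] t in auto)
      finally show ?thesis .
    qed
    fix d assume d: "d \<in> fsupp R S"
    note dc = fsuppD(1)[OF d]
    let ?A = "{x. c x \<noteq> \<zero>} \<union> {x. d x \<noteq> \<zero>}"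
    have fin: "finite ?A" using fsuppD(3)[OF c] fsuppD(3)[OF d] by simp
    have A: "?A \<subseteq> S" using sub[OF c] sub[OF d] by blast
    have "feval M t (fadd R c d) = (\<Oplus>\<^bsub>M\<^esub>x\<in>?A. fadd R c d x \<odot>\<^bsub>M\<^esub> t x)"
      by (rule on[OF fadd_in[OF c d] fin _ A]) (auto simp: fadd_def)
    also have "\<dots> = (\<Oplus>\<^bsub>M\<^esub>x\<in>?A. c x \<odot>\<^bsub>M\<^esub> t x \<oplus>\<^bsub>M\<^esub> d x \<odot>\<^bsub>M\<^esub> t x)"
      by (rule M.add.finprod_cong') (use cc dc A t in \<open>auto simp: fadd_def M.smult_l_distr\<close>)
    also have "\<dots> = (\<Oplus>\<^bsub>M\<^esub>x\<in>?A. c x \<odot>\<^bsub>M\<^esub> t x) \<oplus>\<^bsub>M\<^esub> (\<Oplus>\<^bsub>M\<^esub>x\<in>?A. d x \<odot>\<^bsub>M\<^esub> t x)"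
      by (rule M.finsum_addf) (use cc dc A t in auto)
    finally show "feval M t (fadd R c d) = feval M t c \<oplus>\<^bsub>M\<^esub> feval M t d"
      using on[OF c fin _ A] on[OF d fin _ A] by simp
  qed
qed

lemma feval_delta:
  assumes M: "Module.module R M" and t: "t x \<in> carrier M"
  shows "feval M t (fdelta R x) = t x"
proof -
  interpret M: Module.module R M by fact
  show ?thesis
  proof (cases "\<one> = \<zero>")
    \<comment> \<open>Over the zero ring \<open>fdelta R x\<close> has empty support, but then every
      module is zero as well.\<close>
    case True
    then have "t x = \<zero>\<^bsub>M\<^esub>" using t M.smult_one[OF t] M.smult_l_null[OF t] by simp
    moreover have "{y. fdelta R x y \<noteq> \<zero>} = {}" using True by (auto simp: fdelta_def)
    ultimately show ?thesis by (simp add: feval_def)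
  next
    case False
    then have "{y. fdelta R x y \<noteq> \<zero>} = {x}" by (auto simp: fdelta_def)
    then show ?thesis using t by (simp add: feval_def fdelta_def)
  qed
qed

end

section \<open>Cosets and quotient modules\<close>

context cring begin

lemma fadd_assoc: "\<lbrakk>c \<in> fsupp R S; d \<in> fsupp R S; e \<in> fsupp R S\<rbrakk> \<Longrightarrow> fadd R (fadd R c d) e = fadd R c (fadd R d e)"
  by (rule ext) (simp add: fadd_def fsuppD a_assoc)

lemma fadd_comm: "\<lbrakk>c \<in> fsupp R S; d \<in> fsupp R S\<rbrakk> \<Longrightarrow> fadd R c d = fadd R d c"
  by (rule ext) (simp add: fadd_def fsuppD a_comm)

lemma fadd_zero: "c \<in> fsupp R S \<Longrightarrow> fadd R c (fzero R) = c" "c \<in> fsupp R S \<Longrightarrow> fadd R (fzero R) c = c"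
  by (rule ext, simp add: fadd_def fzero_def fsuppD)+

lemma fadd_neg: "c \<in> fsupp R S \<Longrightarrow> fadd R c (fneg R c) = fzero R"
  by (rule ext) (simp add: fadd_def fzero_def fneg_def fsuppD r_neg)

lemma fadd_swap: "\<lbrakk>c \<in> fsupp R S; x \<in> fsupp R S; d \<in> fsupp R S; y \<in> fsupp R S\<rbrakk> \<Longrightarrow>
  fadd R (fadd R c x) (fadd R d y) = fadd R (fadd R c d) (fadd R x y)"
  by (rule ext) (simp add: fadd_def fsuppD a_ac)

lemma fsmult_fadd: "\<lbrakk>a \<in> carrier R; c \<in> fsupp R S; x \<in> fsupp R S\<rbrakk> \<Longrightarrow>
  fsmult R a (fadd R c x) = fadd R (fsmult R a c) (fsmult R a x)"
  by (rule ext) (simp add: fadd_def fsmult_def fsuppD r_distr)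

lemma coset_zero:
  assumes N: "fsubspace S N" shows "coset_of R N (fzero R) = N"
proof -
  have "fadd R (fzero R) x = x" if "x \<in> N" for x by (rule fadd_zero(2)[OF fsubspaceD(1)[OF N that]])
  then show ?thesis unfolding coset_of_def by force
qed

lemma coset_self: "fsubspace S N \<Longrightarrow> c \<in> fsupp R S \<Longrightarrow> c \<in> coset_of R N c"
  unfolding coset_of_def using fsubspaceD(2)[of S N] fadd_zero(1)[of c S] by force

lemma coset_absorb:
  assumes N: "fsubspace S N" and c: "c \<in> fsupp R S" and x: "x \<in> N"
  shows "coset_of R N (fadd R c x) = coset_of R N c"
proof -
  note N' = fsubspaceD[OF N]
  have xs: "x \<in> fsupp R S" by (rule N'(1)[OF x])
  show ?thesis
  proof (rule Set.set_eqI, rule iffI)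
    fix e assume "e \<in> coset_of R N (fadd R c x)"
    then obtain y where y: "y \<in> N" "e = fadd R (fadd R c x) y" by (auto simp: coset_of_def)
    then have "e = fadd R c (fadd R x y)" using fadd_assoc[OF c xs N'(1)[OF y(1)]] by simp
    then show "e \<in> coset_of R N c" using N'(3)[OF x y(1)] by (auto simp: coset_of_def)
  next
    fix e assume "e \<in> coset_of R N c"
    then obtain y where y: "y \<in> N" "e = fadd R c y" by (auto simp: coset_of_def)
    have ys: "y \<in> fsupp R S" by (rule N'(1)[OF y(1)])
    have ns: "fneg R x \<in> fsupp R S" by (rule fneg_in[OF xs])
    have "e = fadd R (fadd R c x) (fadd R y (fneg R x))"
      using y fadd_swap[OF c xs ys ns] fadd_neg[OF xs] fadd_zero(1)[OF fadd_in[OF c ys]] by simp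
    then show "e \<in> coset_of R N (fadd R c x)" using N'(3)[OF y(1) N'(5)[OF x]] by (auto simp: coset_of_def)
  qed
qed

lemma coset_eqD:
  assumes N: "fsubspace S N" and c: "c \<in> fsupp R S" and e: "coset_of R N c = N"
  shows "c \<in> N"
  using coset_self[OF N c] e by simp

lemma coset_memE:
  assumes N: "fsubspace S N" and c: "c \<in> fsupp R S" and d: "d \<in> coset_of R N c"
  shows "d \<in> fsupp R S \<and> coset_of R N d = coset_of R N c \<and> (\<exists>x\<in>N. d = fadd R c x)"
proof -
  obtain x where x: "x \<in> N" "d = fadd R c x" using d by (auto simp: coset_of_def)
  then show ?thesis using coset_absorb[OF N c x(1)] fadd_in[OF c fsubspaceD(1)[OF N x(1)]] by auto
qed

lemma coset_in_N: "fsubspace S N \<Longrightarrow> c \<in> N \<Longrightarrow> coset_of R N c = N"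
  using coset_absorb[of S N "fzero R" c] fzero_in[of S] coset_zero[of S N] fadd_zero(2)[of c S] fsubspaceD(1)[of S N c]
  by simp

lemma add_coset:
  assumes N: "fsubspace S N" and c: "c \<in> fsupp R S" and d: "d \<in> fsupp R S"
  shows "{fadd R a b | a b. a \<in> coset_of R N c \<and> b \<in> coset_of R N d} = coset_of R N (fadd R c d)" (is "?L = ?R")
proof (rule Set.set_eqI, rule iffI)
  note N' = fsubspaceD[OF N]
  fix e assume "e \<in> ?L"
  then obtain x y where xy: "x \<in> N" "y \<in> N" "e = fadd R (fadd R c x) (fadd R d y)" by (auto simp: coset_of_def)
  then have "e = fadd R (fadd R c d) (fadd R x y)" using fadd_swap[OF c N'(1) d N'(1)] by simp
  then show "e \<in> ?R" using N'(3)[OF xy(1,2)] by (auto simp: coset_of_def)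
next
  note N' = fsubspaceD[OF N]
  fix e assume "e \<in> ?R"
  then obtain x where x: "x \<in> N" "e = fadd R (fadd R c d) x" by (auto simp: coset_of_def)
  then have "e = fadd R c (fadd R d x)" using fadd_assoc[OF c d N'(1)] by simp
  moreover have "fadd R d x \<in> coset_of R N d" using x by (auto simp: coset_of_def)
  ultimately show "e \<in> ?L" using coset_self[OF N c] by blast
qed

text \<open>The map induced by \<open>L\<close> on quotients, acting on cosets as sets; adding all
  of \<open>N'\<close> completes the image of a coset to a full coset.\<close>

definition fmap :: "(('x \<Rightarrow> 'a) \<Rightarrow> 'y \<Rightarrow> 'a) \<Rightarrow> ('y \<Rightarrow> 'a) set \<Rightarrow> ('x \<Rightarrow> 'a) set \<Rightarrow> ('y \<Rightarrow> 'a) set" where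
  "fmap L N' A = {fadd R (L c) x | c x. c \<in> A \<and> x \<in> N'}"

lemma fmap_coset:
  assumes N: "fsubspace S N" and N': "fsubspace S' N'" and L: "flinear S S' L"
    and LN: "\<And>x. x \<in> N \<Longrightarrow> L x \<in> N'" and c: "c \<in> fsupp R S"
  shows "fmap L N' (coset_of R N c) = coset_of R N' (L c)"
proof (rule Set.set_eqI, rule iffI)
  note Ns = fsubspaceD(1)[OF N] and Ns' = fsubspaceD(1)[OF N'] and L' = flinearD[OF L]
  fix e assume "e \<in> fmap L N' (coset_of R N c)"
  then obtain y x where xy: "y \<in> N" "x \<in> N'" "e = fadd R (L (fadd R c y)) x" by (auto simp: coset_of_def fmap_def)
  then have "e = fadd R (L c) (fadd R (L y) x)"
    using L'(2)[OF c Ns[OF xy(1)]] fadd_assoc[OF L'(1)[OF c] L'(1)[OF Ns[OF xy(1)]] Ns'[OF xy(2)]] by simp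
  then show "e \<in> coset_of R N' (L c)" using fsubspaceD(3)[OF N' LN[OF xy(1)] xy(2)] by (auto simp: coset_of_def)
next
  fix e assume "e \<in> coset_of R N' (L c)"
  then show "e \<in> fmap L N' (coset_of R N c)" using coset_self[OF N c] by (auto simp: coset_of_def fmap_def)
qed

lemma fsmult_linear: "a \<in> carrier R \<Longrightarrow> flinear S S (fsmult R a)"
  by (rule flinearI) (simp_all add: fsmult_in fsmult_fadd, simp add: fsmult_def fsuppD m_lcomm)

lemma smult_coset:
  assumes N: "fsubspace S N" and c: "c \<in> fsupp R S" and a: "a \<in> carrier R"
  shows "{fadd R (fsmult R a c') x | c' x. c' \<in> coset_of R N c \<and> x \<in> N} = coset_of R N (fsmult R a c)"
  using fmap_coset[OF N N fsmult_linear[OF a] _ c] fsubspaceD(4)[OF N a] by (simp add: fmap_def)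

text \<open>The record of \<open>freeM_space\<close> over an arbitrary subspace, kept in the same
  form so that \<open>space_eq\<close> is a matter of unfolding.\<close>

definition fquot :: "'x set \<Rightarrow> ('x \<Rightarrow> 'a) set \<Rightarrow> ('a, ('x \<Rightarrow> 'a) set) module" where
  "fquot S N = \<lparr>carrier = {coset_of R N c | c. c \<in> fsupp R S}, mult = undefined, one = undefined, zero = N,
       add = (\<lambda>A B. {fadd R a b | a b. a \<in> A \<and> b \<in> B}),
       smult = (\<lambda>a A. {fadd R (fsmult R a c) x | c x. c \<in> A \<and> x \<in> N})\<rparr>"

lemma fquot_carrier: "carrier (fquot S N) = coset_of R N ` fsupp R S" "zero (fquot S N) = N"
  by (auto simp: fquot_def)

lemma fquot_ops:
  assumes N: "fsubspace S N" and c: "c \<in> fsupp R S"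
  shows "d \<in> fsupp R S \<Longrightarrow> coset_of R N c \<oplus>\<^bsub>fquot S N\<^esub> coset_of R N d = coset_of R N (fadd R c d)"
    "a \<in> carrier R \<Longrightarrow> a \<odot>\<^bsub>fquot S N\<^esub> coset_of R N c = coset_of R N (fsmult R a c)"
  using add_coset[OF N c] smult_coset[OF N c] by (simp_all add: fquot_def)

lemma fquot_module:
  assumes N: "fsubspace S N" shows "Module.module R (fquot S N)"
proof (rule moduleI)
  note ops = fquot_ops[OF N]
  show "cring R" by (rule is_cring)
  show "abelian_group (fquot S N)"
  proof (rule abelian_groupI; unfold fquot_carrier)
    show "N \<in> coset_of R N ` fsupp R S" using coset_zero[OF N] fzero_in by blast
    fix A B C assume "A \<in> coset_of R N ` fsupp R S"
    then obtain c where c: "c \<in> fsupp R S" "A = coset_of R N c" by blast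
    have "N \<oplus>\<^bsub>fquot S N\<^esub> A = coset_of R N (fzero R) \<oplus>\<^bsub>fquot S N\<^esub> A" using coset_zero[OF N] by simp
    also have "\<dots> = A" using ops(1)[OF fzero_in c(1)] fadd_zero(2)[OF c(1)] c(2) by simp
    finally show "N \<oplus>\<^bsub>fquot S N\<^esub> A = A" .
    have "coset_of R N (fneg R c) \<oplus>\<^bsub>fquot S N\<^esub> A = N"
      using ops(1)[OF fneg_in[OF c(1)] c(1)] fadd_comm[OF c(1) fneg_in[OF c(1)]] fadd_neg[OF c(1)] c(2) coset_zero[OF N] by simp
    then show "\<exists>B\<in>coset_of R N ` fsupp R S. B \<oplus>\<^bsub>fquot S N\<^esub> A = N" using fneg_in[OF c(1)] by blast
    assume "B \<in> coset_of R N ` fsupp R S"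
    then obtain d where d: "d \<in> fsupp R S" "B = coset_of R N d" by blast
    show "A \<oplus>\<^bsub>fquot S N\<^esub> B \<in> coset_of R N ` fsupp R S" using ops(1)[OF c(1) d(1)] c d fadd_in[OF c(1) d(1)] by simp
    show "A \<oplus>\<^bsub>fquot S N\<^esub> B = B \<oplus>\<^bsub>fquot S N\<^esub> A"
      using ops(1)[OF c(1) d(1)] ops(1)[OF d(1) c(1)] c d fadd_comm[OF c(1) d(1)] by simp
    assume "C \<in> coset_of R N ` fsupp R S"
    then obtain e where e: "e \<in> fsupp R S" "C = coset_of R N e" by blast
    show "A \<oplus>\<^bsub>fquot S N\<^esub> B \<oplus>\<^bsub>fquot S N\<^esub> C = A \<oplus>\<^bsub>fquot S N\<^esub> (B \<oplus>\<^bsub>fquot S N\<^esub> C)"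
      using ops(1)[OF c(1) d(1)] ops(1)[OF d(1) e(1)] ops(1)[OF fadd_in[OF c(1) d(1)] e(1)]
        ops(1)[OF c(1) fadd_in[OF d(1) e(1)]] fadd_assoc[OF c(1) d(1) e(1)] c d e by simp
  qed
next
  note ops = fquot_ops[OF N]
  fix a b A B assume a: "a \<in> carrier R" and "A \<in> carrier (fquot S N)"
  then obtain c where c: "c \<in> fsupp R S" "A = coset_of R N c" unfolding fquot_carrier by blast
  note cc = fsuppD(1)[OF c(1)]
  have ac: "fsmult R a c \<in> fsupp R S" by (rule fsmult_in[OF c(1) a])
  show "a \<odot>\<^bsub>fquot S N\<^esub> A \<in> carrier (fquot S N)" unfolding fquot_carrier
    using ops(2)[OF c(1) a] c ac by simp
  show "(a \<oplus> b) \<odot>\<^bsub>fquot S N\<^esub> A = a \<odot>\<^bsub>fquot S N\<^esub> A \<oplus>\<^bsub>fquot S N\<^esub> b \<odot>\<^bsub>fquot S N\<^esub> A" if b: "b \<in> carrier R"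
  proof -
    have "fsmult R (a \<oplus> b) c = fadd R (fsmult R a c) (fsmult R b c)"
      by (rule ext) (simp add: fsmult_def fadd_def cc a b l_distr)
    then show ?thesis using ops(2)[OF c(1)] a b ops(1)[OF ac fsmult_in[OF c(1) b]] c by simp
  qed
  show "(a \<otimes> b) \<odot>\<^bsub>fquot S N\<^esub> A = a \<odot>\<^bsub>fquot S N\<^esub> (b \<odot>\<^bsub>fquot S N\<^esub> A)" if b: "b \<in> carrier R"
  proof -
    have "fsmult R (a \<otimes> b) c = fsmult R a (fsmult R b c)"
      by (rule ext) (simp add: fsmult_def cc a b m_assoc)
    then show ?thesis using ops(2)[OF c(1)] ops(2)[OF fsmult_in[OF c(1) b] a] a b c by simp
  qed
  show "a \<odot>\<^bsub>fquot S N\<^esub> (A \<oplus>\<^bsub>fquot S N\<^esub> B) = a \<odot>\<^bsub>fquot S N\<^esub> A \<oplus>\<^bsub>fquot S N\<^esub> a \<odot>\<^bsub>fquot S N\<^esub> B"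
    if B: "B \<in> carrier (fquot S N)"
  proof -
    obtain d where d: "d \<in> fsupp R S" "B = coset_of R N d" using B unfolding fquot_carrier by blast
    show ?thesis using ops(1)[OF c(1) d(1)] ops(2)[OF c(1) a] ops(2)[OF d(1) a] ops(2)[OF fadd_in[OF c(1) d(1)] a]
      ops(1)[OF ac fsmult_in[OF d(1) a]] fsmult_fadd[OF a c(1) d(1)] c d by simp
  qed
next
  fix A assume "A \<in> carrier (fquot S N)"
  then obtain c where c: "c \<in> fsupp R S" "A = coset_of R N c" unfolding fquot_carrier by blast
  have "fsmult R \<one> c = c" by (rule ext) (simp add: fsmult_def fsuppD(1)[OF c(1)])
  then show "\<one> \<odot>\<^bsub>fquot S N\<^esub> A = A" using fquot_ops(2)[OF N c(1) one_closed] c by simp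
qed

lemma fmap_klinear:
  assumes N: "fsubspace S N" and N': "fsubspace S' N'" and L: "flinear S S' L"
    and LN: "\<And>x. x \<in> N \<Longrightarrow> L x \<in> N'"
  shows "klinear R (fquot S N) (fquot S' N') (fmap L N')"
  unfolding klinear_def
proof (intro conjI ballI funcsetI)
  note L' = flinearD[OF L]
  have fm: "fmap L N' (coset_of R N c) = coset_of R N' (L c)" if "c \<in> fsupp R S" for c
    by (rule fmap_coset[OF N N' L _ that]) (rule LN)
  fix A assume "A \<in> carrier (fquot S N)"
  then obtain c where c: "c \<in> fsupp R S" "A = coset_of R N c" unfolding fquot_carrier by blast
  show "fmap L N' A \<in> carrier (fquot S' N')" unfolding c(2) fm[OF c(1)] fquot_carrier using L'(1)[OF c(1)] by blast
  show "fmap L N' (a \<odot>\<^bsub>fquot S N\<^esub> A) = a \<odot>\<^bsub>fquot S' N'\<^esub> fmap L N' A" if a: "a \<in> carrier R" for a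
    unfolding c(2) fquot_ops(2)[OF N c(1) a] fm[OF c(1)] fm[OF fsmult_in[OF c(1) a]] fquot_ops(2)[OF N' L'(1)[OF c(1)] a]
    using L'(3)[OF a c(1)] by simp
  fix B assume "B \<in> carrier (fquot S N)"
  then obtain d where d: "d \<in> fsupp R S" "B = coset_of R N d" unfolding fquot_carrier by blast
  show "fmap L N' (A \<oplus>\<^bsub>fquot S N\<^esub> B) = fmap L N' A \<oplus>\<^bsub>fquot S' N'\<^esub> fmap L N' B"
    unfolding c(2) d(2) fquot_ops(1)[OF N c(1) d(1)] fm[OF c(1)] fm[OF d(1)] fm[OF fadd_in[OF c(1) d(1)]]
      fquot_ops(1)[OF N' L'(1)[OF c(1)] L'(1)[OF d(1)]]
    using L'(2)[OF c(1) d(1)] by simp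
qed

end

section \<open>Category laws and left cancellation in FI_G\<close>

lemma fig_comp_assoc:
  assumes G: "group G" and "\<phi> \<in> fig_hom G n m" "\<psi> \<in> fig_hom G s n" "\<chi> \<in> fig_hom G r s"
  shows "fig_comp G r \<phi> (fig_comp G r \<psi> \<chi>) = fig_comp G r (fig_comp G s \<phi> \<psi>) \<chi>"
proof -
  interpret group G by fact
  obtain f1 g1 where e1: "\<phi> = (f1, g1)" by (cases \<phi>)
  obtain f2 g2 where e2: "\<psi> = (f2, g2)" by (cases \<psi>)
  obtain f3 g3 where e3: "\<chi> = (f3, g3)" by (cases \<chi>)
  note h1 = fig_homD[OF assms(2)[unfolded e1]] and h2 = fig_homD[OF assms(3)[unfolded e2]]
    and h3 = fig_homD[OF assms(4)[unfolded e3]]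
  show ?thesis unfolding e1 e2 e3 fig_comp_pair
    by (rule restrict_pair_eqI) (simp_all add: h1(1,3) h2(1,3) h3(1,3) m_assoc del: atLeastAtMost_iff One_nat_def)
qed

lemma fig_comp_id:
  assumes G: "group G" and "\<phi> \<in> fig_hom G n m"
  shows "fig_comp G n \<phi> (fig_id G n) = \<phi>" "fig_comp G n (fig_id G m) \<phi> = \<phi>"
proof -
  interpret group G by fact
  obtain f g where e: "\<phi> = (f, g)" by (cases \<phi>)
  note h = fig_homD[OF assms(2)[unfolded e]]
  have "fig_comp G n \<phi> (fig_id G n) = (restrict f {1..n}, restrict g {1..n})"
    unfolding e fig_comp_pair fig_id_def
    by (rule restrict_pair_eqI) (simp_all add: h(1,3) del: atLeastAtMost_iff One_nat_def)
  then show "fig_comp G n \<phi> (fig_id G n) = \<phi>" using h(4,5) e by simp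
  have "fig_comp G n (fig_id G m) \<phi> = (restrict f {1..n}, restrict g {1..n})"
    unfolding e fig_comp_pair fig_id_def
    by (rule restrict_pair_eqI) (simp_all add: h(1,3) del: atLeastAtMost_iff One_nat_def)
  then show "fig_comp G n (fig_id G m) \<phi> = \<phi>" using h(4,5) e by simp
qed

text \<open>The underlying maps agree because \<open>f1\<close> is injective; after that the labels
  agree by cancelling the common right factor in \<open>G\<close>.\<close>

lemma fig_comp_left_cancel:
  assumes G: "group G" and "\<psi> \<in> fig_hom G n m" "\<phi> \<in> fig_hom G r n" "\<chi> \<in> fig_hom G r n"
    and eq: "fig_comp G r \<psi> \<phi> = fig_comp G r \<psi> \<chi>"
  shows "\<phi> = \<chi>"
proof -
  interpret group G by fact
  obtain f1 g1 where e1: "\<psi> = (f1, g1)" by (cases \<psi>)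
  obtain f2 g2 where e2: "\<phi> = (f2, g2)" by (cases \<phi>)
  obtain f3 g3 where e3: "\<chi> = (f3, g3)" by (cases \<chi>)
  note h1 = fig_homD[OF assms(2)[unfolded e1]] and h2 = fig_homD[OF assms(3)[unfolded e2]]
    and h3 = fig_homD[OF assms(4)[unfolded e3]]
  have f: "f2 i = f3 i" if i: "i \<in> {1..r}" for i
  proof -
    have "(\<lambda>x\<in>{1..r}. f1 (f2 x)) i = (\<lambda>x\<in>{1..r}. f1 (f3 x)) i" using eq unfolding e1 e2 e3 fig_comp_pair by simp
    then have "f1 (f2 i) = f1 (f3 i)" using i by simp
    then show ?thesis by (rule inj_onD[OF h1(2) _ h2(1)[OF i] h3(1)[OF i]])
  qed
  have "g2 i = g3 i" if i: "i \<in> {1..r}" for i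
  proof -
    have "(\<lambda>x\<in>{1..r}. g2 x \<otimes>\<^bsub>G\<^esub> g1 (f2 x)) i = (\<lambda>x\<in>{1..r}. g3 x \<otimes>\<^bsub>G\<^esub> g1 (f3 x)) i"
      using eq unfolding e1 e2 e3 fig_comp_pair by simp
    then have "g2 i \<otimes>\<^bsub>G\<^esub> g1 (f2 i) = g3 i \<otimes>\<^bsub>G\<^esub> g1 (f2 i)" using i f[OF i] by simp
    then show ?thesis using h1(3)[OF h2(1)[OF i]] h2(3)[OF i] h3(3)[OF i] by simp
  qed
  with f have "(restrict f2 {1..r}, restrict g2 {1..r}) = (restrict f3 {1..r}, restrict g3 {1..r})"
    by (intro restrict_pair_eqI)
  then show ?thesis using h2(4,5) h3(4,5) e2 e3 by simp
qed

context cring begin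

text \<open>This lemma and the next two carry the three shapes of relation in
  \<open>tens_rels\<close> through a linear map.\<close>

lemma flinear_rel_add:
  assumes "flinear S S' L" "c \<in> fsupp R S" "d \<in> fsupp R S" "e \<in> fsupp R S"
  shows "L (fadd R c (fneg R (fadd R d e))) = fadd R (L c) (fneg R (fadd R (L d) (L e)))"
  using flinearD(2)[OF assms(1,2) fneg_in[OF fadd_in[OF assms(3,4)]]]
    flinear_neg[OF assms(1) fadd_in[OF assms(3,4)]] flinearD(2)[OF assms(1,3,4)] by simp

lemma flinear_rel_smult:
  assumes "flinear S S' L" "c \<in> fsupp R S" "d \<in> fsupp R S" "a \<in> carrier R"
  shows "L (fadd R c (fneg R (fsmult R a d))) = fadd R (L c) (fneg R (fsmult R a (L d)))"
  using flinearD(2)[OF assms(1,2) fneg_in[OF fsmult_in[OF assms(3,4)]]]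
    flinear_neg[OF assms(1) fsmult_in[OF assms(3,4)]] flinearD(3)[OF assms(1,4,3)] by simp

lemma flinear_rel_bal:
  assumes "flinear S S' L" "c \<in> fsupp R S" "d \<in> fsupp R S"
  shows "L (fadd R c (fneg R d)) = fadd R (L c) (fneg R (L d))"
  using flinearD(2)[OF assms(1,2) fneg_in[OF assms(3)]] flinear_neg[OF assms(1,3)] by simp

lemma fneg_zero: "fneg R (fzero R) = fzero R"
  by (simp add: fneg_def fzero_def)

lemma fsmult_zero: "a \<in> carrier R \<Longrightarrow> fsmult R a (fzero R) = fzero R"
  by (simp add: fsmult_def fzero_def)

end

section \<open>The FI_G-module M(W)\<close>

locale free_fig =
  fixes G :: "('g,'b) monoid_scheme" and R :: "('k,'a) ring_scheme" and r :: nat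
    and W :: "('k,'w) module" and wact :: "'g fimor \<Rightarrow> 'w \<Rightarrow> 'w"
  assumes G: "group G" and R: "cring R" and W: "kGr_module G R r W wact"
begin

sublocale R: cring R by (rule R)

abbreviation S :: "nat \<Rightarrow> ('g fimor \<times> 'w) set" where "S n \<equiv> fig_hom G r n \<times> carrier W"
abbreviation N :: "nat \<Rightarrow> ('g fimor \<times> 'w \<Rightarrow> 'k) set" where "N n \<equiv> freeM_rel G R r W wact n"

lemma W_module: "Module.module R W" using W by (simp add: kGr_module_def)

lemma wact_klinear: "\<sigma> \<in> fig_hom G r r \<Longrightarrow> klinear R W W (wact \<sigma>)"
  using W by (simp add: kGr_module_def)

lemma wact_closed: "\<sigma> \<in> fig_hom G r r \<Longrightarrow> w \<in> carrier W \<Longrightarrow> wact \<sigma> w \<in> carrier W"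
  using wact_klinear unfolding klinear_def by blast

lemma W_closed: "w \<in> carrier W \<Longrightarrow> w' \<in> carrier W \<Longrightarrow> w \<oplus>\<^bsub>W\<^esub> w' \<in> carrier W"
  "a \<in> carrier R \<Longrightarrow> w \<in> carrier W \<Longrightarrow> a \<odot>\<^bsub>W\<^esub> w \<in> carrier W"
proof -
  interpret Module.module R W by (rule W_module)
  show "w \<in> carrier W \<Longrightarrow> w' \<in> carrier W \<Longrightarrow> w \<oplus>\<^bsub>W\<^esub> w' \<in> carrier W"
    "a \<in> carrier R \<Longrightarrow> w \<in> carrier W \<Longrightarrow> a \<odot>\<^bsub>W\<^esub> w \<in> carrier W" by simp_all
qed

lemma delta_in: "\<phi> \<in> fig_hom G r n \<Longrightarrow> w \<in> carrier W \<Longrightarrow> fdelta R (\<phi>, w) \<in> fsupp R (S n)"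
  by (rule R.fdelta_in) simp

lemma rels_cases:
  assumes "x \<in> tens_rels G R r W wact n"
  obtains (add) \<phi> w w' where "x = fadd R (fdelta R (\<phi>, w \<oplus>\<^bsub>W\<^esub> w')) (fneg R (fadd R (fdelta R (\<phi>, w)) (fdelta R (\<phi>, w'))))"
      "\<phi> \<in> fig_hom G r n" "w \<in> carrier W" "w' \<in> carrier W"
    | (smult) \<phi> a w where "x = fadd R (fdelta R (\<phi>, a \<odot>\<^bsub>W\<^esub> w)) (fneg R (fsmult R a (fdelta R (\<phi>, w))))"
      "\<phi> \<in> fig_hom G r n" "a \<in> carrier R" "w \<in> carrier W"
    | (bal) \<phi> \<sigma> w where "x = fadd R (fdelta R (fig_comp G r \<phi> \<sigma>, w)) (fneg R (fdelta R (\<phi>, wact \<sigma> w)))"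
      "\<phi> \<in> fig_hom G r n" "\<sigma> \<in> fig_hom G r r" "w \<in> carrier W"
  using assms unfolding tens_rels_def by (elim UnE CollectE exE conjE) (rule add smult bal; assumption)+

lemma rels_sub: "tens_rels G R r W wact n \<subseteq> fsupp R (S n)"
proof
  fix x assume "x \<in> tens_rels G R r W wact n"
  then show "x \<in> fsupp R (S n)"
  proof (cases rule: rels_cases)
    case (add \<phi> w w') then show ?thesis
      by (auto intro!: R.fadd_in R.fneg_in delta_in W_closed)
  next
    case (smult \<phi> a w) then show ?thesis
      by (auto intro!: R.fadd_in R.fneg_in R.fsmult_in delta_in W_closed)
  next
    case (bal \<phi> \<sigma> w) then show ?thesis
      by (auto intro!: R.fadd_in R.fneg_in delta_in wact_closed fig_hom_comp[OF G])
  qed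
qed

lemma N_sub: "R.fsubspace (S n) (N n)"
  unfolding freeM_rel_def by (rule R.fspan_subspace[OF rels_sub])

lemma rel_in:
  "\<lbrakk>\<phi> \<in> fig_hom G r n; w \<in> carrier W; w' \<in> carrier W\<rbrakk> \<Longrightarrow>
    fadd R (fdelta R (\<phi>, w \<oplus>\<^bsub>W\<^esub> w')) (fneg R (fadd R (fdelta R (\<phi>, w)) (fdelta R (\<phi>, w')))) \<in> N n"
  "\<lbrakk>\<phi> \<in> fig_hom G r n; a \<in> carrier R; w \<in> carrier W\<rbrakk> \<Longrightarrow>
    fadd R (fdelta R (\<phi>, a \<odot>\<^bsub>W\<^esub> w)) (fneg R (fsmult R a (fdelta R (\<phi>, w)))) \<in> N n"
  "\<lbrakk>\<phi> \<in> fig_hom G r n; \<sigma> \<in> fig_hom G r r; w \<in> carrier W\<rbrakk> \<Longrightarrow>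
    fadd R (fdelta R (fig_comp G r \<phi> \<sigma>, w)) (fneg R (fdelta R (\<phi>, wact \<sigma> w))) \<in> N n"
  unfolding freeM_rel_def by (rule R.fspan_base, subst tens_rels_def, blast)+

lemma space_eq: "freeM_space G R r W wact n = R.fquot (S n) (N n)"
  by (simp add: freeM_space_def R.fquot_def Let_def)

definition push :: "'g fimor \<Rightarrow> ('g fimor \<times> 'w \<Rightarrow> 'k) \<Rightarrow> 'g fimor \<times> 'w \<Rightarrow> 'k" where
  "push \<psi> = flin_ext R (\<lambda>(\<phi>, w). (fig_comp G r \<psi> \<phi>, w))"

lemma map_eq: "freeM_map G R r W wact n m \<psi> = R.fmap (push \<psi>) (N m)"
  by (rule ext) (simp add: freeM_map_def R.fmap_def push_def)

lemma push_linear: "\<psi> \<in> fig_hom G n m \<Longrightarrow> R.flinear (S n) (S m) (push \<psi>)"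
  unfolding push_def by (rule R.flin_ext_linear) (auto intro: fig_hom_comp[OF G])

lemma push_delta: "push \<psi> (fdelta R (\<phi>, w)) = fdelta R (fig_comp G r \<psi> \<phi>, w)"
  unfolding push_def by (simp add: R.flin_ext_delta)

text \<open>Composition on the left commutes with precomposition by elements of G_r, so each
  relation goes to one of the same shape.\<close>

lemma push_N:
  assumes \<psi>: "\<psi> \<in> fig_hom G n m" and x: "x \<in> N n"
  shows "push \<psi> x \<in> N m"
proof (rule R.flinear_fspan[OF push_linear[OF \<psi>] rels_sub N_sub _ x[unfolded freeM_rel_def]])
  note L = push_linear[OF \<psi>]
  fix y assume "y \<in> tens_rels G R r W wact n"
  then show "push \<psi> y \<in> N m"
  proof (cases rule: rels_cases)
    case (add \<phi> w w')
    have "push \<psi> y = fadd R (fdelta R (fig_comp G r \<psi> \<phi>, w \<oplus>\<^bsub>W\<^esub> w'))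
       (fneg R (fadd R (fdelta R (fig_comp G r \<psi> \<phi>, w)) (fdelta R (fig_comp G r \<psi> \<phi>, w'))))"
      unfolding add(1) using add
      by (subst R.flinear_rel_add[OF L]) (auto intro!: delta_in W_closed simp: push_delta)
    then show ?thesis using rel_in(1)[OF fig_hom_comp[OF G \<psi> add(2)] add(3,4)] by simp
  next
    case (smult \<phi> a w)
    have "push \<psi> y = fadd R (fdelta R (fig_comp G r \<psi> \<phi>, a \<odot>\<^bsub>W\<^esub> w)) (fneg R (fsmult R a (fdelta R (fig_comp G r \<psi> \<phi>, w))))"
      unfolding smult(1) using smult
      by (subst R.flinear_rel_smult[OF L]) (auto intro!: delta_in W_closed simp: push_delta)
    then show ?thesis using rel_in(2)[OF fig_hom_comp[OF G \<psi> smult(2)] smult(3,4)] by simp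
  next
    case (bal \<phi> \<sigma> w)
    have "push \<psi> y = fadd R (fdelta R (fig_comp G r (fig_comp G r \<psi> \<phi>) \<sigma>, w)) (fneg R (fdelta R (fig_comp G r \<psi> \<phi>, wact \<sigma> w)))"
      unfolding bal(1) using bal
      by (subst R.flinear_rel_bal[OF L])
        (auto intro!: delta_in wact_closed fig_hom_comp[OF G] simp: push_delta fig_comp_assoc[OF G \<psi>])
    then show ?thesis using rel_in(3)[OF fig_hom_comp[OF G \<psi> bal(2)] bal(3,4)] by simp
  qed
qed

lemma map_coset:
  "\<psi> \<in> fig_hom G n m \<Longrightarrow> c \<in> fsupp R (S n) \<Longrightarrow>
   freeM_map G R r W wact n m \<psi> (coset_of R (N n) c) = coset_of R (N m) (push \<psi> c)"
  unfolding map_eq by (rule R.fmap_coset[OF N_sub N_sub push_linear push_N])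

lemma push_id:
  assumes c: "c \<in> fsupp R (S n)" shows "push (fig_id G n) c = c"
  using c
proof (induction rule: R.fsupp_induct)
  note L = push_linear[OF fig_id_hom[OF G], of n]
  {
    case zero show ?case by (rule R.flinear_zero[OF L])
  next
    case (add c a x)
    obtain \<phi> w where x: "x = (\<phi>, w)" "\<phi> \<in> fig_hom G r n" using add.hyps(3) by blast
    have d: "fdelta R x \<in> fsupp R (S n)" by (rule R.fdelta_in) (rule add.hyps(3))
    have "push (fig_id G n) (fdelta R x) = fdelta R x"
      unfolding x(1) push_delta fig_comp_id(2)[OF G x(2)] ..
    then show ?case
      using R.flinearD(2)[OF L add.hyps(1) R.fsmult_in[OF d add.hyps(2)]] R.flinearD(3)[OF L add.hyps(2) d] add by simp
  }
qed

lemma push_comp: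
  assumes \<phi>: "\<phi> \<in> fig_hom G n m" and \<psi>: "\<psi> \<in> fig_hom G s n" and c: "c \<in> fsupp R (S s)"
  shows "push (fig_comp G s \<phi> \<psi>) c = push \<phi> (push \<psi> c)"
  using c
proof (induction rule: R.fsupp_induct)
  note L = push_linear[OF \<phi>] and L' = push_linear[OF \<psi>] and L'' = push_linear[OF fig_hom_comp[OF G \<phi> \<psi>]]
  {
    case zero show ?case by (simp add: R.flinear_zero[OF L] R.flinear_zero[OF L'] R.flinear_zero[OF L''])
  next
    case (add c a x)
    obtain \<chi> w where x: "x = (\<chi>, w)" "\<chi> \<in> fig_hom G r s" using add.hyps(3) by blast
    have d: "fdelta R x \<in> fsupp R (S s)" by (rule R.fdelta_in) (rule add.hyps(3))
    have "push (fig_comp G s \<phi> \<psi>) (fdelta R x) = push \<phi> (push \<psi> (fdelta R x))"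
      unfolding x(1) push_delta fig_comp_assoc[OF G \<phi> \<psi> x(2)] ..
    then show ?case
      using R.flinearD(2)[OF L'' add.hyps(1) R.fsmult_in[OF d add.hyps(2)]] R.flinearD(3)[OF L'' add.hyps(2) d]
        R.flinearD(2)[OF L' add.hyps(1) R.fsmult_in[OF d add.hyps(2)]] R.flinearD(3)[OF L' add.hyps(2) d]
        R.flinearD(2)[OF L R.flinearD(1)[OF L' add.hyps(1)] R.fsmult_in[OF R.flinearD(1)[OF L' d] add.hyps(2)]]
        R.flinearD(3)[OF L add.hyps(2) R.flinearD(1)[OF L' d]] add by simp
  }
qed

lemma freeM_is_fig_module: "is_fig_module G R (freeM G R r W wact)"
  unfolding is_fig_module_def freeM_def fig_module.simps
proof (intro conjI allI impI ballI)
  show "Module.module R (freeM_space G R r W wact n)" for n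
    unfolding space_eq by (rule R.fquot_module[OF N_sub])
  show "klinear R (freeM_space G R r W wact n) (freeM_space G R r W wact m) (freeM_map G R r W wact n m \<phi>)"
    if "\<phi> \<in> fig_hom G n m" for n m \<phi>
    unfolding space_eq map_eq by (rule R.fmap_klinear[OF N_sub N_sub push_linear[OF that] push_N[OF that]])
next
  fix n A assume "A \<in> carrier (freeM_space G R r W wact n)"
  then obtain c where c: "c \<in> fsupp R (S n)" "A = coset_of R (N n) c" unfolding space_eq R.fquot_carrier by blast
  show "freeM_map G R r W wact n n (fig_id G n) A = A"
    unfolding c(2) map_coset[OF fig_id_hom[OF G] c(1)] push_id[OF c(1)] ..
next
  fix s n m \<phi> \<psi> A
  assume \<phi>: "\<phi> \<in> fig_hom G n m" and \<psi>: "\<psi> \<in> fig_hom G s n" and "A \<in> carrier (freeM_space G R r W wact s)"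
  then obtain c where c: "c \<in> fsupp R (S s)" "A = coset_of R (N s) c" unfolding space_eq R.fquot_carrier by blast
  show "freeM_map G R r W wact s m (fig_comp G s \<phi> \<psi>) A = freeM_map G R r W wact n m \<phi> (freeM_map G R r W wact s n \<psi> A)"
    unfolding c(2) map_coset[OF fig_hom_comp[OF G \<phi> \<psi>] c(1)] map_coset[OF \<psi> c(1)]
      map_coset[OF \<phi> R.flinearD(1)[OF push_linear[OF \<psi>] c(1)]] push_comp[OF \<phi> \<psi> c(1)] ..
qed

text \<open>A left inverse of \<open>push\<close>. It respects the relations since precomposing with a unit does not affect
  whether a morphism factors through \<open>\<psi>\<close>.\<close>

definition pull :: "'g fimor \<Rightarrow> nat \<Rightarrow> ('g fimor \<times> 'w \<Rightarrow> 'k) \<Rightarrow> 'g fimor \<times> 'w \<Rightarrow> 'k" where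
  "pull \<psi> n c = (\<lambda>x. if x \<in> S n then c (fig_comp G r \<psi> (fst x), snd x) else \<zero>\<^bsub>R\<^esub>)"

lemma pull_linear:
  assumes \<psi>: "\<psi> \<in> fig_hom G n m" shows "R.flinear (S m) (S n) (pull \<psi> n)"
proof (rule R.flinearI)
  fix c assume c: "c \<in> fsupp R (S m)"
  note cc = R.fsuppD(1)[OF c]
  show "pull \<psi> n c \<in> fsupp R (S n)"
  proof (rule R.fsuppI)
    let ?j = "\<lambda>x. (fig_comp G r \<psi> (fst x), snd x)"
    \<comment> \<open>Left cancellation makes the reindexing injective, so the preimage of a finite
      support is finite.\<close>
    have "inj_on ?j (S n)"
      by (rule inj_onI) (auto dest: fig_comp_left_cancel[OF G \<psi>])
    then have "finite (?j -` {x. c x \<noteq> \<zero>\<^bsub>R\<^esub>} \<inter> S n)" by (rule finite_vimage_IntI[OF R.fsuppD(3)[OF c]])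
    then show "finite {x. pull \<psi> n c x \<noteq> \<zero>\<^bsub>R\<^esub>}"
      by (rule rev_finite_subset) (auto simp: pull_def split: if_splits)
  qed (auto simp: pull_def cc)
  show "pull \<psi> n (fsmult R a c) = fsmult R a (pull \<psi> n c)" if "a \<in> carrier R" for a
    by (rule ext) (simp add: pull_def fsmult_def that)
  fix d assume "d \<in> fsupp R (S m)"
  show "pull \<psi> n (fadd R c d) = fadd R (pull \<psi> n c) (pull \<psi> n d)"
    by (rule ext) (simp add: pull_def fadd_def)
qed

lemma pull_delta:
  assumes \<psi>: "\<psi> \<in> fig_hom G n m" and w: "w \<in> carrier W"
  shows "\<phi> \<in> fig_hom G r n \<Longrightarrow> pull \<psi> n (fdelta R (fig_comp G r \<psi> \<phi>, w)) = fdelta R (\<phi>, w)"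
    "\<phi>' \<notin> fig_comp G r \<psi> ` fig_hom G r n \<Longrightarrow> pull \<psi> n (fdelta R (\<phi>', w)) = fzero R"
proof -
  show "pull \<psi> n (fdelta R (fig_comp G r \<psi> \<phi>, w)) = fdelta R (\<phi>, w)" if \<phi>: "\<phi> \<in> fig_hom G r n"
  proof (rule ext)
    fix x :: "'g fimor \<times> 'w"
    obtain \<chi> u where x: "x = (\<chi>, u)" by (cases x)
    have "fig_comp G r \<psi> \<chi> = fig_comp G r \<psi> \<phi> \<longleftrightarrow> \<chi> = \<phi>" if "\<chi> \<in> fig_hom G r n"
      using fig_comp_left_cancel[OF G \<psi> that \<phi>] by blast
    then show "pull \<psi> n (fdelta R (fig_comp G r \<psi> \<phi>, w)) x = fdelta R (\<phi>, w) x"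
      using \<phi> w by (auto simp: x pull_def fdelta_def)
  qed
  show "pull \<psi> n (fdelta R (\<phi>', w)) = fzero R" if "\<phi>' \<notin> fig_comp G r \<psi> ` fig_hom G r n"
    using that by (auto simp: pull_def fdelta_def fzero_def intro!: ext)
qed

lemma pull_push:
  assumes \<psi>: "\<psi> \<in> fig_hom G n m" and c: "c \<in> fsupp R (S n)"
  shows "pull \<psi> n (push \<psi> c) = c"
  using c
proof (induction rule: R.fsupp_induct)
  note L = push_linear[OF \<psi>] and L' = pull_linear[OF \<psi>]
  {
    case zero show ?case by (simp add: R.flinear_zero[OF L] R.flinear_zero[OF L'])
  next
    case (add c a x)
    obtain \<chi> w where x: "x = (\<chi>, w)" "\<chi> \<in> fig_hom G r n" "w \<in> carrier W" using add.hyps(3) by blast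
    have d: "fdelta R x \<in> fsupp R (S n)" by (rule R.fdelta_in) (rule add.hyps(3))
    have "pull \<psi> n (push \<psi> (fdelta R x)) = fdelta R x"
      unfolding x(1) push_delta pull_delta(1)[OF \<psi> x(3,2)] ..
    then show ?case
      using R.flinearD(2)[OF L add.hyps(1) R.fsmult_in[OF d add.hyps(2)]] R.flinearD(3)[OF L add.hyps(2) d]
        R.flinearD(2)[OF L' R.flinearD(1)[OF L add.hyps(1)] R.fsmult_in[OF R.flinearD(1)[OF L d] add.hyps(2)]]
        R.flinearD(3)[OF L' add.hyps(2) R.flinearD(1)[OF L d]] add by simp
  }
qed

text \<open>If \<open>\<phi>\<close> factors through \<open>\<psi>\<close>, the pulled back relation
  has the same shape for the other factor; otherwise all its terms vanish.\<close>

lemma pull_N: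
  assumes \<psi>: "\<psi> \<in> fig_hom G n m" and x: "x \<in> N m"
  shows "pull \<psi> n x \<in> N n"
proof (rule R.flinear_fspan[OF pull_linear[OF \<psi>] rels_sub N_sub _ x[unfolded freeM_rel_def]])
  note L = pull_linear[OF \<psi>]
  let ?im = "fig_comp G r \<psi> ` fig_hom G r n"
  have z: "fzero R \<in> N n" by (rule R.fsubspaceD(2)[OF N_sub])
  have z0: "fadd R (fzero R) (fzero R) = (fzero R :: 'g fimor \<times> 'w \<Rightarrow> 'k)" by (rule R.fadd_zero(1)[OF R.fzero_in])
  fix y assume "y \<in> tens_rels G R r W wact m"
  then show "pull \<psi> n y \<in> N n"
  proof (cases rule: rels_cases)
    case (add \<phi> w w')
    have e: "pull \<psi> n y = fadd R (pull \<psi> n (fdelta R (\<phi>, w \<oplus>\<^bsub>W\<^esub> w')))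
       (fneg R (fadd R (pull \<psi> n (fdelta R (\<phi>, w))) (pull \<psi> n (fdelta R (\<phi>, w')))))"
      unfolding add(1) using add
      by (intro R.flinear_rel_add[OF L] delta_in W_closed)
    show ?thesis
    proof (cases "\<phi> \<in> ?im")
      case True
      then obtain \<phi>0 where p: "\<phi>0 \<in> fig_hom G r n" "\<phi> = fig_comp G r \<psi> \<phi>0" by blast
      show ?thesis unfolding e p(2) using rel_in(1)[OF p(1) add(3,4)]
        by (simp add: pull_delta(1)[OF \<psi> _ p(1)] add W_closed)
    next
      case False
      then show ?thesis unfolding e using z z0
        by (simp add: pull_delta(2)[OF \<psi>] add W_closed R.fneg_zero)
    qed
  next
    case (smult \<phi> a w)
    have e: "pull \<psi> n y = fadd R (pull \<psi> n (fdelta R (\<phi>, a \<odot>\<^bsub>W\<^esub> w))) (fneg R (fsmult R a (pull \<psi> n (fdelta R (\<phi>, w)))))"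
      unfolding smult(1) using smult
      by (intro R.flinear_rel_smult[OF L] delta_in W_closed)
    show ?thesis
    proof (cases "\<phi> \<in> ?im")
      case True
      then obtain \<phi>0 where p: "\<phi>0 \<in> fig_hom G r n" "\<phi> = fig_comp G r \<psi> \<phi>0" by blast
      show ?thesis unfolding e p(2) using rel_in(2)[OF p(1) smult(3,4)]
        by (simp add: pull_delta(1)[OF \<psi> _ p(1)] smult W_closed)
    next
      case False
      then show ?thesis unfolding e using z z0
        by (simp add: pull_delta(2)[OF \<psi>] smult W_closed R.fneg_zero R.fsmult_zero)
    qed
  next
    case (bal \<phi> \<sigma> w)
    have e: "pull \<psi> n y = fadd R (pull \<psi> n (fdelta R (fig_comp G r \<phi> \<sigma>, w))) (fneg R (pull \<psi> n (fdelta R (\<phi>, wact \<sigma> w))))"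
      unfolding bal(1) using bal
      by (intro R.flinear_rel_bal[OF L] delta_in wact_closed fig_hom_comp[OF G])
    show ?thesis
    proof (cases "\<phi> \<in> ?im")
      case True
      then obtain \<phi>0 where p: "\<phi>0 \<in> fig_hom G r n" "\<phi> = fig_comp G r \<psi> \<phi>0" by blast
      have "fig_comp G r \<phi> \<sigma> = fig_comp G r \<psi> (fig_comp G r \<phi>0 \<sigma>)"
        unfolding p(2) by (rule fig_comp_assoc[OF G \<psi> p(1) bal(3), symmetric])
      then show ?thesis unfolding e using rel_in(3)[OF p(1) bal(3,4)]
        by (simp add: p(2) pull_delta(1)[OF \<psi> _ p(1)] pull_delta(1)[OF \<psi> _ fig_hom_comp[OF G p(1) bal(3)]] bal wact_closed)
    next
      case False
      \<comment> \<open>If \<open>\<phi> \<sigma>\<close> factored through \<open>\<psi>\<close>,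
        composing with the inverse of \<open>\<sigma>\<close> would factor \<open>\<phi>\<close>. So
        the two terms of the balancing relation vanish together.\<close>
      have "fig_comp G r \<phi> \<sigma> \<notin> ?im"
      proof
        assume "fig_comp G r \<phi> \<sigma> \<in> ?im"
        then obtain \<phi>1 where p: "\<phi>1 \<in> fig_hom G r n" "fig_comp G r \<phi> \<sigma> = fig_comp G r \<psi> \<phi>1" by blast
        obtain \<tau> where t: "\<tau> \<in> fig_hom G r r" "fig_comp G r \<sigma> \<tau> = fig_id G r"
          using fig_hom_inverse[OF G bal(3)] by (elim bexE conjE)
        have "\<phi> = fig_comp G r \<phi> (fig_comp G r \<sigma> \<tau>)" unfolding t(2) fig_comp_id(1)[OF G bal(2)] ..
        also have "\<dots> = fig_comp G r (fig_comp G r \<phi> \<sigma>) \<tau>" by (rule fig_comp_assoc[OF G bal(2,3) t(1)])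
        also have "\<dots> = fig_comp G r \<psi> (fig_comp G r \<phi>1 \<tau>)"
          unfolding p(2) by (rule fig_comp_assoc[OF G \<psi> p(1) t(1), symmetric])
        finally show False using False fig_hom_comp[OF G p(1) t(1)] by blast
      qed
      then show ?thesis unfolding e using z z0 False
        by (simp add: pull_delta(2)[OF \<psi>] bal wact_closed R.fneg_zero)
    qed
  qed
qed

text \<open>If \<open>push \<psi> c\<close> is a combination of relations, then so is
  \<open>c\<close>, being its pullback; the induced maps of M(W) are therefore injective.\<close>

lemma freeM_torsion_free:
  assumes \<psi>: "\<psi> \<in> fig_hom G n m" and A: "A \<in> carrier (fi_space (freeM G R r W wact) n)"
    and z: "fi_map (freeM G R r W wact) n m \<psi> A = \<zero>\<^bsub>fi_space (freeM G R r W wact) m\<^esub>"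
  shows "A = \<zero>\<^bsub>fi_space (freeM G R r W wact) n\<^esub>"
proof -
  obtain c where c: "c \<in> fsupp R (S n)" "A = coset_of R (N n) c"
    using A unfolding freeM_def fig_module.simps space_eq R.fquot_carrier by blast
  have "coset_of R (N m) (push \<psi> c) = N m"
    using z unfolding freeM_def fig_module.simps space_eq R.fquot_carrier c(2) map_coset[OF \<psi> c(1)] .
  then have "push \<psi> c \<in> N m" by (rule R.coset_eqD[OF N_sub R.flinearD(1)[OF push_linear[OF \<psi>] c(1)]])
  then have "c \<in> N n" using pull_N[OF \<psi>] pull_push[OF \<psi> c(1)] by metis
  then show ?thesis unfolding freeM_def fig_module.simps space_eq R.fquot_carrier c(2)
    by (rule R.coset_in_N[OF N_sub])
qed

end

section \<open>Direct sums\<close>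

lemma dsum_sel:
  "fi_space (dsum F I) = dsum_space F I"
  "fi_map (dsum F I) n m \<phi> x = (\<lambda>i\<in>I. fi_map (F i) n m \<phi> (x i))"
  "zero (dsum_space F I n) = (\<lambda>i\<in>I. \<zero>\<^bsub>fi_space (F i) n\<^esub>)"
  "x \<oplus>\<^bsub>dsum_space F I n\<^esub> y = (\<lambda>i\<in>I. x i \<oplus>\<^bsub>fi_space (F i) n\<^esub> y i)"
  "a \<odot>\<^bsub>dsum_space F I n\<^esub> x = (\<lambda>i\<in>I. a \<odot>\<^bsub>fi_space (F i) n\<^esub> x i)"
  by (simp_all add: dsum_def dsum_space_def)

lemma dsum_carrierD:
  assumes "x \<in> carrier (dsum_space F I n)"
  shows "i \<in> I \<Longrightarrow> x i \<in> carrier (fi_space (F i) n)" "restrict x I = x"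
    "finite {i\<in>I. x i \<noteq> \<zero>\<^bsub>fi_space (F i) n\<^esub>}"
  using assms by (auto simp: dsum_space_def restrict_def fun_eq_iff)

text \<open>Elements of the direct sum are \<open>undefined\<close> outside \<open>I\<close>, hence
  the \<open>restrict\<close>; \<open>A\<close> is any finite set containing the support.\<close>

lemma dsum_carrierI:
  assumes "\<And>i. i \<in> I \<Longrightarrow> x i \<in> carrier (fi_space (F i) n)" "finite A"
    "\<And>i. \<lbrakk>i \<in> I; i \<notin> A\<rbrakk> \<Longrightarrow> x i = \<zero>\<^bsub>fi_space (F i) n\<^esub>"
  shows "restrict x I \<in> carrier (dsum_space F I n)"
proof -
  have "finite {i\<in>I. restrict x I i \<noteq> \<zero>\<^bsub>fi_space (F i) n\<^esub>}"
    by (rule finite_subset[OF _ assms(2)]) (use assms(3) in auto)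
  then show ?thesis using assms(1) by (simp add: dsum_space_def)
qed

lemma dsum_eqI:
  assumes "x \<in> carrier (dsum_space F I n)" "\<And>i. i \<in> I \<Longrightarrow> y i = x i"
  shows "restrict y I = x"
  using restrict_ext[of I y x, OF assms(2)] dsum_carrierD(2)[OF assms(1)] by simp

lemma dsum_module:
  assumes R: "cring R" and F: "\<And>i. i \<in> I \<Longrightarrow> Module.module R (fi_space (F i) n)"
  shows "Module.module R (dsum_space F I n)"
proof (rule moduleI)
  have ag: "abelian_group (fi_space (F i) n)" if "i \<in> I" for i by (rule Module.module.axioms(2)[OF F[OF that]])
  have am: "abelian_monoid (fi_space (F i) n)" if "i \<in> I" for i by (rule abelian_group.axioms(1)[OF ag[OF that]])
  note zc = abelian_monoid.zero_closed[OF am] and adc = abelian_monoid.a_closed[OF am]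
    and lz = abelian_monoid.l_zero[OF am] and asc = abelian_monoid.a_assoc[OF am] and com = abelian_monoid.a_comm[OF am]
    and negc = abelian_group.a_inv_closed[OF ag] and lneg = abelian_group.l_neg[OF ag]
  show "cring R" by fact
  show "abelian_group (dsum_space F I n)"
  proof (rule abelian_groupI; unfold dsum_sel)
    show "(\<lambda>i\<in>I. \<zero>\<^bsub>fi_space (F i) n\<^esub>) \<in> carrier (dsum_space F I n)"
      by (rule dsum_carrierI[of _ _ _ _ "{}"]) (auto intro: zc)
    fix x y z assume x: "x \<in> carrier (dsum_space F I n)"
    note x' = dsum_carrierD[OF x]
    let ?X = "{i\<in>I. x i \<noteq> \<zero>\<^bsub>fi_space (F i) n\<^esub>}"
    show "(\<lambda>i\<in>I. (\<lambda>i\<in>I. \<zero>\<^bsub>fi_space (F i) n\<^esub>) i \<oplus>\<^bsub>fi_space (F i) n\<^esub> x i) = x"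
      by (rule dsum_eqI[OF x]) (simp add: lz x')
    have nx: "(\<lambda>i\<in>I. \<ominus>\<^bsub>fi_space (F i) n\<^esub> x i) \<in> carrier (dsum_space F I n)"
    proof (rule dsum_carrierI[of _ _ _ _ ?X])
      fix i assume i: "i \<in> I" "i \<notin> ?X"
      interpret abelian_group "fi_space (F i) n" by (rule ag) fact
      show "\<ominus>\<^bsub>fi_space (F i) n\<^esub> x i = \<zero>\<^bsub>fi_space (F i) n\<^esub>"
        using i l_neg[of "x i"] a_inv_closed[of "x i"] by simp
    qed (use x' negc in auto)
    have "(\<lambda>i\<in>I. (\<lambda>i\<in>I. \<ominus>\<^bsub>fi_space (F i) n\<^esub> x i) i \<oplus>\<^bsub>fi_space (F i) n\<^esub> x i) = (\<lambda>i\<in>I. \<zero>\<^bsub>fi_space (F i) n\<^esub>)"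
      by (rule restrict_ext) (simp add: lneg x')
    then show "\<exists>y\<in>carrier (dsum_space F I n). (\<lambda>i\<in>I. y i \<oplus>\<^bsub>fi_space (F i) n\<^esub> x i) = (\<lambda>i\<in>I. \<zero>\<^bsub>fi_space (F i) n\<^esub>)"
      by (rule bexI[OF _ nx])
    assume y: "y \<in> carrier (dsum_space F I n)"
    note y' = dsum_carrierD[OF y]
    show "(\<lambda>i\<in>I. x i \<oplus>\<^bsub>fi_space (F i) n\<^esub> y i) \<in> carrier (dsum_space F I n)"
    proof (rule dsum_carrierI[of _ _ _ _ "?X \<union> {i\<in>I. y i \<noteq> \<zero>\<^bsub>fi_space (F i) n\<^esub>}"])
      fix i assume i: "i \<in> I" "i \<notin> ?X \<union> {i\<in>I. y i \<noteq> \<zero>\<^bsub>fi_space (F i) n\<^esub>}"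
      then show "x i \<oplus>\<^bsub>fi_space (F i) n\<^esub> y i = \<zero>\<^bsub>fi_space (F i) n\<^esub>" using lz[OF i(1) zc[OF i(1)]] by simp
    qed (use x' y' adc in auto)
    show "(\<lambda>i\<in>I. x i \<oplus>\<^bsub>fi_space (F i) n\<^esub> y i) = (\<lambda>i\<in>I. y i \<oplus>\<^bsub>fi_space (F i) n\<^esub> x i)"
      by (rule restrict_ext) (simp add: com x' y')
    assume z: "z \<in> carrier (dsum_space F I n)"
    note z' = dsum_carrierD[OF z]
    show "(\<lambda>i\<in>I. (\<lambda>i\<in>I. x i \<oplus>\<^bsub>fi_space (F i) n\<^esub> y i) i \<oplus>\<^bsub>fi_space (F i) n\<^esub> z i)
       = (\<lambda>i\<in>I. x i \<oplus>\<^bsub>fi_space (F i) n\<^esub> (\<lambda>i\<in>I. y i \<oplus>\<^bsub>fi_space (F i) n\<^esub> z i) i)"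
      by (rule restrict_ext) (simp add: asc x' y' z')
  qed
  note smc = Module.module.smult_closed[OF F] and sr0 = Module.module.smult_r_null[OF F]
    and sld = Module.module.smult_l_distr[OF F] and srd = Module.module.smult_r_distr[OF F]
    and sas = Module.module.smult_assoc1[OF F] and s1 = Module.module.smult_one[OF F]
  fix a b x y assume a: "a \<in> carrier R" and x: "x \<in> carrier (dsum_space F I n)"
  note x' = dsum_carrierD[OF x]
  show "a \<odot>\<^bsub>dsum_space F I n\<^esub> x \<in> carrier (dsum_space F I n)" unfolding dsum_sel
    by (rule dsum_carrierI[of _ _ _ _ "{i\<in>I. x i \<noteq> \<zero>\<^bsub>fi_space (F i) n\<^esub>}"]) (use x' a smc sr0 in auto)
  show "(a \<oplus>\<^bsub>R\<^esub> b) \<odot>\<^bsub>dsum_space F I n\<^esub> x = a \<odot>\<^bsub>dsum_space F I n\<^esub> x \<oplus>\<^bsub>dsum_space F I n\<^esub> b \<odot>\<^bsub>dsum_space F I n\<^esub> x"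
    if b: "b \<in> carrier R" unfolding dsum_sel by (rule restrict_ext) (simp add: sld a b x')
  show "(a \<otimes>\<^bsub>R\<^esub> b) \<odot>\<^bsub>dsum_space F I n\<^esub> x = a \<odot>\<^bsub>dsum_space F I n\<^esub> (b \<odot>\<^bsub>dsum_space F I n\<^esub> x)"
    if b: "b \<in> carrier R" unfolding dsum_sel by (rule restrict_ext) (simp add: sas a b x')
  show "a \<odot>\<^bsub>dsum_space F I n\<^esub> (x \<oplus>\<^bsub>dsum_space F I n\<^esub> y) = a \<odot>\<^bsub>dsum_space F I n\<^esub> x \<oplus>\<^bsub>dsum_space F I n\<^esub> a \<odot>\<^bsub>dsum_space F I n\<^esub> y"
    if y: "y \<in> carrier (dsum_space F I n)"
    unfolding dsum_sel by (rule restrict_ext) (simp add: srd a x' dsum_carrierD(1)[OF y])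
next
  fix x assume x: "x \<in> carrier (dsum_space F I n)"
  show "\<one>\<^bsub>R\<^esub> \<odot>\<^bsub>dsum_space F I n\<^esub> x = x" unfolding dsum_sel
    by (rule dsum_eqI[OF x]) (simp add: Module.module.smult_one[OF F] dsum_carrierD(1)[OF x])
qed

lemma dsum_is_fig_module:
  assumes G: "group G" and R: "cring R" and F: "\<And>i. i \<in> I \<Longrightarrow> is_fig_module G R (F i)"
  shows "is_fig_module G R (dsum F I)"
  unfolding is_fig_module_def dsum_sel(1)
proof (intro conjI allI impI ballI)
  show "Module.module R (dsum_space F I n)" for n by (rule dsum_module[OF R fig_moduleD(1)[OF F]])
next
  fix n m \<phi> assume \<phi>: "\<phi> \<in> fig_hom G n m"
  note Fc = fig_moduleD(3)[OF F \<phi>] and Fa = fig_moduleD(4)[OF F \<phi>] and Fs = fig_moduleD(5)[OF F \<phi>]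
    and F0 = fi_map_zero[OF F \<phi>]
  show "klinear R (dsum_space F I n) (dsum_space F I m) (fi_map (dsum F I) n m \<phi>)"
    unfolding klinear_def
  proof (intro conjI ballI funcsetI)
    fix x assume x: "x \<in> carrier (dsum_space F I n)"
    note x' = dsum_carrierD[OF x]
    show "fi_map (dsum F I) n m \<phi> x \<in> carrier (dsum_space F I m)" unfolding dsum_sel
      by (rule dsum_carrierI[of _ _ _ _ "{i\<in>I. x i \<noteq> \<zero>\<^bsub>fi_space (F i) n\<^esub>}"]) (use x' Fc F0 in auto)
    show "fi_map (dsum F I) n m \<phi> (a \<odot>\<^bsub>dsum_space F I n\<^esub> x) = a \<odot>\<^bsub>dsum_space F I m\<^esub> fi_map (dsum F I) n m \<phi> x"
      if "a \<in> carrier R" for a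
      unfolding dsum_sel by (rule restrict_ext) (simp add: Fs x' that)
    fix y assume y: "y \<in> carrier (dsum_space F I n)"
    show "fi_map (dsum F I) n m \<phi> (x \<oplus>\<^bsub>dsum_space F I n\<^esub> y) = fi_map (dsum F I) n m \<phi> x \<oplus>\<^bsub>dsum_space F I m\<^esub> fi_map (dsum F I) n m \<phi> y"
      unfolding dsum_sel by (rule restrict_ext) (simp add: Fa x' dsum_carrierD(1)[OF y])
  qed
next
  fix n x assume x: "x \<in> carrier (dsum_space F I n)"
  show "fi_map (dsum F I) n n (fig_id G n) x = x" unfolding dsum_sel
    by (rule dsum_eqI[OF x]) (rule fig_moduleD(6)[OF F dsum_carrierD(1)[OF x]])
next
  fix r n m \<phi> \<psi> x
  assume \<phi>: "\<phi> \<in> fig_hom G n m" and \<psi>: "\<psi> \<in> fig_hom G r n" and x: "x \<in> carrier (dsum_space F I r)"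
  show "fi_map (dsum F I) r m (fig_comp G r \<phi> \<psi>) x = fi_map (dsum F I) n m \<phi> (fi_map (dsum F I) r n \<psi> x)"
    unfolding dsum_sel by (rule restrict_ext) (simp add: fig_moduleD(7)[OF F \<phi> \<psi> dsum_carrierD(1)[OF x]])
qed

lemma dsum_torsion_free:
  assumes tf: "\<And>i x. \<lbrakk>i \<in> I; x \<in> carrier (fi_space (F i) n);
      fi_map (F i) n m \<phi> x = \<zero>\<^bsub>fi_space (F i) m\<^esub>\<rbrakk> \<Longrightarrow> x = \<zero>\<^bsub>fi_space (F i) n\<^esub>"
    and x: "x \<in> carrier (fi_space (dsum F I) n)" "fi_map (dsum F I) n m \<phi> x = \<zero>\<^bsub>fi_space (dsum F I) m\<^esub>"
  shows "x = \<zero>\<^bsub>fi_space (dsum F I) n\<^esub>"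
proof -
  have xc: "x \<in> carrier (dsum_space F I n)" using x by (simp add: dsum_sel)
  have z: "x i = \<zero>\<^bsub>fi_space (F i) n\<^esub>" if i: "i \<in> I" for i
  proof (rule tf[OF i dsum_carrierD(1)[OF xc i]])
    have "(\<lambda>i\<in>I. fi_map (F i) n m \<phi> (x i)) i = (\<lambda>i\<in>I. \<zero>\<^bsub>fi_space (F i) m\<^esub>) i" using x(2) unfolding dsum_sel by simp
    then show "fi_map (F i) n m \<phi> (x i) = \<zero>\<^bsub>fi_space (F i) m\<^esub>" using i by simp
  qed
  show ?thesis unfolding dsum_sel by (rule dsum_eqI[OF xc, symmetric]) (simp add: z)
qed

section \<open>Generation of finite direct sums, and maps out of them\<close>

definition dsingle :: "('i \<Rightarrow> ('g,'k,'x) fig_module) \<Rightarrow> 'i set \<Rightarrow> nat \<Rightarrow> 'i \<Rightarrow> 'x \<Rightarrow> 'i \<Rightarrow> 'x" where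
  "dsingle F I n j A = (\<lambda>i\<in>I. if i = j then A else \<zero>\<^bsub>fi_space (F i) n\<^esub>)"

lemma dsingle_in:
  assumes F: "\<And>i. i \<in> I \<Longrightarrow> is_fig_module G R (F i)" and A: "A \<in> carrier (fi_space (F j) n)"
  shows "dsingle F I n j A \<in> carrier (fi_space (dsum F I) n)"
  unfolding dsum_sel dsingle_def
proof (rule dsum_carrierI[of _ _ _ _ "{j}"])
  fix i assume i: "i \<in> I"
  interpret abelian_group "fi_space (F i) n" by (rule fig_moduleD(2)[OF F[OF i]])
  show "(if i = j then A else \<zero>\<^bsub>fi_space (F i) n\<^esub>) \<in> carrier (fi_space (F i) n)" using A by simp
qed auto

text \<open>The elements of \<open>F j\<close> whose copy in the sum lies in \<open>W\<close> form a
  submodule of \<open>F j\<close> that contains the low degrees, hence all of \<open>F j\<close>.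
  Every element of the sum is a finite sum of such copies.\<close>

lemma gen_degree_dsum:
  assumes G: "group G" and R: "cring R" and F: "\<And>i. i \<in> I \<Longrightarrow> is_fig_module G R (F i)"
    and I: "finite I" and gen: "\<And>i. i \<in> I \<Longrightarrow> gen_degree G R (F i) N"
  shows "gen_degree G R (dsum F I) N"
  unfolding gen_degree_def
proof (intro allI impI, elim conjE)
  fix W n assume W: "fig_submodule G R (dsum F I) W" and low: "\<forall>n\<le>N. carrier (fi_space (dsum F I) n) \<subseteq> W n"
  have Ws: "submodule (W n) R (dsum_space F I n)" for n using W by (simp add: fig_submodule_def dsum_sel)
  have Wm: "(\<lambda>i\<in>I. fi_map (F i) n m \<phi> (x i)) \<in> W m" if "\<phi> \<in> fig_hom G n m" "x \<in> W n" for n m \<phi> x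
    using W that unfolding fig_submodule_def dsum_sel by blast
  note Wd = submoduleD[OF Ws]
  have single: "dsingle F I n j A \<in> W n" if j: "j \<in> I" and A: "A \<in> carrier (fi_space (F j) n)" for j A n
  proof -
    define W' where "W' n = {A \<in> carrier (fi_space (F j) n). dsingle F I n j A \<in> W n}" for n
    note Fj = fig_moduleD[OF F[OF j]]
    have "fig_submodule G R (F j) W'" unfolding fig_submodule_def
    proof (intro conjI allI impI)
      fix n
      interpret j: Module.module R "fi_space (F j) n" by (rule Fj)
      show "submodule (W' n) R (fi_space (F j) n)"
      proof (rule submodule_of_closed[OF Fj(1)])
        show "W' n \<subseteq> carrier (fi_space (F j) n)" by (auto simp: W'_def)
        have "dsingle F I n j \<zero>\<^bsub>fi_space (F j) n\<^esub> = (\<lambda>i\<in>I. \<zero>\<^bsub>fi_space (F i) n\<^esub>)"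
          unfolding dsingle_def by (rule restrict_ext) simp
        then show "\<zero>\<^bsub>fi_space (F j) n\<^esub> \<in> W' n" using Wd(2)[of n] by (simp add: W'_def dsum_sel)
        fix A assume A: "A \<in> W' n"
        show "A \<oplus>\<^bsub>fi_space (F j) n\<^esub> B \<in> W' n" if B: "B \<in> W' n" for B
        proof -
          have "dsingle F I n j (A \<oplus>\<^bsub>fi_space (F j) n\<^esub> B) = dsingle F I n j A \<oplus>\<^bsub>dsum_space F I n\<^esub> dsingle F I n j B"
            unfolding dsingle_def dsum_sel
          proof (rule restrict_ext)
            fix i assume i: "i \<in> I"
            interpret abelian_group "fi_space (F i) n" by (rule fig_moduleD(2)[OF F[OF i]])
            show "(if i = j then A \<oplus>\<^bsub>fi_space (F j) n\<^esub> B else \<zero>\<^bsub>fi_space (F i) n\<^esub>) =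
              (\<lambda>i\<in>I. if i = j then A else \<zero>\<^bsub>fi_space (F i) n\<^esub>) i \<oplus>\<^bsub>fi_space (F i) n\<^esub>
              (\<lambda>i\<in>I. if i = j then B else \<zero>\<^bsub>fi_space (F i) n\<^esub>) i" using i by simp
          qed
          then show ?thesis using A B Wd(3)[of _ n] by (simp add: W'_def)
        qed
        show "a \<odot>\<^bsub>fi_space (F j) n\<^esub> A \<in> W' n" if a: "a \<in> carrier R" for a
        proof -
          have "dsingle F I n j (a \<odot>\<^bsub>fi_space (F j) n\<^esub> A) = a \<odot>\<^bsub>dsum_space F I n\<^esub> dsingle F I n j A"
            unfolding dsingle_def dsum_sel
          proof (rule restrict_ext)
            fix i assume i: "i \<in> I"
            interpret Module.module R "fi_space (F i) n" by (rule fig_moduleD(1)[OF F[OF i]])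
            show "(if i = j then a \<odot>\<^bsub>fi_space (F j) n\<^esub> A else \<zero>\<^bsub>fi_space (F i) n\<^esub>) =
              a \<odot>\<^bsub>fi_space (F i) n\<^esub> (\<lambda>i\<in>I. if i = j then A else \<zero>\<^bsub>fi_space (F i) n\<^esub>) i" using i a by simp
          qed
          then show ?thesis using A a Wd(4)[of a _ n] by (simp add: W'_def)
        qed
      qed
    next
      fix n m \<phi> A assume \<phi>: "\<phi> \<in> fig_hom G n m" and A: "A \<in> W' n"
      have "dsingle F I m j (fi_map (F j) n m \<phi> A) = (\<lambda>i\<in>I. fi_map (F i) n m \<phi> (dsingle F I n j A i))"
        unfolding dsingle_def by (rule restrict_ext) (simp add: fi_map_zero[OF F \<phi>])
      then show "fi_map (F j) n m \<phi> A \<in> W' m" using A Wm[OF \<phi>] Fj(3)[OF \<phi>] by (simp add: W'_def)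
    qed
    moreover have "carrier (fi_space (F j) n) \<subseteq> W' n" if "n \<le> N" for n
    proof
      fix A assume A: "A \<in> carrier (fi_space (F j) n)"
      have "dsingle F I n j A \<in> carrier (fi_space (dsum F I) n)" by (rule dsingle_in[where F = F, OF _ A]) (rule F)
      then show "A \<in> W' n" using A low[rule_format, OF that] by (auto simp: W'_def)
    qed
    ultimately have "W' n = carrier (fi_space (F j) n)" using gen[OF j] unfolding gen_degree_def by blast
    then show ?thesis using A by (auto simp: W'_def)
  qed
  have "x \<in> W n" if x: "x \<in> carrier (dsum_space F I n)" for x
  proof -
    note x' = dsum_carrierD[OF x]
    have "(\<lambda>i\<in>I. if i \<in> J then x i else \<zero>\<^bsub>fi_space (F i) n\<^esub>) \<in> W n" if "finite J" "J \<subseteq> I" for J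
      using that
    proof (induction J rule: finite_induct)
      case empty show ?case using Wd(2)[of n] by (simp add: dsum_sel restrict_def)
    next
      case (insert j J)
      have j: "j \<in> I" using insert.prems by simp
      have JI: "J \<subseteq> I" using insert.prems by simp
      have eq: "(\<lambda>i\<in>I. if i \<in> insert j J then x i else \<zero>\<^bsub>fi_space (F i) n\<^esub>) =
        (\<lambda>i\<in>I. if i \<in> J then x i else \<zero>\<^bsub>fi_space (F i) n\<^esub>) \<oplus>\<^bsub>dsum_space F I n\<^esub> dsingle F I n j (x j)"
        unfolding dsum_sel dsingle_def
      proof (rule restrict_ext)
        fix i assume i: "i \<in> I"
        interpret abelian_group "fi_space (F i) n" by (rule fig_moduleD(2)[OF F[OF i]])
        show "(if i \<in> insert j J then x i else \<zero>\<^bsub>fi_space (F i) n\<^esub>) =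
          (\<lambda>i\<in>I. if i \<in> J then x i else \<zero>\<^bsub>fi_space (F i) n\<^esub>) i \<oplus>\<^bsub>fi_space (F i) n\<^esub>
          (\<lambda>i\<in>I. if i = j then x j else \<zero>\<^bsub>fi_space (F i) n\<^esub>) i"
          using i insert.hyps l_zero[OF x'(1)[OF i]] r_zero[OF x'(1)[OF i]] by auto
      qed
      show ?case unfolding eq by (rule Wd(3)[OF insert.IH[OF JI] single[OF j x'(1)[OF j]]])
    qed
    from this[OF I order_refl] have "(\<lambda>i\<in>I. if i \<in> I then x i else \<zero>\<^bsub>fi_space (F i) n\<^esub>) \<in> W n" .
    moreover have "(\<lambda>i\<in>I. if i \<in> I then x i else \<zero>\<^bsub>fi_space (F i) n\<^esub>) = x" by (rule dsum_eqI[OF x]) simp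
    ultimately show ?thesis by (simp only:)
  qed
  then show "W n = carrier (fi_space (dsum F I) n)" using Wd(1)[of n] unfolding dsum_sel by blast
qed

lemma klinear_finsum:
  assumes M: "abelian_group M" and N: "abelian_group N" and h: "klinear R M N h"
    and I: "finite I" and f: "\<And>i. i \<in> I \<Longrightarrow> f i \<in> carrier M"
  shows "h (\<Oplus>\<^bsub>M\<^esub>i\<in>I. f i) = (\<Oplus>\<^bsub>N\<^esub>i\<in>I. h (f i))"
proof -
  interpret M: abelian_group M by fact
  interpret N: abelian_group N by fact
  have hc: "h x \<in> carrier N" if "x \<in> carrier M" for x using h that unfolding klinear_def by blast
  have ha: "h (x \<oplus>\<^bsub>M\<^esub> y) = h x \<oplus>\<^bsub>N\<^esub> h y" if "x \<in> carrier M" "y \<in> carrier M" for x y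
    using h that unfolding klinear_def by blast
  have h0: "h \<zero>\<^bsub>M\<^esub> = \<zero>\<^bsub>N\<^esub>"
    using ha[OF M.zero_closed M.zero_closed] hc[OF M.zero_closed] N.add.l_cancel_one by simp
  show ?thesis using I f
  proof (induction I rule: finite_induct)
    case empty then show ?case using h0 by simp
  next
    case (insert i I)
    have fi: "f i \<in> carrier M" and fI: "f \<in> I \<rightarrow> carrier M" using insert.prems by auto
    have s: "(\<Oplus>\<^bsub>M\<^esub>i\<in>I. f i) \<in> carrier M" using fI by (rule M.finsum_closed)
    have "h (\<Oplus>\<^bsub>M\<^esub>i\<in>insert i I. f i) = h (f i) \<oplus>\<^bsub>N\<^esub> h (\<Oplus>\<^bsub>M\<^esub>i\<in>I. f i)"
      using M.finsum_insert[OF insert.hyps fI fi] ha[OF fi s] by simp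
    also have "\<dots> = (\<Oplus>\<^bsub>N\<^esub>i\<in>insert i I. h (f i))"
      using N.finsum_insert[OF insert.hyps(1,2), of "\<lambda>i. h (f i)"] fI fi hc insert.IH insert.prems by auto
    finally show ?case .
  qed
qed

lemma dsum_hom:
  assumes G: "group G" and R: "cring R" and F: "\<And>i. i \<in> I \<Longrightarrow> is_fig_module G R (F i)" and V: "is_fig_module G R V"
    and I: "finite I" and q: "\<And>i. i \<in> I \<Longrightarrow> fig_mod_hom G R (F i) V (q i)"
  shows "fig_mod_hom G R (dsum F I) V (\<lambda>n x. \<Oplus>\<^bsub>fi_space V n\<^esub>i\<in>I. q i n (x i))"
  unfolding fig_mod_hom_def dsum_sel(1)
proof (intro conjI allI impI ballI)
  fix n
  interpret V: Module.module R "fi_space V n" by (rule fig_moduleD[OF V])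
  note qc = fig_mod_homD(1)[OF q] and qa = fig_mod_homD(2)[OF q] and qs = fig_mod_homD(3)[OF q]
  show "klinear R (dsum_space F I n) (fi_space V n) (\<lambda>x. \<Oplus>\<^bsub>fi_space V n\<^esub>i\<in>I. q i n (x i))"
    unfolding klinear_def
  proof (intro conjI ballI funcsetI)
    fix x assume x: "x \<in> carrier (dsum_space F I n)"
    note x' = dsum_carrierD(1)[OF x]
    show "(\<Oplus>\<^bsub>fi_space V n\<^esub>i\<in>I. q i n (x i)) \<in> carrier (fi_space V n)"
      by (rule V.finsum_closed) (use qc x' in auto)
    show "(\<Oplus>\<^bsub>fi_space V n\<^esub>i\<in>I. q i n ((a \<odot>\<^bsub>dsum_space F I n\<^esub> x) i)) = a \<odot>\<^bsub>fi_space V n\<^esub> (\<Oplus>\<^bsub>fi_space V n\<^esub>i\<in>I. q i n (x i))"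
      if a: "a \<in> carrier R" for a
    proof -
      have "(\<Oplus>\<^bsub>fi_space V n\<^esub>i\<in>I. q i n ((a \<odot>\<^bsub>dsum_space F I n\<^esub> x) i)) = (\<Oplus>\<^bsub>fi_space V n\<^esub>i\<in>I. a \<odot>\<^bsub>fi_space V n\<^esub> q i n (x i))"
        by (rule V.add.finprod_cong') (use qc x' a in \<open>auto simp: dsum_sel qs\<close>)
      also have "\<dots> = a \<odot>\<^bsub>fi_space V n\<^esub> (\<Oplus>\<^bsub>fi_space V n\<^esub>i\<in>I. q i n (x i))"
        by (rule V.finsum_smult_ldistr[OF I a, symmetric]) (use qc x' in auto)
      finally show ?thesis .
    qed
    fix y assume y: "y \<in> carrier (dsum_space F I n)"
    note y' = dsum_carrierD(1)[OF y]
    have "(\<Oplus>\<^bsub>fi_space V n\<^esub>i\<in>I. q i n ((x \<oplus>\<^bsub>dsum_space F I n\<^esub> y) i)) = (\<Oplus>\<^bsub>fi_space V n\<^esub>i\<in>I. q i n (x i) \<oplus>\<^bsub>fi_space V n\<^esub> q i n (y i))"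
      by (rule V.add.finprod_cong') (use qc x' y' in \<open>auto simp: dsum_sel qa\<close>)
    also have "\<dots> = (\<Oplus>\<^bsub>fi_space V n\<^esub>i\<in>I. q i n (x i)) \<oplus>\<^bsub>fi_space V n\<^esub> (\<Oplus>\<^bsub>fi_space V n\<^esub>i\<in>I. q i n (y i))"
      by (rule V.finsum_addf) (use qc x' y' in auto)
    finally show "(\<Oplus>\<^bsub>fi_space V n\<^esub>i\<in>I. q i n ((x \<oplus>\<^bsub>dsum_space F I n\<^esub> y) i)) =
      (\<Oplus>\<^bsub>fi_space V n\<^esub>i\<in>I. q i n (x i)) \<oplus>\<^bsub>fi_space V n\<^esub> (\<Oplus>\<^bsub>fi_space V n\<^esub>i\<in>I. q i n (y i))" .
  qed
next
  fix n m \<phi> x assume \<phi>: "\<phi> \<in> fig_hom G n m" and x: "x \<in> carrier (dsum_space F I n)"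
  note x' = dsum_carrierD(1)[OF x]
  interpret m: abelian_group "fi_space V m" by (rule fig_moduleD[OF V])
  have k: "klinear R (fi_space V n) (fi_space V m) (fi_map V n m \<phi>)"
    using V \<phi> unfolding is_fig_module_def by blast
  have "fi_map V n m \<phi> (\<Oplus>\<^bsub>fi_space V n\<^esub>i\<in>I. q i n (x i)) = (\<Oplus>\<^bsub>fi_space V m\<^esub>i\<in>I. fi_map V n m \<phi> (q i n (x i)))"
    by (rule klinear_finsum[OF fig_moduleD(2)[OF V] fig_moduleD(2)[OF V] k I]) (rule fig_mod_homD(1)[OF q x'])
  also have "\<dots> = (\<Oplus>\<^bsub>fi_space V m\<^esub>i\<in>I. q i m (fi_map (dsum F I) n m \<phi> x i))"
    by (rule m.add.finprod_cong')
      (use fig_mod_homD(1)[OF q fig_moduleD(3)[OF F \<phi> x']] fig_mod_homD(4)[OF q \<phi> x'] in \<open>auto simp: dsum_sel\<close>)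
  finally show "(\<Oplus>\<^bsub>fi_space V m\<^esub>i\<in>I. q i m (fi_map (dsum F I) n m \<phi> x i)) = fi_map V n m \<phi> (\<Oplus>\<^bsub>fi_space V n\<^esub>i\<in>I. q i n (x i))"
    by simp
qed

text \<open>The class of \<open>(\<phi>, w)\<close> is the image under \<open>\<phi>\<close> of the
  class of the identity with \<open>w\<close>, which lives in degree \<open>r\<close>.\<close>

lemma (in free_fig) gen_degree_freeM:
  assumes "r \<le> D" shows "gen_degree G R (freeM G R r W wact) D"
  unfolding gen_degree_def
proof (intro allI impI, elim conjE)
  fix U n assume U: "fig_submodule G R (freeM G R r W wact) U"
    and low: "\<forall>n\<le>D. carrier (fi_space (freeM G R r W wact) n) \<subseteq> U n"
  have sp: "fi_space (freeM G R r W wact) n = R.fquot (S n) (N n)" for n by (simp add: freeM_def space_eq)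
  have mp: "fi_map (freeM G R r W wact) = freeM_map G R r W wact" by (simp add: freeM_def)
  have Us: "submodule (U n) R (R.fquot (S n) (N n))" for n using U unfolding fig_submodule_def sp by blast
  have Um: "freeM_map G R r W wact n m \<phi> x \<in> U m" if "\<phi> \<in> fig_hom G n m" "x \<in> U n" for n m \<phi> x
    using U that unfolding fig_submodule_def mp by blast
  have "coset_of R (N n) c \<in> U n" if c: "c \<in> fsupp R (S n)" for c
    using c
  proof (induction rule: R.fsupp_induct)
    case zero
    show ?case using submoduleD(2)[OF Us] unfolding R.coset_zero[OF N_sub] R.fquot_carrier .
  next
    case (add c a x)
    obtain \<phi> w where x: "x = (\<phi>, w)" "\<phi> \<in> fig_hom G r n" "w \<in> carrier W" using add.hyps(3) by blast
    have d: "fdelta R x \<in> fsupp R (S n)" by (rule R.fdelta_in) (rule add.hyps(3))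
    have d0: "fdelta R (fig_id G r, w) \<in> fsupp R (S r)" by (rule delta_in[OF fig_id_hom[OF G] x(3)])
    have "coset_of R (N r) (fdelta R (fig_id G r, w)) \<in> U r"
      using low[rule_format, OF assms] d0 unfolding sp R.fquot_carrier by blast
    from Um[OF x(2) this] have "coset_of R (N n) (fdelta R x) \<in> U n"
      unfolding map_coset[OF x(2) d0] push_delta fig_comp_id(1)[OF G x(2)] x(1) .
    from submoduleD(4)[OF Us add.hyps(2) this] have "coset_of R (N n) (fsmult R a (fdelta R x)) \<in> U n"
      unfolding R.fquot_ops(2)[OF N_sub d add.hyps(2)] .
    from submoduleD(3)[OF Us add.IH this] show ?case
      unfolding R.fquot_ops(1)[OF N_sub add.hyps(1) R.fsmult_in[OF d add.hyps(2)]] .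
  qed
  then have "carrier (R.fquot (S n) (N n)) \<subseteq> U n" unfolding R.fquot_carrier by blast
  then show "U n = carrier (fi_space (freeM G R r W wact) n)"
    using submoduleD(1)[OF Us, of n] unfolding sp by blast
qed

section \<open>The canonical cover\<close>

text \<open>The canonical map M(V_i) \<rightarrow> V, which evaluates
  \<open>\<phi> \<otimes> w\<close> to the image of \<open>w\<close> under \<open>\<phi>\<close>.
  V_i carries its own action of G_i, so the map is onto in degree \<open>i\<close>.\<close>

locale fig_cover =
  fixes G :: "('g,'b) monoid_scheme" and R :: "('k,'a) ring_scheme" and V :: "('g,'k,'v) fig_module" and i :: nat
  assumes cover_G: "group G" and cover_R: "cring R" and V: "is_fig_module G R V"
begin

lemma cover_kGr: "kGr_module G R i (fi_space V i) (fi_map V i i)"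
  unfolding kGr_module_def
proof (intro conjI ballI)
  show "klinear R (fi_space V i) (fi_space V i) (fi_map V i i \<sigma>)" if "\<sigma> \<in> fig_hom G i i" for \<sigma>
    using V that unfolding is_fig_module_def by blast
qed (simp_all add: fig_moduleD[OF V])

sublocale free_fig G R i "fi_space V i" "fi_map V i i"
  by (rule free_fig.intro[OF cover_G cover_R cover_kGr])

definition gen_eval :: "nat \<Rightarrow> ('g fimor \<times> 'v \<Rightarrow> 'k) \<Rightarrow> 'v" where
  "gen_eval n = R.feval (fi_space V n) (\<lambda>(\<phi>, w). fi_map V i n \<phi> w)"

lemma gen_eval_delta:
  "\<phi> \<in> fig_hom G i n \<Longrightarrow> w \<in> carrier (fi_space V i) \<Longrightarrow> gen_eval n (fdelta R (\<phi>, w)) = fi_map V i n \<phi> w"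
  unfolding gen_eval_def using R.feval_delta[OF fig_moduleD(1)[OF V], of "\<lambda>(\<phi>, w). fi_map V i n \<phi> w" "(\<phi>, w)" n] fig_moduleD(3)[OF V]
  by simp

lemma gen_eval_klinear: "klinear R (R.fspace (S n)) (fi_space V n) (gen_eval n)"
  unfolding gen_eval_def by (rule R.feval_linear[OF fig_moduleD(1)[OF V]]) (auto intro: fig_moduleD(3)[OF V])

lemma gen_eval_lin:
  "c \<in> fsupp R (S n) \<Longrightarrow> gen_eval n c \<in> carrier (fi_space V n)"
  "\<lbrakk>c \<in> fsupp R (S n); d \<in> fsupp R (S n)\<rbrakk> \<Longrightarrow> gen_eval n (fadd R c d) = gen_eval n c \<oplus>\<^bsub>fi_space V n\<^esub> gen_eval n d"
  "\<lbrakk>a \<in> carrier R; c \<in> fsupp R (S n)\<rbrakk> \<Longrightarrow> gen_eval n (fsmult R a c) = a \<odot>\<^bsub>fi_space V n\<^esub> gen_eval n c"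
  using gen_eval_klinear[of n] unfolding klinear_def R.fspace_simps by blast+

lemma gen_eval_zero: "gen_eval n (fzero R) = \<zero>\<^bsub>fi_space V n\<^esub>"
proof -
  interpret abelian_group "fi_space V n" by (rule fig_moduleD[OF V])
  have z: "(fzero R :: 'g fimor \<times> 'v \<Rightarrow> 'k) \<in> fsupp R (S n)" by (rule R.fzero_in)
  have "gen_eval n (fzero R) = gen_eval n (fzero R) \<oplus>\<^bsub>fi_space V n\<^esub> gen_eval n (fzero R)"
    using gen_eval_lin(2)[OF z z] R.fadd_zero(1)[OF z] by simp
  then show ?thesis using gen_eval_lin(1)[OF z] add.l_cancel_one by simp
qed

lemma gen_eval_neg:
  assumes c: "c \<in> fsupp R (S n)" shows "gen_eval n (fneg R c) = \<ominus>\<^bsub>fi_space V n\<^esub> gen_eval n c"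
proof -
  interpret abelian_group "fi_space V n" by (rule fig_moduleD[OF V])
  have "gen_eval n (fneg R c) \<oplus>\<^bsub>fi_space V n\<^esub> gen_eval n c = \<zero>\<^bsub>fi_space V n\<^esub>"
    using gen_eval_lin(2)[OF R.fneg_in[OF c] c] R.fadd_comm[OF c R.fneg_in[OF c]] R.fadd_neg[OF c] gen_eval_zero by simp
  then show ?thesis using minus_equality gen_eval_lin(1)[OF c] gen_eval_lin(1)[OF R.fneg_in[OF c]] by metis
qed

text \<open>Additivity and linearity relations hold in \<open>V\<close> because its maps are linear,
  and the balancing relation is functoriality for \<open>\<phi>\<close> after
  \<open>\<sigma>\<close>.\<close>

lemma gen_eval_N:
  assumes x: "x \<in> N n" shows "gen_eval n x = \<zero>\<^bsub>fi_space V n\<^esub>"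
proof (rule R.fspan_induct[OF x[unfolded freeM_rel_def] rels_sub, where P = "\<lambda>x. gen_eval n x = \<zero>\<^bsub>fi_space V n\<^esub>"])
  interpret Module.module R "fi_space V n" by (rule fig_moduleD[OF V])
  note V' = fig_moduleD[OF V]
  show "gen_eval n (fzero R) = \<zero>\<^bsub>fi_space V n\<^esub>" by (rule gen_eval_zero)
  show "gen_eval n (fadd R c d) = \<zero>\<^bsub>fi_space V n\<^esub>"
    if "c \<in> fsupp R (S n)" "d \<in> fsupp R (S n)" "gen_eval n c = \<zero>\<^bsub>fi_space V n\<^esub>" "gen_eval n d = \<zero>\<^bsub>fi_space V n\<^esub>" for c d
    using gen_eval_lin(2)[OF that(1,2)] that(3,4) by simp
  show "gen_eval n (fsmult R a c) = \<zero>\<^bsub>fi_space V n\<^esub>"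
    if "a \<in> carrier R" "c \<in> fsupp R (S n)" "gen_eval n c = \<zero>\<^bsub>fi_space V n\<^esub>" for a c
    using gen_eval_lin(3)[OF that(1,2)] that by simp
  fix c assume "c \<in> tens_rels G R i (fi_space V i) (fi_map V i i) n"
  then show "gen_eval n c = \<zero>\<^bsub>fi_space V n\<^esub>"
  proof (cases rule: rels_cases)
    case (add \<phi> w w')
    note d = delta_in[OF add(2)]
    have "gen_eval n c = gen_eval n (fdelta R (\<phi>, w \<oplus>\<^bsub>fi_space V i\<^esub> w')) \<oplus>\<^bsub>fi_space V n\<^esub>
        (\<ominus>\<^bsub>fi_space V n\<^esub> (gen_eval n (fdelta R (\<phi>, w)) \<oplus>\<^bsub>fi_space V n\<^esub> gen_eval n (fdelta R (\<phi>, w'))))"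
      unfolding add(1) using d[OF add(3)] d[OF add(4)] d[OF W_closed(1)[OF add(3,4)]]
      by (simp add: gen_eval_lin(2) gen_eval_neg R.fneg_in R.fadd_in)
    then show ?thesis using V'(3)[OF add(2)] V'(4)[OF add(2-4)]
      by (simp add: gen_eval_delta[OF add(2)] add(3,4) W_closed(1) r_neg)
  next
    case (smult \<phi> a w)
    note d = delta_in[OF smult(2)]
    have "gen_eval n c = gen_eval n (fdelta R (\<phi>, a \<odot>\<^bsub>fi_space V i\<^esub> w)) \<oplus>\<^bsub>fi_space V n\<^esub>
        (\<ominus>\<^bsub>fi_space V n\<^esub> (a \<odot>\<^bsub>fi_space V n\<^esub> gen_eval n (fdelta R (\<phi>, w))))"
      unfolding smult(1) using d[OF smult(4)] d[OF W_closed(2)[OF smult(3,4)]] smult(3)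
      by (simp add: gen_eval_lin(2,3) gen_eval_neg R.fneg_in R.fsmult_in)
    then show ?thesis using V'(3)[OF smult(2)] V'(5)[OF smult(2,4,3)] smult(3)
      by (simp add: gen_eval_delta[OF smult(2)] smult(4) W_closed(2) r_neg)
  next
    case (bal \<phi> \<sigma> w)
    have d: "fdelta R (fig_comp G i \<phi> \<sigma>, w) \<in> fsupp R (S n)" "fdelta R (\<phi>, fi_map V i i \<sigma> w) \<in> fsupp R (S n)"
      using delta_in[OF fig_hom_comp[OF cover_G bal(2,3)] bal(4)] delta_in[OF bal(2) wact_closed[OF bal(3,4)]] .
    have "gen_eval n c = gen_eval n (fdelta R (fig_comp G i \<phi> \<sigma>, w)) \<oplus>\<^bsub>fi_space V n\<^esub>
        (\<ominus>\<^bsub>fi_space V n\<^esub> gen_eval n (fdelta R (\<phi>, fi_map V i i \<sigma> w)))"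
      unfolding bal(1) using d by (simp add: gen_eval_lin(2) gen_eval_neg R.fneg_in)
    then show ?thesis
      using V'(3)[OF bal(2) wact_closed[OF bal(3,4)]] V'(7)[OF bal(2-4)]
        gen_eval_delta[OF fig_hom_comp[OF cover_G bal(2,3)] bal(4)] gen_eval_delta[OF bal(2) wact_closed[OF bal(3,4)]]
      by (simp add: r_neg)
  qed
qed

lemma gen_eval_push:
  assumes \<psi>: "\<psi> \<in> fig_hom G n m" and c: "c \<in> fsupp R (S n)"
  shows "gen_eval m (push \<psi> c) = fi_map V n m \<psi> (gen_eval n c)"
  using c
proof (induction rule: R.fsupp_induct)
  note L = push_linear[OF \<psi>] and V' = fig_moduleD[OF V]
  {
    case zero show ?case unfolding R.flinear_zero[OF L] gen_eval_zero by (rule fi_map_zero[OF V \<psi>, symmetric])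
  next
    case (add c a x)
    obtain \<phi> w where x: "x = (\<phi>, w)" "\<phi> \<in> fig_hom G i n" "w \<in> carrier (fi_space V i)" using add.hyps(3) by blast
    have d: "fdelta R x \<in> fsupp R (S n)" by (rule R.fdelta_in) (rule add.hyps(3))
    have ad: "fsmult R a (fdelta R x) \<in> fsupp R (S n)" by (rule R.fsmult_in[OF d add.hyps(2)])
    have dm: "push \<psi> (fdelta R x) \<in> fsupp R (S m)" by (rule R.flinearD(1)[OF L d])
    have e: "gen_eval m (push \<psi> (fdelta R x)) = fi_map V n m \<psi> (gen_eval n (fdelta R x))"
      unfolding x(1) push_delta gen_eval_delta[OF x(2,3)] gen_eval_delta[OF fig_hom_comp[OF cover_G \<psi> x(2)] x(3)]
      by (rule V'(7)[OF \<psi> x(2,3), symmetric])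
    have "gen_eval m (push \<psi> (fadd R c (fsmult R a (fdelta R x)))) =
        gen_eval m (push \<psi> c) \<oplus>\<^bsub>fi_space V m\<^esub> a \<odot>\<^bsub>fi_space V m\<^esub> gen_eval m (push \<psi> (fdelta R x))"
      unfolding R.flinearD(2)[OF L add.hyps(1) ad] R.flinearD(3)[OF L add.hyps(2) d]
        gen_eval_lin(2)[OF R.flinearD(1)[OF L add.hyps(1)] R.fsmult_in[OF dm add.hyps(2)]] gen_eval_lin(3)[OF add.hyps(2) dm] ..
    also have "\<dots> = fi_map V n m \<psi> (gen_eval n (fadd R c (fsmult R a (fdelta R x))))"
      unfolding add.IH e gen_eval_lin(2)[OF add.hyps(1) ad] gen_eval_lin(3)[OF add.hyps(2) d]
        V'(5)[OF \<psi> gen_eval_lin(1)[OF d] add.hyps(2), symmetric]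
      using V'(4)[OF \<psi> gen_eval_lin(1)[OF add.hyps(1)] gen_eval_lin(1)[OF ad]] gen_eval_lin(3)[OF add.hyps(2) d] by simp
    finally show ?case .
  }
qed

text \<open>Evaluates a chosen representative; by \<open>gen_eval_N\<close> the value depends on the
  coset only, as \<open>cover_coset\<close> records.\<close>

definition cover :: "nat \<Rightarrow> ('g fimor \<times> 'v \<Rightarrow> 'k) set \<Rightarrow> 'v" where
  "cover n A = gen_eval n (SOME c. c \<in> A)"

lemma cover_coset:
  assumes c: "c \<in> fsupp R (S n)" shows "cover n (coset_of R (N n) c) = gen_eval n c"
proof -
  interpret abelian_group "fi_space V n" by (rule fig_moduleD[OF V])
  let ?d = "SOME d. d \<in> coset_of R (N n) c"
  have "?d \<in> coset_of R (N n) c" by (rule someI[of "\<lambda>d. d \<in> coset_of R (N n) c"]) (rule R.coset_self[OF N_sub c])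
  then obtain x where x: "x \<in> N n" "?d = fadd R c x" using R.coset_memE[OF N_sub c] by blast
  show ?thesis unfolding cover_def x(2) gen_eval_lin(2)[OF c R.fsubspaceD(1)[OF N_sub x(1)]] gen_eval_N[OF x(1)]
    using gen_eval_lin(1)[OF c] by simp
qed

lemma cover_hom: "fig_mod_hom G R (freeM G R i (fi_space V i) (fi_map V i i)) V cover"
  unfolding fig_mod_hom_def klinear_def
proof (intro conjI allI impI ballI funcsetI)
  have sp: "fi_space (freeM G R i (fi_space V i) (fi_map V i i)) n = R.fquot (S n) (N n)" for n
    by (simp add: freeM_def space_eq)
  {
    fix n A assume "A \<in> carrier (fi_space (freeM G R i (fi_space V i) (fi_map V i i)) n)"
    then obtain c where c: "c \<in> fsupp R (S n)" "A = coset_of R (N n) c" unfolding sp R.fquot_carrier by blast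
    show "cover n A \<in> carrier (fi_space V n)" unfolding c(2) cover_coset[OF c(1)] by (rule gen_eval_lin(1)[OF c(1)])
    show "cover n (a \<odot>\<^bsub>fi_space (freeM G R i (fi_space V i) (fi_map V i i)) n\<^esub> A) = a \<odot>\<^bsub>fi_space V n\<^esub> cover n A"
      if a: "a \<in> carrier R" for a
      unfolding sp c(2) R.fquot_ops(2)[OF N_sub c(1) a] cover_coset[OF c(1)] cover_coset[OF R.fsmult_in[OF c(1) a]]
      by (rule gen_eval_lin(3)[OF a c(1)])
    show "cover n (A \<oplus>\<^bsub>fi_space (freeM G R i (fi_space V i) (fi_map V i i)) n\<^esub> B) = cover n A \<oplus>\<^bsub>fi_space V n\<^esub> cover n B"
      if B: "B \<in> carrier (fi_space (freeM G R i (fi_space V i) (fi_map V i i)) n)" for B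
    proof -
      obtain d where d: "d \<in> fsupp R (S n)" "B = coset_of R (N n) d" using B unfolding sp R.fquot_carrier by blast
      show ?thesis unfolding sp c(2) d(2) R.fquot_ops(1)[OF N_sub c(1) d(1)] cover_coset[OF c(1)] cover_coset[OF d(1)]
          cover_coset[OF R.fadd_in[OF c(1) d(1)]]
        by (rule gen_eval_lin(2)[OF c(1) d(1)])
    qed
    show "cover m (fi_map (freeM G R i (fi_space V i) (fi_map V i i)) n m \<phi> A) = fi_map V n m \<phi> (cover n A)"
      if \<phi>: "\<phi> \<in> fig_hom G n m" for m \<phi>
      unfolding freeM_def fig_module.simps c(2) map_coset[OF \<phi> c(1)] cover_coset[OF c(1)]
        cover_coset[OF R.flinearD(1)[OF push_linear[OF \<phi>] c(1)]]
      by (rule gen_eval_push[OF \<phi> c(1)])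
  }
qed

lemma cover_onto:
  assumes v: "v \<in> carrier (fi_space V i)"
  shows "\<exists>A\<in>carrier (fi_space (freeM G R i (fi_space V i) (fi_map V i i)) i). cover i A = v"
proof -
  have d: "fdelta R (fig_id G i, v) \<in> fsupp R (S i)" by (rule delta_in[OF fig_id_hom[OF cover_G] v])
  have "cover i (coset_of R (N i) (fdelta R (fig_id G i, v))) = v"
    unfolding cover_coset[OF d] gen_eval_delta[OF fig_id_hom[OF cover_G] v] by (rule fig_moduleD(6)[OF V v])
  moreover have "coset_of R (N i) (fdelta R (fig_id G i, v)) \<in> carrier (fi_space (freeM G R i (fi_space V i) (fi_map V i i)) i)"
    using d by (simp add: freeM_def space_eq R.fquot_carrier)
  ultimately show ?thesis by blast
qed

end

section \<open>The two implications of the theorem\<close>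

lemma image_submodule:
  assumes F: "is_fig_module G R F" and V: "is_fig_module G R V" and p: "fig_mod_hom G R F V p"
  shows "fig_submodule G R V (\<lambda>n. p n ` carrier (fi_space F n))"
  unfolding fig_submodule_def
proof (intro conjI allI impI)
  note p' = fig_mod_homD[OF p]
  fix n
  interpret F: Module.module R "fi_space F n" by (rule fig_moduleD[OF F])
  show "submodule (p n ` carrier (fi_space F n)) R (fi_space V n)"
  proof (rule submodule_of_closed[OF fig_moduleD(1)[OF V]])
    show "p n ` carrier (fi_space F n) \<subseteq> carrier (fi_space V n)" using p'(1) by blast
    show "\<zero>\<^bsub>fi_space V n\<^esub> \<in> p n ` carrier (fi_space F n)"
      using fig_mod_hom_zero[OF F V p, of n] F.zero_closed by (metis imageI)
    fix x assume "x \<in> p n ` carrier (fi_space F n)"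
    then obtain x0 where x: "x0 \<in> carrier (fi_space F n)" "x = p n x0" by blast
    show "a \<odot>\<^bsub>fi_space V n\<^esub> x \<in> p n ` carrier (fi_space F n)" if a: "a \<in> carrier R" for a
      unfolding x(2) p'(3)[OF a x(1), symmetric] using F.smult_closed[OF a x(1)] by (rule imageI)
    fix y assume "y \<in> p n ` carrier (fi_space F n)"
    then obtain y0 where y: "y0 \<in> carrier (fi_space F n)" "y = p n y0" by blast
    show "x \<oplus>\<^bsub>fi_space V n\<^esub> y \<in> p n ` carrier (fi_space F n)"
      unfolding x(2) y(2) p'(2)[OF x(1) y(1), symmetric] using F.a_closed[OF x(1) y(1)] by (rule imageI)
  qed
next
  fix n m \<phi> v assume \<phi>: "\<phi> \<in> fig_hom G n m" and "v \<in> p n ` carrier (fi_space F n)"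
  then obtain x where x: "x \<in> carrier (fi_space F n)" "v = p n x" by blast
  show "fi_map V n m \<phi> v \<in> p m ` carrier (fi_space F m)"
    unfolding x(2) fig_mod_homD(4)[OF p \<phi> x(1), symmetric] using fig_moduleD(3)[OF F \<phi> x(1)] by (rule imageI)
qed

text \<open>Sums of modules M(W) have injective induced maps, so a coherent presentation is of the
  kind treated in \<open>torsion_bounded_of_presentation\<close>.\<close>

lemma dw_coherent_imp_td_finite:
  fixes G :: "'g monoid" and R :: "'k ring" and V :: "('g,'k,'v) fig_module"
  assumes G: "group G" and R: "cring R" and V: "is_fig_module G R V"
    and coh: "dw_coherent_in TYPE('i) TYPE('w) G R V"
  shows "td G V < \<infinity>"
proof -
  obtain I :: "'i set" and r N and W :: "'i \<Rightarrow> ('k,'w) module" and wact p where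
    W: "\<forall>i\<in>I. r i \<le> N \<and> kGr_module G R (r i) (W i) (wact i)"
    and p: "fig_mod_hom G R (dsum (\<lambda>i. freeM G R (r i) (W i) (wact i)) I) V p"
    and surj: "\<forall>n. p n ` carrier (fi_space (dsum (\<lambda>i. freeM G R (r i) (W i) (wact i)) I) n) = carrier (fi_space V n)"
    and gen: "gen_fin_degree G R (fig_kernel V (dsum (\<lambda>i. freeM G R (r i) (W i) (wact i)) I) p)"
    using coh unfolding dw_coherent_in_def by (elim exE conjE) (rule that)
  let ?F = "\<lambda>i. freeM G R (r i) (W i) (wact i)"
  have ff: "free_fig G R (r i) (W i) (wact i)" if "i \<in> I" for i
    by (rule free_fig.intro[OF G R]) (use W that in simp)
  have F: "is_fig_module G R (dsum ?F I)"
    by (rule dsum_is_fig_module[OF G R]) (rule free_fig.freeM_is_fig_module[OF ff])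
  show ?thesis unfolding td_finite_iff[OF G V]
  proof (rule torsion_bounded_of_presentation[OF G F V p surj[rule_format] _ gen])
    fix n m \<phi> x
    assume \<phi>: "\<phi> \<in> fig_hom G n m" and x: "x \<in> carrier (fi_space (dsum ?F I) n)"
      "fi_map (dsum ?F I) n m \<phi> x = \<zero>\<^bsub>fi_space (dsum ?F I) m\<^esub>"
    show "x = \<zero>\<^bsub>fi_space (dsum ?F I) n\<^esub>"
      by (rule dsum_torsion_free[OF _ x]) (rule free_fig.freeM_torsion_free[OF ff \<phi>])
  qed
qed

text \<open>The presentation is the sum of the canonical maps M(V_i) \<rightarrow> V for
  \<open>i \<le> N\<close>. Its image is a submodule containing V_n for \<open>n \<le> N\<close>,
  hence all of \<open>V\<close>.\<close>

lemma td_finite_imp_dw_coherent: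
  fixes G :: "'g monoid" and R :: "'k ring" and V :: "('g,'k,'v) fig_module"
  assumes G: "group G" and R: "cring R" and V: "is_fig_module G R V" and gen: "gen_fin_degree G R V"
    and td: "td G V < \<infinity>"
  shows "dw_coherent_in TYPE(nat) TYPE('v) G R V"
proof -
  obtain N where N: "gen_degree G R V N" using gen unfolding gen_fin_degree_iff by (elim exE)
  obtain C where C: "\<forall>n\<ge>C. \<forall>v. is_torsion G V n v \<longrightarrow> v = \<zero>\<^bsub>fi_space V n\<^esub>"
    using td unfolding td_finite_iff[OF G V] by (elim exE)
  define I :: "nat set" where "I = {..N}"
  let ?F = "\<lambda>i. freeM G R i (fi_space V i) (fi_map V i i)"
  have fc: "fig_cover G R V" by (rule fig_cover.intro[OF G R V])
  have kGr: "kGr_module G R i (fi_space V i) (fi_map V i i)" for i by (rule fig_cover.cover_kGr[OF fc])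
  have ff: "free_fig G R i (fi_space V i) (fi_map V i i)" for i by (rule free_fig.intro[OF G R kGr])
  have Fi: "is_fig_module G R (?F i)" for i by (rule free_fig.freeM_is_fig_module[OF ff])
  have F: "is_fig_module G R (dsum ?F I)" by (rule dsum_is_fig_module[OF G R Fi])
  have fI: "finite I" by (simp add: I_def)
  have genF: "gen_degree G R (dsum ?F I) N"
    by (rule gen_degree_dsum[OF G R Fi fI free_fig.gen_degree_freeM[OF ff]]) (simp add: I_def)
  define q where "q i = fig_cover.cover R V i" for i
  have q: "fig_mod_hom G R (?F i) V (q i)" for i unfolding q_def by (rule fig_cover.cover_hom[OF fc])
  define p where "p n x = (\<Oplus>\<^bsub>fi_space V n\<^esub>i\<in>I. q i n (x i))" for n x
  have p: "fig_mod_hom G R (dsum ?F I) V p"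
    unfolding p_def[abs_def] by (rule dsum_hom[OF G R Fi V fI q])
  have "carrier (fi_space V n) \<subseteq> p n ` carrier (fi_space (dsum ?F I) n)" if n: "n \<le> N" for n
  proof
    fix v assume v: "v \<in> carrier (fi_space V n)"
    obtain A where A: "A \<in> carrier (fi_space (?F n) n)" "q n n A = v"
      using fig_cover.cover_onto[OF fc v] unfolding q_def by blast
    interpret V: abelian_group "fi_space V n" by (rule fig_moduleD[OF V])
    have nI: "n \<in> I" using n by (simp add: I_def)
    have s: "dsingle ?F I n n A \<in> carrier (fi_space (dsum ?F I) n)"
      by (rule dsingle_in[where F = ?F, OF _ A(1)]) (rule Fi)
    \<comment> \<open>Only the summand with index \<open>n\<close> contributes, and there the
      canonical map takes \<open>A\<close> to \<open>v\<close>.\<close>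
    have "p n (dsingle ?F I n n A) = (\<Oplus>\<^bsub>fi_space V n\<^esub>i\<in>I. if n = i then v else \<zero>\<^bsub>fi_space V n\<^esub>)"
      unfolding p_def
    proof (rule V.add.finprod_cong')
      show "(\<lambda>i. if n = i then v else \<zero>\<^bsub>fi_space V n\<^esub>) \<in> I \<rightarrow> carrier (fi_space V n)" using v by auto
      show "q i n (dsingle ?F I n n A i) = (if n = i then v else \<zero>\<^bsub>fi_space V n\<^esub>)" if "i \<in> I" for i
        using that A(2) fig_mod_hom_zero[OF Fi V q, of i n] by (auto simp: dsingle_def)
    qed simp
    also have "\<dots> = v" using V.finsum_singleton[OF nI fI, of "\<lambda>_. v"] v by simp
    finally show "v \<in> p n ` carrier (fi_space (dsum ?F I) n)" using s by blast
  qed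
  then have surj: "p n ` carrier (fi_space (dsum ?F I) n) = carrier (fi_space V n)" for n
    using N[unfolded gen_degree_def, rule_format, of "\<lambda>n. p n ` carrier (fi_space (dsum ?F I) n)" n]
      image_submodule[OF F V p] by simp
  have K: "gen_fin_degree G R (fig_kernel V (dsum ?F I) p)"
    by (rule kernel_gen_fin_degree[OF G F V p surj genF, of C]) (use C in simp)
  show ?thesis unfolding dw_coherent_in_def
  proof (intro exI conjI)
    show "\<forall>i\<in>I. i \<le> N \<and> kGr_module G R i (fi_space V i) (fi_map V i i)" using kGr by (simp add: I_def)
  qed (use p surj K in simp_all)
qed

text \<open>Coherence carries the types of indices and of generators as parameters. It implies
  finite torsion degree for all choices of these types; conversely the presentation built from the
  V_i with \<open>i \<le> N\<close> uses \<open>nat\<close> and the element type of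
  \<open>V\<close>.\<close>

theorem theoremA:
  fixes G :: "'g monoid" and R :: "'k ring" and V :: "('g,'k,'v) fig_module"
  assumes "group G" and "cring R"
    and "is_fig_module G R V"
    and "gen_fin_degree G R V"
  shows "(dw_coherent_in TYPE('i) TYPE('w) G R V \<longrightarrow> td G V < \<infinity>)
       \<and> (td G V < \<infinity> \<longrightarrow> dw_coherent_in TYPE(nat) TYPE('v) G R V)"
  using dw_coherent_imp_td_finite[OF assms(1-3)] td_finite_imp_dw_coherent[OF assms] by blast

end
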